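(* Let $b \in \mathcal{T}$, i.e. let $b:\Gamma^*=[-1/2,1/2]\to\mathbb{R}$ be a continuous even function that is strictly increasing on $[0,1/2]$, and let $b^* := \int_{-1/2}^{1/2} b(q)\,dq \in \mathbb{R}$ be its mean value over $\Gamma^*$. Then for every real $B > \frac14 - b^*$ there exists a solution $V_{b,B} \in \mathcal{V}_B$ to the minimisation problem $$V_{b,B} \in \operatorname*{arg\,min}_{V \in \mathcal{V}_B} \mathcal{J}_b(V),$$ that is, there exists $V_{b,B}\in\mathcal{V}_B$ with $\mathcal{J}_b(V_{b,B}) \le \mathcal{J}_b(V)$ for all $V\in \mathcal{V}_B$.
   Context: Notation. $\Gamma := [-\pi,\pi)$ and $\Gamma^* := [-1/2,1/2]$. For $s\in\mathbb{R}$, $H^s_{\mathrm{per}}$ is the Sobolev space of complex-valued $2\pi$-periodic distributions $u$ on $\mathbb{R}$ with $\sum_{k\in\mathbb{Z}}(1+|k|^2)^s|\widehat u(k)|^2<\infty$, where $\widehat u(k)$ is the $k$-th normalised Fourier coefficient (normalised so that $\langle v,w\rangle_{L^2_{\mathrm{per}}}=\int_\Gamma \overline v w$); $L^2_{\mathrm{per}} := H^0_{\mathrm{per}}$; $H^s_{\mathrm{per},r}$ is the subset of real-valued elements ($\widehat u(-k)=\overline{\widehat u(k)}$ for all $k$). $\langle\cdot,\cdot\rangle_{H^{-1}_{\mathrm{per}},H^1_{\mathrm{per}}}$ is the bilinear duality pairing extending $\int_\Gamma V\phi$. Elements of $H^1_{\mathrm{per}}$ are continuous functions, and $H^1_{\mathrm{per}}$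 is an algebra. First band. For $V\in H^{-1}_{\mathrm{per},r}$ and $q\in\Gamma^*$, let $$a^V_q(v,w) := \int_\Gamma \overline{\left(-i\tfrac{d}{dx}+q\right)v}\,\left(-i\tfrac{d}{dx}+q\right)w \;+\; \langle V,\overline v w\rangle_{H^{-1}_{\mathrm{per}},H^1_{\mathrm{per}}},\qquad v,w\in H^1_{\mathrm{per}}.$$ This is a closed, bounded from below, symmetric form on $L^2_{\mathrm{per}}$; its associated self-adjoint operator $A^V_q$ (formally $|-i\frac{d}{dx}+q|^2+V$) has compact resolvent. Its lowest eigenvalue is $$\varepsilon^V_q := \min\{a^V_q(v,v) : v\in H^1_{\mathrm{per}},\ \|v\|_{L^2_{\mathrm{per}}}=1\}.$$ Potentials. $\mathcal{M}^+_{\mathrm{per}}$ is the set of non-negative regular Borel measures $\nu$ on $\mathbb{R}$ that are $2\pi$-periodic ($\nu(S+2\pi)=\nu(S)$ for every Borel set $S$) with $\nu(\Gamma)<\infty$. For $\nu\in\mathcal{M}^+_{\mathrm{per}}$, $V_\nu\in H^{-1}_{\mathrm{per},r}$ is defined by $\langle V_\nu,\phi\rangle_{H^{-1}_{\mathrm{per}},H^1_{\mathrm{per}}}=\int_\Gamma\phi\,d\nu$ for all $\phi\in H^1_{\mathrm{per}}$. For $B\in\mathbb{R}$, $$\mathcal{V}_B := \{V\in H^{-1}_{\mathrm{per},r} : \exists\,\nu\in\mathcal{M}^+_{\mathrm{per}},\ V=V_\nu-B\}.$$ Error functional. For $b\in\mathcal{T}$ and $V\in H^{-1}_{\mathrm{per},r}$,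 $$\mathcal{J}_b(V) := \frac12\int_{\Gamma^*}|b(q)-\varepsilon^V_q|^2\,dq = \int_0^{1/2}|b(q)-\varepsilon^V_q|^2\,dq.$$ *)

theory Defs
  imports "HOL-Analysis.Analysis"
begin

definition cell :: "real set"  (* \<Gamma> *)
  where "cell = {-pi..<pi}"

definition bzone :: "real set"  (* \<Gamma>* *)
  where "bzone = {-1/2..1/2}"

definition periodic :: "(real \<Rightarrow> 'a) \<Rightarrow> bool"
  where "periodic f \<longleftrightarrow> (\<forall>x. f (x + 2 * pi) = f x)"

definition D :: "(real \<Rightarrow> complex) \<Rightarrow> real \<Rightarrow> complex"
  where "D f = (\<lambda>x. vector_derivative f (at x))"

definition test_funs :: "(real \<Rightarrow> complex) set"
  where "test_funs = {\<phi>. periodic \<phi> \<and> (\<forall>n x. (D ^^ n) \<phi> differentiable (at x))}"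

text \<open>
  A periodic distribution is a continuous linear functional on the smooth periodic functions.
  It is made \<open>extensional\<close>, so that equality of distributions is equality of HOL functions.
\<close>

type_synonym distr = "(real \<Rightarrow> complex) \<Rightarrow> complex"

definition distributions :: "distr set"
  where "distributions = {T \<in> extensional test_funs.
     (\<forall>\<phi>\<in>test_funs. \<forall>\<psi>\<in>test_funs. T (\<lambda>x. \<phi> x + \<psi> x) = T \<phi> + T \<psi>) \<and>
     (\<forall>c. \<forall>\<phi>\<in>test_funs. T (\<lambda>x. c * \<phi> x) = c * T \<phi>) \<and>
     (\<exists>C N. \<forall>\<phi>\<in>test_funs. cmod (T \<phi>) \<le> C * (\<Sum>n\<le>N. SUP x. cmod ((D ^^ n) \<phi> x)))}"

definition distr_of_fun :: "(real \<Rightarrow> complex) \<Rightarrow> distr"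
  where "distr_of_fun f = (\<lambda>\<phi>\<in>test_funs. LINT x:cell|lborel. f x * \<phi> x)"

definition distr_diff :: "distr \<Rightarrow> distr \<Rightarrow> distr"
  where "distr_diff S T = (\<lambda>\<phi>\<in>test_funs. S \<phi> - T \<phi>)"

definition distr_deriv :: "distr \<Rightarrow> distr"
  where "distr_deriv T = (\<lambda>\<phi>\<in>test_funs. - T (D \<phi>))"

text \<open>
  Coefficients with respect to the orthonormal basis \<open>exp (i k x) / sqrt (2 pi)\<close>.
\<close>

definition fourier_coeff :: "distr \<Rightarrow> int \<Rightarrow> complex"
  where "fourier_coeff T k =
     T (\<lambda>x. exp (- \<i> * of_int k * of_real x) / of_real (sqrt (2 * pi)))"

definition sobolev_per :: "real \<Rightarrow> distr set"
  where "sobolev_per s = {T \<in> distributions.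
     (\<lambda>k. (1 + \<bar>real_of_int k\<bar>\<^sup>2) powr s * (cmod (fourier_coeff T k))\<^sup>2) summable_on UNIV}"

definition sobolev_per_real :: "real \<Rightarrow> distr set"
  where "sobolev_per_real s =
     {T \<in> sobolev_per s. \<forall>k. fourier_coeff T (- k) = cnj (fourier_coeff T k)}"

text \<open>
  Elements of the Sobolev space of order 1 are used through their continuous representatives.
\<close>

definition H1_per :: "(real \<Rightarrow> complex) set"
  where "H1_per = {v. continuous_on UNIV v \<and> periodic v \<and> distr_of_fun v \<in> sobolev_per 1}"

text \<open>
  The distributional derivative of an element of \<open>H1_per\<close> is an \<open>L\<^sup>2\<close> function, unique up to
  null sets; only integrals of the chosen representative occur below.
\<close>

definition L2_funs :: "(real \<Rightarrow> complex) set"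
  where "L2_funs = {g \<in> borel_measurable borel. periodic g \<and>
     set_integrable lborel cell (\<lambda>x. (cmod (g x))\<^sup>2)}"

definition weak_deriv :: "(real \<Rightarrow> complex) \<Rightarrow> real \<Rightarrow> complex"
  where "weak_deriv v =
     (SOME g. g \<in> L2_funs \<and> distr_of_fun g = distr_deriv (distr_of_fun v))"

definition momentum :: "real \<Rightarrow> (real \<Rightarrow> complex) \<Rightarrow> real \<Rightarrow> complex"  (* -i d/dx + q *)
  where "momentum q v = (\<lambda>x. - \<i> * weak_deriv v x + of_real q * v x)"

text \<open>
  The bilinear pairing of orders -1 and 1 (no conjugation, hence the index \<open>- k\<close>); by Parseval
  it is the integral of \<open>V * \<phi>\<close> over a period when \<open>V\<close> is an \<open>L\<^sup>2\<close> function.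
\<close>

definition pairing :: "distr \<Rightarrow> (real \<Rightarrow> complex) \<Rightarrow> complex"
  where "pairing V \<phi> =
     (\<Sum>\<^sub>\<infinity>k::int. fourier_coeff V k * fourier_coeff (distr_of_fun \<phi>) (- k))"

definition bloch_form :: "distr \<Rightarrow> real \<Rightarrow> (real \<Rightarrow> complex) \<Rightarrow> (real \<Rightarrow> complex) \<Rightarrow> complex"
  where "bloch_form V q v w =
     (LINT x:cell|lborel. cnj (momentum q v x) * momentum q w x)
     + pairing V (\<lambda>x. cnj (v x) * w x)"

definition L2_norm_per :: "(real \<Rightarrow> complex) \<Rightarrow> real"
  where "L2_norm_per v = sqrt (LINT x:cell|lborel. (cmod (v x))\<^sup>2)"

text \<open>
  \<open>bloch_form V q v v\<close> is real for real \<open>V\<close>; \<open>LEAST\<close> is the minimum of the set.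
\<close>

definition first_band :: "distr \<Rightarrow> real \<Rightarrow> real"
  where "first_band V q =
     (LEAST e. e \<in> {Re (bloch_form V q v v) | v. v \<in> H1_per \<and> L2_norm_per v = 1})"

definition regular_measure :: "real measure \<Rightarrow> bool"
  where "regular_measure \<nu> \<longleftrightarrow> (\<forall>S\<in>sets borel.
     emeasure \<nu> S = (SUP K\<in>{K. K \<subseteq> S \<and> compact K}. emeasure \<nu> K) \<and>
     emeasure \<nu> S = (INF U\<in>{U. S \<subseteq> U \<and> open U}. emeasure \<nu> U))"

definition periodic_measures :: "real measure set"
  where "periodic_measures = {\<nu>. sets \<nu> = sets borel \<and> regular_measure \<nu> \<and>
     (\<forall>S\<in>sets borel. emeasure \<nu> ((\<lambda>x. x + 2 * pi) ` S) = emeasure \<nu> S) \<and>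
     emeasure \<nu> cell < \<infinity>}"

definition is_potential_of :: "real measure \<Rightarrow> distr \<Rightarrow> bool"  (* V = V_\<nu> *)
  where "is_potential_of \<nu> V \<longleftrightarrow> V \<in> sobolev_per_real (-1) \<and>
     (\<forall>\<phi>\<in>H1_per. pairing V \<phi> = (LINT x:cell|\<nu>. \<phi> x))"

definition potentials :: "real \<Rightarrow> distr set"
  where "potentials B = {V \<in> sobolev_per_real (-1). \<exists>\<nu>\<in>periodic_measures. \<exists>W.
     is_potential_of \<nu> W \<and> V = distr_diff W (distr_of_fun (\<lambda>x. of_real B))}"

definition target_bands :: "(real \<Rightarrow> real) set"
  where "target_bands = {b. continuous_on bzone b \<and> (\<forall>q\<in>bzone. b (- q) = b q) \<and>
     strict_mono_on {0..1/2} b}"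

definition band_mean :: "(real \<Rightarrow> real) \<Rightarrow> real"
  where "band_mean b = (LINT q:bzone|lborel. b q)"

definition error_functional :: "(real \<Rightarrow> real) \<Rightarrow> distr \<Rightarrow> real"
  where "error_functional b V = 1/2 * (LINT q:bzone|lborel. \<bar>b q - first_band V q\<bar>\<^sup>2)"

end

theory Submission
  imports Defs "HOL-Probability.Probability"
begin

text \<open>
  A potential \<open>V = V_\<nu> - B\<close> enters the band function only through the restriction \<open>\<mu>\<close> of \<open>\<nu>\<close> to one
  period: the first band is \<open>ground_energy \<mu> q - B\<close>, where \<open>ground_energy \<mu> q\<close> is the minimum of
  \<open>\<integral> |(-i d/dx + q) v|\<^sup>2 dx + \<integral> |v|\<^sup>2 d\<mu>\<close> over normalised periodic \<open>v\<close>
  (\<open>potentials_first_band\<close>, \<open>potential_with_band\<close>). With \<open>\<beta> = b + B\<close> the task is to minimise the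
  mean square distance \<open>misfit \<beta> \<mu>\<close> between \<open>\<beta>\<close> and \<open>ground_energy \<mu>\<close> over all finite measures on the
  circle, and the hypothesis on \<open>B\<close> says that the mean of \<open>\<beta>\<close> exceeds \<open>1/4\<close>.

  This is the direct method. If a minimising sequence has bounded masses, it has a weakly
  convergent subsequence (\<open>weak_compactness\<close>). The ground energy is weakly continuous
  (\<open>ground_energy_weak_limit\<close>), because \<open>H\<^sup>1\<close> embeds compactly into the continuous functions, and
  dominated convergence in \<open>q\<close> shows that the limit is a minimiser.

  Large masses have to be excluded. If the mass of \<open>\<mu>\<close> is large compared with the ground energy, then the ground state \<open>v\<close>
  is small at some point \<open>x0\<close>. Shrinking the values of \<open>v\<close> by a small amount makes \<open>v\<close> vanish near \<open>x0\<close>;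
  there the circle can be cut open, and a phase factor with a jump at \<open>x0\<close> turns the result into an
  admissible function for any other quasimomentum, without increasing the energy. Hence the band
  is almost flat (\<open>ground_energy_flat\<close>). A flat band has misfit at least the variance \<open>spread \<beta>\<close> of \<open>\<beta>\<close>,
  so the masses are bounded along every sequence whose misfits stay below a number smaller than
  \<open>spread \<beta>\<close> (\<open>misfit_bounds_mass\<close>).

  It remains to find one measure with misfit strictly less than \<open>spread \<beta>\<close>
  (\<open>delta_mix_beats_constant\<close>). Let \<open>m > 1/4\<close> be the mean of \<open>\<beta>\<close> and take Lebesgue measure with density
  \<open>m - 1/4\<close> plus a point mass \<open>L\<close> at \<open>0\<close>. As \<open>L\<close> tends to infinity, the point mass forces a Dirichlet condition,
  whose ground energy on an interval of length \<open>2 \<pi>\<close> is \<open>1/4\<close> for every \<open>q\<close>, so the band tends to the constant \<open>m\<close>.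
  The first correction is explicit: the ground energy is \<open>m - g(q) / L + O(1/L\<^sup>2)\<close> with
  \<open>g = 2 \<pi> / \<tau>\<close> and \<open>\<tau>(q)\<close> the sum of \<open>1 / ((n + q)\<^sup>2 - 1/4)\<^sup>2\<close> over all integers \<open>n\<close>. It comes from the
  secular equation of a rank-one perturbation, in which the leading sum of \<open>1 / ((n + q)\<^sup>2 - 1/4)\<close>
  telescopes to zero (\<open>delta_comb_lower\<close>, \<open>delta_comb_upper\<close>). Therefore
  \<open>misfit = spread + (2/L) \<integral> (\<beta> - m) g + O(1/L\<^sup>2)\<close>. On \<open>[0, 1/2)\<close> the function \<open>\<beta>\<close> is strictly increasing and
  \<open>g\<close> is strictly decreasing (\<open>tau_strict_mono\<close>), so the integral is negative by Chebyshev's inequality, and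
  a large \<open>L\<close> gives misfit below \<open>spread \<beta>\<close>.
\<close>

section \<open>Integration over one period\<close>

text \<open>
  Restricting the measure, instead of writing set integrals over the cell, makes every
  periodic integral an integral against a finite Borel measure on the line.
\<close>

definition cell_measure :: "real measure \<Rightarrow> real measure"
  where "cell_measure \<nu> = density \<nu> (indicator cell)"

abbreviation lam :: "real measure" where "lam \<equiv> cell_measure lborel"

lemma cell_borel [measurable]: "cell \<in> sets borel"
  by (simp add: cell_def)

lemma sets_cell_measure [measurable_cong, simp]: "sets (cell_measure \<nu>) = sets \<nu>"
  by (simp add: cell_measure_def)

lemma space_cell_measure [simp]: "space (cell_measure \<nu>) = space \<nu>"
  by (simp add: cell_measure_def)

lemma emeasure_cell_measure:
  assumes "sets \<nu> = sets borel" "S \<in> sets borel"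
  shows "emeasure (cell_measure \<nu>) S = emeasure \<nu> (cell \<inter> S)"
proof -
  have [measurable_cong]: "sets \<nu> = sets borel" by fact
  have [measurable]: "S \<in> sets borel" by fact
  show ?thesis
    unfolding cell_measure_def using assms
    by (subst emeasure_density) (auto simp: indicator_inter_arith[symmetric])
qed

lemma set_integral_cell_measure:
  fixes f :: "real \<Rightarrow> 'a::{banach, second_countable_topology}"
  assumes "sets \<nu> = sets borel" "f \<in> borel_measurable borel"
  shows "(LINT x:cell|\<nu>. f x) = (\<integral>x. f x \<partial>cell_measure \<nu>)"
proof -
  have [measurable_cong]: "sets \<nu> = sets borel" by fact
  have [measurable]: "f \<in> borel_measurable borel" by fact
  have "(\<integral>x. f x \<partial>density \<nu> (\<lambda>x. ennreal (indicator cell x))) = (\<integral>x. indicator cell x *\<^sub>R f x \<partial>\<nu>)"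
    by (rule integral_density) auto
  moreover have "(\<lambda>x. ennreal (indicator cell x)) = (indicator cell :: real \<Rightarrow> ennreal)"
    by (auto simp: fun_eq_iff indicator_def)
  ultimately show ?thesis
    by (simp add: cell_measure_def set_lebesgue_integral_def)
qed

lemma set_integrable_cell_measure:
  fixes f :: "real \<Rightarrow> 'a::{banach, second_countable_topology}"
  assumes "sets \<nu> = sets borel" "f \<in> borel_measurable borel"
  shows "set_integrable \<nu> cell f \<longleftrightarrow> integrable (cell_measure \<nu>) f"
proof -
  have [measurable_cong]: "sets \<nu> = sets borel" by fact
  have [measurable]: "f \<in> borel_measurable borel" by fact
  have "integrable (density \<nu> (\<lambda>x. ennreal (indicator cell x))) f \<longleftrightarrow> integrable \<nu> (\<lambda>x. indicator cell x *\<^sub>R f x)"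
    by (rule integrable_density) auto
  moreover have "(\<lambda>x. ennreal (indicator cell x)) = (indicator cell :: real \<Rightarrow> ennreal)"
    by (auto simp: fun_eq_iff indicator_def)
  ultimately show ?thesis
    by (simp add: cell_measure_def set_integrable_def)
qed

lemma emeasure_lam: "emeasure lam UNIV = ennreal (2 * pi)"
  by (simp add: emeasure_cell_measure cell_def)

lemma finite_measure_lam: "finite_measure lam"
  by (rule finite_measureI) (simp add: emeasure_lam)

lemma measure_lam: "measure lam UNIV = 2 * pi"
  by (simp add: measure_def emeasure_lam)

text \<open>
  The continuous functions on the circle, with no smoothness implied.
\<close>

definition cper :: "(real \<Rightarrow> 'a::real_normed_vector) \<Rightarrow> bool"
  where "cper v \<longleftrightarrow> continuous_on UNIV v \<and> periodic v"

lemma periodic_int: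
  assumes "periodic f"
  shows "f (x + 2 * pi * of_int n) = f x"
proof -
  have nat: "f (x + 2 * pi * real m) = f x" for m x
  proof (induction m)
    case (Suc m)
    have "f (x + 2 * pi * real (Suc m)) = f ((x + 2 * pi * real m) + 2 * pi)"
      by (simp add: algebra_simps)
    then show ?case using assms Suc by (simp add: periodic_def)
  qed simp
  show ?thesis
  proof (cases "n \<ge> 0")
    case True
    then show ?thesis using nat[of x "nat n"] by simp
  next
    case False
    then show ?thesis using nat[of "x + 2 * pi * of_int n" "nat (- n)"] by simp
  qed
qed

lemma cell_representative:
  obtains y n where "y \<in> cell" "x = y + 2 * pi * of_int n"
proof
  let ?n = "\<lfloor>(x + pi) / (2 * pi)\<rfloor>"
  have "of_int ?n \<le> (x + pi) / (2 * pi)" "(x + pi) / (2 * pi) < of_int ?n + 1"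
    by linarith+
  then have "of_int ?n * (2 * pi) \<le> x + pi" "x + pi < (of_int ?n + 1) * (2 * pi)"
    by (simp_all only: pos_le_divide_eq pos_divide_less_eq pi_gt_zero mult_pos_pos zero_less_numeral)
  then show "x - 2 * pi * of_int ?n \<in> cell"
    by (simp add: cell_def algebra_simps)
qed auto

lemma cper_bounded:
  assumes "cper v"
  obtains B where "B > 0" "\<And>x. norm (v x) \<le> B"
proof -
  have "compact (v ` {-pi..pi})"
    using assms by (intro compact_continuous_image) (auto simp: cper_def intro: continuous_on_subset)
  then obtain B where B: "B > 0" "\<And>x. x \<in> {-pi..pi} \<Longrightarrow> norm (v x) \<le> B"
    by (auto dest!: compact_imp_bounded simp: bounded_pos)
  have "norm (v x) \<le> B" for x
  proof -
    obtain y n where "y \<in> cell" "x = y + 2 * pi * of_int n" by (rule cell_representative)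
    then show ?thesis using B(2)[of y] periodic_int[of v y n] assms by (auto simp: cper_def cell_def)
  qed
  then show ?thesis using B(1) that by blast
qed

lemma cper_measurable [measurable_dest]: "cper v \<Longrightarrow> v \<in> borel_measurable borel"
  by (simp add: cper_def borel_measurable_continuous_onI)

lemma finite_integrable_bounded:
  fixes f :: "real \<Rightarrow> 'a::{banach, second_countable_topology}"
  assumes "finite_measure \<mu>" "sets \<mu> = sets borel" "f \<in> borel_measurable borel" "\<And>x. norm (f x) \<le> B"
  shows "integrable \<mu> f"
proof -
  interpret finite_measure \<mu> by fact
  have [measurable_cong]: "sets \<mu> = sets borel" by fact
  show ?thesis using assms by (intro integrable_const_bound[of f B]) auto
qed

lemma cper_integrable:
  fixes f :: "real \<Rightarrow> 'a::{banach, second_countable_topology}"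
  assumes "finite_measure \<mu>" "sets \<mu> = sets borel" "cper f"
  shows "integrable \<mu> f"
proof -
  obtain B where "\<And>x. norm (f x) \<le> B" using cper_bounded[OF assms(3)] by blast
  then show ?thesis using assms by (intro finite_integrable_bounded[of \<mu> f B]) auto
qed

lemma cper_cis: "cper (\<lambda>x. cis (of_int k * x))"
proof -
  have "cis (of_int k * (x + 2 * pi)) = cis (of_int k * x)" for x
  proof -
    have "cis (of_int k * (x + 2 * pi)) = cis (of_int k * x) * cis (2 * pi * of_int k)"
      by (simp add: cis_mult algebra_simps)
    then show ?thesis by (simp add: cis_multiple_2pi)
  qed
  then show ?thesis by (auto simp: cper_def periodic_def intro!: continuous_intros)
qed

lemma cper_const [intro, simp]: "cper (\<lambda>x. c)"
  by (simp add: cper_def periodic_def)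

lemma cper_mult: "cper f \<Longrightarrow> cper g \<Longrightarrow> cper (\<lambda>x. f x * (g x :: 'a::real_normed_algebra))"
  by (auto simp: cper_def periodic_def intro!: continuous_intros)

lemma cper_add: "cper f \<Longrightarrow> cper g \<Longrightarrow> cper (\<lambda>x. f x + g x)"
  by (auto simp: cper_def periodic_def intro!: continuous_intros)

lemma cper_diff: "cper f \<Longrightarrow> cper g \<Longrightarrow> cper (\<lambda>x. f x - g x)"
  by (auto simp: cper_def periodic_def intro!: continuous_intros)

lemma cper_cnj: "cper f \<Longrightarrow> cper (\<lambda>x. cnj (f x))"
  by (auto simp: cper_def periodic_def intro!: continuous_intros)

lemma cper_norm: "cper f \<Longrightarrow> cper (\<lambda>x. norm (f x))"
  by (auto simp: cper_def periodic_def intro!: continuous_intros)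

lemma cper_power: "cper f \<Longrightarrow> cper (\<lambda>x. (f x :: real) ^ n)"
  by (auto simp: cper_def periodic_def intro!: continuous_intros)

lemma cper_shift: "cper f \<Longrightarrow> cper (\<lambda>x. f (x + h))"
  unfolding cper_def periodic_def
  by (auto intro!: continuous_intros continuous_on_compose2[of UNIV f] simp: algebra_simps)
     (metis add.assoc add.commute)

lemma cper_cis': "cper (\<lambda>x. cis (- (of_int k * x)))"
  using cper_cis[of "- k"] by simp

lemmas cper_intros = cper_cis cper_cis' cper_const cper_mult cper_add cper_diff cper_cnj cper_norm cper_power cper_shift

lemma lam_integral_eq_HK:
  fixes f :: "real \<Rightarrow> 'a::euclidean_space"
  assumes "continuous_on UNIV f"
  shows "(\<integral>x. f x \<partial>lam) = integral {-pi..pi} f"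
proof -
  have m: "f \<in> borel_measurable borel" using assms by (rule borel_measurable_continuous_onI)
  have int: "set_integrable lborel {-pi..pi} f"
    using assms unfolding set_integrable_def
    by (intro borel_integrable_compact) (auto intro: continuous_on_subset)
  have "(\<integral>x. f x \<partial>lam) = (LINT x:cell|lborel. f x)"
    using m by (simp add: set_integral_cell_measure)
  also have "\<dots> = (LINT x:{-pi..pi}|lborel. f x)"
    by (rule set_integral_discrete_difference[where X = "{pi}"]) (auto simp: cell_def)
  also have "\<dots> = integral {-pi..pi} f"
    using int by (rule set_borel_integral_eq_integral(2))
  finally show ?thesis .
qed

text \<open>
  Periodicity moves the piece of the shifted interval that sticks out on the right back to the
  gap on the left.
\<close>

lemma lam_integral_shift:
  fixes f :: "real \<Rightarrow> 'a::euclidean_space"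
  assumes "cper f" "h \<ge> 0"
  shows "(\<integral>x. f (x + h) \<partial>lam) = (\<integral>x. f x \<partial>lam)"
proof -
  have c: "continuous_on A f" for A using assms by (auto simp: cper_def intro: continuous_on_subset)
  have io: "f integrable_on {a..b}" for a b by (intro integrable_continuous_real c)
  have sh: "integral {a..b} (\<lambda>x. f (x + t)) = integral {a + t..b + t} f" for a b t
    using integral_shift_real_ivl[of "a + t" t "b + t" f] by simp
  have "(\<integral>x. f (x + h) \<partial>lam) = integral {-pi..pi} (\<lambda>x. f (x + h))"
    using cper_shift[OF assms(1), of h] by (intro lam_integral_eq_HK) (auto simp: cper_def)
  also have "\<dots> = integral {-pi + h..pi + h} f" by (rule sh)
  also have "\<dots> = integral {-pi..pi + h} f - integral {-pi..-pi + h} f"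
    using Henstock_Kurzweil_Integration.integral_combine[of "-pi" "-pi + h" "pi + h" f] assms(2) io pi_gt_zero by (simp add: algebra_simps)
  also have "integral {-pi..-pi + h} f = integral {-pi..-pi + h} (\<lambda>x. f (x + 2 * pi))"
    using assms(1) by (simp add: cper_def periodic_def)
  also have "\<dots> = integral {pi..pi + h} f" by (subst sh) (simp add: algebra_simps)
  also have "integral {-pi..pi + h} f - integral {pi..pi + h} f = integral {-pi..pi} f"
    using Henstock_Kurzweil_Integration.integral_combine[of "-pi" "pi" "pi + h" f] assms(2) io pi_gt_zero by (simp add: algebra_simps)
  also have "\<dots> = (\<integral>x. f x \<partial>lam)"
    using assms by (intro lam_integral_eq_HK[symmetric]) (auto simp: cper_def)
  finally show ?thesis .
qed

lemma integral_cis: "(\<integral>x. cis (of_int k * x) \<partial>lam) = (if k = 0 then 2 * of_real pi else 0)"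
proof (cases "k = 0")
  case True
  then show ?thesis by (simp add: scaleR_conv_of_real measure_lam)
next
  case False
  let ?F = "\<lambda>x. cis (of_int k * x) / (\<i> * of_int k)"
  have "(?F has_vector_derivative cis (of_int k * x)) (at x within A)" for x A
  proof -
    have "((\<lambda>x. exp (\<i> * of_int k * of_real x) / (\<i> * of_int k)) has_vector_derivative 
       exp (\<i> * of_int k * of_real x)) (at x within A)"
      using False by (auto intro!: derivative_eq_intros has_vector_derivative_real_field simp: field_simps)
    then show ?thesis by (simp add: cis_conv_exp mult.assoc)
  qed
  then have "((\<lambda>x. cis (of_int k * x)) has_integral (?F pi - ?F (-pi))) {-pi..pi}"
    by (intro fundamental_theorem_of_calculus) auto
  moreover have "?F pi = ?F (-pi)"
    using periodic_int[of "\<lambda>x. cis (of_int k * x)" "-pi" 1] cper_cis[of k] by (simp add: cper_def)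
  ultimately have "integral {-pi..pi} (\<lambda>x. cis (of_int k * x)) = 0"
    by (simp add: integral_unique)
  moreover have "(\<integral>x. cis (of_int k * x) \<partial>lam) = integral {-pi..pi} (\<lambda>x. cis (of_int k * x))"
    by (intro lam_integral_eq_HK continuous_intros)
  ultimately show ?thesis using False by simp
qed

section \<open>Fourier coefficients: Bessel and Parseval\<close>

text \<open>
  Normalised so that \<open>v\<close> is the sum of \<open>fc v k * cis (k x)\<close>; this differs by the factor
  \<open>sqrt (2 \<pi>)\<close> from \<open>fourier_coeff\<close>, see \<open>fourier_coeff_distr_of_fun\<close>.
\<close>

definition fc :: "(real \<Rightarrow> complex) \<Rightarrow> int \<Rightarrow> complex"
  where "fc v k = (\<integral>x. v x * cis (- (of_int k * x)) \<partial>lam) / (2 * of_real pi)"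

definition fsum :: "(int \<Rightarrow> complex) \<Rightarrow> real \<Rightarrow> complex"
  where "fsum c x = (\<Sum>\<^sub>\<infinity>k. c k * cis (of_int k * x))"

lemma lam_sets_borel [simp]: "sets lam = sets borel" by simp

lemma measurable_cell_measure:
  assumes "sets \<nu> = sets borel"
  shows "borel_measurable (cell_measure \<nu>) = borel_measurable borel"
  using assms by (intro measurable_cong_sets) auto

lemma measurable_lam [simp]: "borel_measurable lam = borel_measurable borel"
  by (rule measurable_cell_measure) simp

lemma lam_integrable_of_square:
  fixes f :: "real \<Rightarrow> complex"
  assumes "f \<in> borel_measurable borel" "integrable lam (\<lambda>x. (cmod (f x))\<^sup>2)"
  shows "integrable lam f"
proof (rule Bochner_Integration.integrable_bound)
  show "integrable lam (\<lambda>x. 1 + (cmod (f x))\<^sup>2)"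
    using assms(2) cper_integrable[OF finite_measure_lam, of "\<lambda>x. 1::real"] by auto
  have "cmod z \<le> 1 + (cmod z)\<^sup>2" for z
    using sum_squares_bound[of "cmod z" 1] norm_ge_zero[of z] unfolding power_one mult_1_right by linarith
  then show "AE x in lam. norm (f x) \<le> norm (1 + (cmod (f x))\<^sup>2)"
    by (auto intro!: AE_I2 order_trans[OF _ abs_ge_self])
qed (use assms in auto)

lemma lam_integrable_mult_cis:
  assumes "f \<in> borel_measurable borel" "integrable lam f"
  shows "integrable lam (\<lambda>x. f x * cis (of_int k * x))"
  by (rule Bochner_Integration.integrable_bound[OF assms(2)])
     (use assms(1) in \<open>auto simp: norm_mult cper_measurable[OF cper_cis] intro!: borel_measurable_times\<close>)

lemma integral_four_terms:
  fixes a b c d :: "'a \<Rightarrow> complex"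
  assumes "integrable M a" "integrable M b" "integrable M c" "integrable M d"
  shows "(\<integral>x. a x - b x - c x + d x \<partial>M) = integral\<^sup>L M a - integral\<^sup>L M b - integral\<^sup>L M c + integral\<^sup>L M d"
  using assms by simp

lemma cmod_diff_square:
  "complex_of_real ((cmod (a - b))\<^sup>2) = of_real ((cmod a)\<^sup>2) - a * cnj b - cnj (a * cnj b) + b * cnj b"
  by (simp only: complex_norm_square) (simp add: algebra_simps)

text \<open>
  Expand the nonnegative square integral of \<open>f - p\<close>, with \<open>p\<close> the finite Fourier sum over \<open>F\<close>: the two mixed terms and
  the square of \<open>p\<close> all equal \<open>2 \<pi>\<close> times the sum of the squared coefficients.
\<close>

lemma bessel_inequality:
  assumes m: "f \<in> borel_measurable borel" and sq: "integrable lam (\<lambda>x. (cmod (f x))\<^sup>2)" and F: "finite F"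
  shows "2 * pi * (\<Sum>k\<in>F. (cmod (fc f k))\<^sup>2) \<le> (\<integral>x. (cmod (f x))\<^sup>2 \<partial>lam)"
proof -
  define p where "p x = (\<Sum>k\<in>F. fc f k * cis (of_int k * x))" for x
  define S where "S = (\<Sum>k\<in>F. (cmod (fc f k))\<^sup>2)"
  have fi: "integrable lam f" using m sq by (rule lam_integrable_of_square)
  have fk: "integrable lam (\<lambda>x. f x * cis (- (of_int k * x)))" for k
    using lam_integrable_mult_cis[OF m fi, of "- k"] by simp
  have fp: "f x * cnj (p x) = (\<Sum>k\<in>F. cnj (fc f k) * (f x * cis (- (of_int k * x))))" for x
    by (simp add: p_def sum_distrib_left cis_cnj mult_ac)
  have ifp: "integrable lam (\<lambda>x. f x * cnj (p x))"
    unfolding fp by (intro Bochner_Integration.integrable_sum integrable_mult_right fk)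
  have "(\<integral>x. f x * cnj (p x) \<partial>lam) = (\<Sum>k\<in>F. cnj (fc f k) * (2 * of_real pi * fc f k))"
    unfolding fp by (subst Bochner_Integration.integral_sum) (auto intro!: integrable_mult_right fk simp: fc_def)
  also have "\<dots> = of_real (2 * pi * S)"
    unfolding S_def of_real_mult of_real_sum sum_distrib_left
    by (intro sum.cong) (simp_all only: complex_norm_square, simp_all)
  finally have 1: "(\<integral>x. f x * cnj (p x) \<partial>lam) = of_real (2 * pi * S)" .
  have 3: "(\<integral>x. cnj (f x * cnj (p x)) \<partial>lam) = of_real (2 * pi * S)"
    by (subst Bochner_Integration.integral_cnj) (simp only: 1 complex_cnj_complex_of_real)
  have pp: "p x * cnj (p x) = (\<Sum>k\<in>F. \<Sum>l\<in>F. fc f k * cnj (fc f l) * cis (of_int (k - l) * x))" for x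
    unfolding p_def cnj_sum sum_product
    by (intro sum.cong refl) (simp add: cis_cnj cis_mult algebra_simps)
  have ipp: "integrable lam (\<lambda>x. p x * cnj (p x))"
    unfolding pp
    by (intro Bochner_Integration.integrable_sum integrable_mult_right cper_integrable finite_measure_lam cper_cis) simp
  have "(\<integral>x. p x * cnj (p x) \<partial>lam) = (\<Sum>k\<in>F. \<Sum>l\<in>F. fc f k * cnj (fc f l) * (if k - l = 0 then 2 * of_real pi else 0))"
    unfolding pp
    by (subst Bochner_Integration.integral_sum, intro Bochner_Integration.integrable_sum integrable_mult_right cper_integrable finite_measure_lam cper_cis, simp)
       (subst Bochner_Integration.integral_sum, intro integrable_mult_right cper_integrable finite_measure_lam cper_cis, simp, simp only: integral_mult_right_zero integral_cis)
  also have "\<dots> = (\<Sum>k\<in>F. \<Sum>l\<in>F. if k = l then 2 * of_real pi * (fc f k * cnj (fc f k)) else 0)"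
    by (intro sum.cong refl) auto
  also have "\<dots> = of_real (2 * pi * S)"
    unfolding S_def of_real_mult of_real_sum sum_distrib_left using F
    by (simp only: sum.delta complex_norm_square) simp
  finally have 2: "(\<integral>x. p x * cnj (p x) \<partial>lam) = of_real (2 * pi * S)" .
  have "complex_of_real (\<integral>x. (cmod (f x - p x))\<^sup>2 \<partial>lam) = (\<integral>x. of_real ((cmod (f x - p x))\<^sup>2) \<partial>lam)"
    by (rule integral_complex_of_real[symmetric])
  also have "\<dots> = (\<integral>x. of_real ((cmod (f x))\<^sup>2) - f x * cnj (p x) - cnj (f x * cnj (p x)) + p x * cnj (p x) \<partial>lam)"
    by (simp only: cmod_diff_square)
  also have "\<dots> = (\<integral>x. of_real ((cmod (f x))\<^sup>2) \<partial>lam) - (\<integral>x. f x * cnj (p x) \<partial>lam) - (\<integral>x. cnj (f x * cnj (p x)) \<partial>lam) + (\<integral>x. p x * cnj (p x) \<partial>lam)"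
    by (rule integral_four_terms) (use ifp ipp sq in \<open>simp_all del: complex_cnj_mult of_real_power add: complex_integrable_cnj\<close>)
  also have "\<dots> = of_real ((\<integral>x. (cmod (f x))\<^sup>2 \<partial>lam) - 2 * pi * S)"
    unfolding 1 2 3 integral_complex_of_real by simp
  finally have "(\<integral>x. (cmod (f x - p x))\<^sup>2 \<partial>lam) = (\<integral>x. (cmod (f x))\<^sup>2 \<partial>lam) - 2 * pi * S"
    by (simp only: of_real_eq_iff)
  moreover have "(\<integral>x. (cmod (f x - p x))\<^sup>2 \<partial>lam) \<ge> 0" by simp
  ultimately show ?thesis by (simp add: S_def)
qed

text \<open>
  Dominated convergence is available for sequences, while sums over the integers are unordered;
  enumerating the integers by \<open>int_decode\<close> connects the two.
\<close>

lemma has_sum_integral: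
  fixes f :: "int \<Rightarrow> real \<Rightarrow> complex"
  assumes "finite_measure \<mu>" "sets \<mu> = sets borel" "\<And>k. f k \<in> borel_measurable borel"
    and bd: "\<And>k x. cmod (f k x) \<le> a k" and a: "a summable_on UNIV"
  shows "((\<lambda>k. \<integral>x. f k x \<partial>\<mu>) has_sum (\<integral>x. (\<Sum>\<^sub>\<infinity>k. f k x) \<partial>\<mu>)) UNIV"
proof -
  interpret finite_measure \<mu> by fact
  have i: "integrable \<mu> (f k)" for k
    using assms by (intro finite_integrable_bounded[where B = "a k"]) auto
  have "(a \<circ> int_decode) summable_on UNIV"
    using a bij_int_decode by (simp add: o_def summable_on_reindex_bij_betw)
  then have sa: "summable (\<lambda>n. a (int_decode n))"
    by (auto dest: summable_on_imp_summable simp: o_def)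
  have sn: "summable (\<lambda>n. norm (f (int_decode n) x))" for x
    by (rule summable_comparison_test'[OF sa, of 0]) (use bd in auto)
  have iN: "norm (\<integral>x. norm (f k x) \<partial>\<mu>) \<le> a k * measure \<mu> (space \<mu>)" for k
  proof -
    have "(\<integral>x. norm (f k x) \<partial>\<mu>) \<le> (\<integral>x. a k \<partial>\<mu>)"
      using i bd by (intro integral_mono) auto
    then show ?thesis by (simp add: mult.commute)
  qed
  have sI: "summable (\<lambda>n. \<integral>x. norm (f (int_decode n) x) \<partial>\<mu>)"
    by (rule summable_comparison_test'[OF summable_mult2[OF sa, of "measure \<mu> (space \<mu>)"], of 0]) (use iN in auto)
  have "(\<lambda>n. \<integral>x. f (int_decode n) x \<partial>\<mu>) sums (\<integral>x. (\<Sum>n. f (int_decode n) x) \<partial>\<mu>)"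
    by (rule sums_integral) (use i sn sI in auto)
  moreover have "summable (\<lambda>n. norm (\<integral>x. f (int_decode n) x \<partial>\<mu>))"
    by (rule summable_comparison_test'[OF sI, of 0]) (auto intro!: integral_norm_bound)
  ultimately have "((\<lambda>n. \<integral>x. f (int_decode n) x \<partial>\<mu>) has_sum (\<integral>x. (\<Sum>n. f (int_decode n) x) \<partial>\<mu>)) UNIV"
    by (intro norm_summable_imp_has_sum)
  moreover have "(\<Sum>n. f (int_decode n) x) = (\<Sum>\<^sub>\<infinity>k. f k x)" for x
  proof -
    have "((\<lambda>n. f (int_decode n) x) has_sum (\<Sum>n. f (int_decode n) x)) UNIV"
      by (rule norm_summable_imp_has_sum[OF sn summable_sums[OF summable_norm_cancel[OF sn]]])
    then show ?thesis
      using has_sum_reindex_bij_betw[OF bij_int_decode, of "\<lambda>k. f k x"] by (metis infsumI)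
  qed
  ultimately show ?thesis
    using has_sum_reindex_bij_betw[OF bij_int_decode, of "\<lambda>k. \<integral>x. f k x \<partial>\<mu>"] by simp
qed

lemma fsum_has_sum:
  assumes "(\<lambda>k. cmod (c k)) summable_on UNIV"
  shows "((\<lambda>k. c k * cis (of_int k * x)) has_sum fsum c x) UNIV"
  unfolding fsum_def
  by (rule has_sum_infsum[OF abs_summable_summable]) (use assms in \<open>simp add: norm_mult\<close>)

lemma cper_fsum:
  assumes "(\<lambda>k. cmod (c k)) summable_on UNIV"
  shows "cper (fsum c)"
proof -
  have "uniform_limit UNIV (\<lambda>X y. \<Sum>k\<in>X. c k * cis (of_int k * y)) (fsum c) (finite_subsets_at_top UNIV)"
    unfolding fsum_def by (rule Weierstrass_m_test_general[OF _ assms]) (simp add: norm_mult)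
  then have "continuous_on UNIV (fsum c)"
    by (rule uniform_limit_theorem[rotated]) (auto intro!: always_eventually continuous_intros)
  moreover have "fsum c (x + 2 * pi) = fsum c x" for x
    using cper_cis unfolding fsum_def cper_def periodic_def by simp
  ultimately show ?thesis by (simp add: cper_def periodic_def)
qed

lemma fsum_bound:
  assumes "(\<lambda>k. cmod (c k)) summable_on UNIV"
  shows "cmod (fsum c x) \<le> (\<Sum>\<^sub>\<infinity>k. cmod (c k))"
  using norm_infsum_bound[of "\<lambda>k. c k * cis (of_int k * x)" UNIV] assms by (simp add: fsum_def norm_mult)

lemma fsum_integral:
  assumes c: "(\<lambda>k. cmod (c k)) summable_on UNIV" and \<mu>: "finite_measure \<mu>" "sets \<mu> = sets borel"
    and f: "f \<in> borel_measurable borel" "\<And>x. cmod (f x) \<le> B"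
  shows "((\<lambda>k. c k * (\<integral>x. f x * cis (of_int k * x) \<partial>\<mu>)) has_sum (\<integral>x. f x * fsum c x \<partial>\<mu>)) UNIV"
proof -
  have [measurable]: "f \<in> borel_measurable borel" by fact
  have "((\<lambda>k. \<integral>x. c k * (f x * cis (of_int k * x)) \<partial>\<mu>) has_sum (\<integral>x. (\<Sum>\<^sub>\<infinity>k. c k * (f x * cis (of_int k * x))) \<partial>\<mu>)) UNIV"
  proof (rule has_sum_integral[OF \<mu>, where a = "\<lambda>k. cmod (c k) * B"])
    show "(\<lambda>k. cmod (c k) * B) summable_on UNIV" using c by (rule summable_on_cmult_left)
    show "(\<lambda>x. c k * (f x * cis (of_int k * x))) \<in> borel_measurable borel" for k
      using cper_measurable[OF cper_cis] f by (intro borel_measurable_times) auto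
    show "cmod (c k * (f x * cis (of_int k * x))) \<le> cmod (c k) * B" for k x
      using f(2) by (auto simp: norm_mult intro!: mult_left_mono)
  qed
  moreover have "(\<Sum>\<^sub>\<infinity>k. c k * (f x * cis (of_int k * x))) = f x * fsum c x" for x
    unfolding fsum_def by (subst infsum_cmult_right'[symmetric]) (simp add: mult_ac)
  ultimately show ?thesis by simp
qed

lemma integral_cis_mult: "(\<integral>x. cis (- (of_int k * x)) * cis (of_int l * x) \<partial>lam) = (if l = k then 2 * of_real pi else 0)"
  using integral_cis[of "l - k"] by (simp add: cis_mult algebra_simps)

lemma fc_fsum:
  assumes c: "(\<lambda>k. cmod (c k)) summable_on UNIV"
  shows "fc (fsum c) k = c k"
proof -
  have "((\<lambda>l. c l * (\<integral>x. cis (- (of_int k * x)) * cis (of_int l * x) \<partial>lam)) has_sum (\<integral>x. cis (- (of_int k * x)) * fsum c x \<partial>lam)) UNIV"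
    using cper_measurable[OF cper_cis'] by (intro fsum_integral[OF c finite_measure_lam, of _ 1]) auto
  moreover have "((\<lambda>l. c l * (\<integral>x. cis (- (of_int k * x)) * cis (of_int l * x) \<partial>lam)) has_sum c k * (2 * of_real pi)) UNIV"
    unfolding integral_cis_mult by (rule has_sum_finite_neutralI[where B = "{k}"]) auto
  ultimately have "(\<integral>x. cis (- (of_int k * x)) * fsum c x \<partial>lam) = c k * (2 * of_real pi)"
    by (rule has_sum_unique)
  then show ?thesis by (simp add: fc_def mult.commute)
qed

lemma parseval_fsum:
  assumes c: "(\<lambda>k. cmod (c k)) summable_on UNIV"
  shows "((\<lambda>k. 2 * pi * (cmod (c k))\<^sup>2) has_sum (\<integral>x. (cmod (fsum c x))\<^sup>2 \<partial>lam)) UNIV"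
proof -
  let ?v = "fsum c"
  have "((\<lambda>k. c k * (\<integral>x. cnj (?v x) * cis (of_int k * x) \<partial>lam)) has_sum (\<integral>x. cnj (?v x) * ?v x \<partial>lam)) UNIV"
    by (rule fsum_integral[OF c finite_measure_lam lam_sets_borel cper_measurable[OF cper_cnj[OF cper_fsum[OF c]]], where B = "\<Sum>\<^sub>\<infinity>k. cmod (c k)"])
       (simp add: fsum_bound[OF c])
  moreover have "(\<integral>x. cnj (?v x) * cis (of_int k * x) \<partial>lam) = 2 * of_real pi * cnj (c k)" for k
  proof -
    have "(\<integral>x. cnj (?v x) * cis (of_int k * x) \<partial>lam) = (\<integral>x. cnj (?v x * cis (- (of_int k * x))) \<partial>lam)"
      by (simp add: cis_cnj)
    also have "\<dots> = cnj (2 * of_real pi * fc ?v k)" unfolding Bochner_Integration.integral_cnj by (simp add: fc_def)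
    finally show ?thesis using fc_fsum[OF c] by simp
  qed
  moreover have "c k * (2 * of_real pi * cnj (c k)) = complex_of_real (2 * pi * (cmod (c k))\<^sup>2)" for k
    by (simp only: of_real_mult complex_norm_square) (simp add: mult_ac)
  moreover have "cnj (?v x) * ?v x = complex_of_real ((cmod (?v x))\<^sup>2)" for x
    by (simp only: complex_norm_square mult.commute)
  ultimately have "((\<lambda>k. complex_of_real (2 * pi * (cmod (c k))\<^sup>2)) has_sum (\<integral>x. complex_of_real ((cmod (?v x))\<^sup>2) \<partial>lam)) UNIV"
    by (simp only:)
  then show ?thesis unfolding integral_complex_of_real by (simp only: has_sum_of_real_iff)
qed

section \<open>Density of trigonometric polynomials\<close>

inductive trig :: "(real \<Rightarrow> complex) \<Rightarrow> bool" where
  base: "trig (\<lambda>x. c * cis (of_int k * x))"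
| add: "trig f \<Longrightarrow> trig g \<Longrightarrow> trig (\<lambda>x. f x + g x)"

lemma trig_mult_base: "trig f \<Longrightarrow> trig (\<lambda>x. c * cis (of_int k * x) * f x)"
proof (induction rule: trig.induct)
  case (base d l)
  have "(\<lambda>x. c * cis (of_int k * x) * (d * cis (of_int l * x))) = (\<lambda>x. (c * d) * cis (of_int (k + l) * x))"
    by (simp add: fun_eq_iff cis_mult[symmetric] algebra_simps)
  then show ?case using trig.base by metis
next
  case (add f g)
  then show ?case using trig.add[OF add.IH] by (simp add: algebra_simps)
qed

lemma trig_mult: "trig f \<Longrightarrow> trig g \<Longrightarrow> trig (\<lambda>x. f x * g x)"
proof (induction rule: trig.induct)
  case (base c k)
  then show ?case by (rule trig_mult_base)
next
  case (add f f')
  then have "trig (\<lambda>x. f x * g x)" "trig (\<lambda>x. f' x * g x)" by auto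
  from trig.add[OF this] show ?case by (simp add: algebra_simps)
qed

lemma trig_const: "trig (\<lambda>x. c)"
  using trig.base[of c 0] by simp

lemma cper_trig: "trig f \<Longrightarrow> cper f"
  by (induction rule: trig.induct) (intro cper_intros)+

text \<open>
  A real-linear function on the plane, restricted to the unit circle, is a combination of
  \<open>cos x\<close> and \<open>sin x\<close>; products of exponentials are exponentials.
\<close>

lemma trig_polynomial:
  assumes "real_polynomial_function p"
  shows "trig (\<lambda>x. of_real (p (cis x)))"
  using assms
proof (induction rule: real_polynomial_function.induct)
  case (linear f)
  have "of_real (f (cis x)) = ((f 1 - \<i> * f \<i>) / 2) * cis (of_int 1 * x) + ((f 1 + \<i> * f \<i>) / 2) * cis (of_int (-1) * x)" for x
  proof -
    have "cis x = cos x *\<^sub>R 1 + sin x *\<^sub>R \<i>" by (simp add: complex_eq_iff)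
    then have "f (cis x) = cos x * f 1 + sin x * f \<i>"
      by (simp add: linear_add[OF bounded_linear.linear[OF linear]] linear_cmul[OF bounded_linear.linear[OF linear]])
    then show ?thesis by (simp add: complex_eq_iff field_simps)
  qed
  then show ?case
    using trig.add[OF trig.base[of "(f 1 - \<i> * f \<i>) / 2" 1] trig.base[of "(f 1 + \<i> * f \<i>) / 2" "-1"]] by (simp only:)
next
  case (const c)
  then show ?case by (simp add: trig_const)
next
  case (add f g)
  then show ?case using trig.add by fastforce
next
  case (mult f g)
  then show ?case using trig_mult by fastforce
qed

lemma Arg2pi_eq_Arg_mod: "z \<noteq> 0 \<Longrightarrow> Arg2pi z = Arg z \<or> Arg2pi z = Arg z + 2 * pi"
proof (cases "Arg z \<ge> 0")
  case True
  assume z: "z \<noteq> 0"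
  have "Arg2pi z = Arg z"
  proof (rule Arg2pi_unique[of "norm z"])
    show "Arg z < 2 * pi" using Arg_le_pi[of z] pi_gt_zero by linarith
  qed (use True z Arg_eq[OF z] in auto)
  then show ?thesis by simp
next
  case False
  assume z: "z \<noteq> 0"
  have "exp (\<i> * complex_of_real (Arg z + 2 * pi)) = exp (\<i> * complex_of_real (Arg z))"
    by (simp add: exp_add distrib_left mult_ac exp_two_pi_i')
  then have "Arg2pi z = Arg z + 2 * pi"
  proof (intro Arg2pi_unique[of "norm z"])
    show "0 \<le> Arg z + 2 * pi" using mpi_less_Arg[of z] pi_gt_zero by linarith
  qed (use False z Arg_eq[OF z] in auto)
  then show ?thesis by simp
qed

text \<open>
  A periodic function descends to the circle. Away from the negative real axis \<open>Arg\<close> is a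
  continuous inverse of \<open>cis\<close>; on that axis \<open>Arg2pi\<close> is, and the two differ by a period.
\<close>

lemma continuous_on_circle_quotient:
  fixes u :: "real \<Rightarrow> 'a::real_normed_vector"
  assumes "cper u"
  shows "continuous_on (sphere 0 1) (\<lambda>z. u (Arg z))"
proof -
  have cu: "isCont u x" for x using assms by (simp add: cper_def continuous_on_eq_continuous_at)
  have "isCont (\<lambda>z. u (Arg z)) z" if "z \<in> sphere 0 1" for z :: complex
  proof (cases "z \<in> \<real>\<^sub>\<le>\<^sub>0")
    case False
    then show ?thesis
      by (intro isCont_o2[OF continuous_at_Arg cu])
  next
    case True
    have "z \<notin> \<real>\<^sub>\<ge>\<^sub>0"
    proof
      assume "z \<in> \<real>\<^sub>\<ge>\<^sub>0"
      with True have "z = 0" by (auto simp: complex_nonneg_Reals_iff complex_nonpos_Reals_iff complex_eq_iff)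
      with that show False by simp
    qed
    then have c: "isCont (\<lambda>z. u (Arg2pi z)) z"
      by (intro isCont_o2[OF continuous_at_Arg2pi cu])
    have eq: "u (Arg2pi w) = u (Arg w)" if "w \<noteq> 0" for w
      using Arg2pi_eq_Arg_mod[OF that] assms by (auto simp: cper_def periodic_def)
    have "z \<noteq> 0" using that by auto
    then have "eventually (\<lambda>w. w \<noteq> 0) (nhds z)" by (rule t1_space_nhds)
    then have "eventually (\<lambda>w. u (Arg2pi w) = u (Arg w)) (nhds z)"
      by eventually_elim (rule eq)
    from isCont_cong[OF this] show ?thesis using c by simp
  qed
  then show ?thesis by (simp add: continuous_at_imp_continuous_on)
qed

text \<open>
  Stone-Weierstrass on the unit circle in the plane: polynomials in the real coordinates are
  dense there, and they pull back to trigonometric polynomials.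
\<close>

lemma trig_dense:
  fixes u :: "real \<Rightarrow> real"
  assumes "cper u" "e > 0"
  obtains t where "trig t" "\<And>x. cmod (of_real (u x) - t x) < e"
proof -
  obtain p where p: "real_polynomial_function p" "\<And>z::complex. z \<in> sphere 0 1 \<Longrightarrow> \<bar>u (Arg z) - p z\<bar> < e"
    using Stone_Weierstrass_real_polynomial_function[OF compact_sphere continuous_on_circle_quotient[OF assms(1)] assms(2)]
    by blast
  show ?thesis
  proof (rule that)
    show "trig (\<lambda>x. of_real (p (cis x)))" by (rule trig_polynomial[OF p(1)])
    fix x
    obtain y n where y: "y \<in> cell" "- x = y + 2 * pi * of_int n" by (rule cell_representative)
    then have "x = - y + 2 * pi * of_int (- n)" by simp
    then have "u x = u (- y)" "cis x = cis (- y)"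
      using assms(1) periodic_int[of u "- y" "- n"] periodic_int[of "\<lambda>x. cis (of_int 1 * x)" "-y" "-n"] cper_cis[of 1]
      by (auto simp: cper_def)
    moreover have "Arg (cis (- y)) = - y" using y by (intro Arg_cis) (auto simp: cell_def)
    ultimately show "cmod (of_real (u x) - of_real (p (cis x))) < e"
      using p(2)[of "cis x"] by (simp flip: of_real_diff)
  qed
qed

lemma lam_zero_imp_zero:
  fixes v :: "real \<Rightarrow> complex"
  assumes v: "cper v" and z: "(\<integral>x. (cmod (v x))\<^sup>2 \<partial>lam) = 0"
  shows "v x = 0"
proof -
  let ?f = "\<lambda>x. (cmod (v x))\<^sup>2"
  have c: "cper ?f" by (intro cper_intros v)
  have "integral {-pi..pi} ?f = 0"
    using c z by (subst lam_integral_eq_HK[symmetric]) (auto simp: cper_def)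
  moreover have "continuous_on (cbox (-pi) pi) ?f" using c by (auto simp: cper_def intro: continuous_on_subset)
  ultimately have 0: "?f y = 0" if "y \<in> {-pi..pi}" for y
    using has_integral_0_cbox_imp_0[of "-pi" pi ?f y] that integrable_integral[OF integrable_continuous, of "-pi" pi ?f]
    by (auto simp: not_le)
  obtain y n where "y \<in> cell" "x = y + 2 * pi * of_int n" by (rule cell_representative)
  then show ?thesis using 0[of y] periodic_int[of v y n] v by (auto simp: cper_def cell_def)
qed

lemma trig_orthogonal:
  assumes f: "f \<in> borel_measurable borel" "integrable lam f"
    and z: "\<And>k. (\<integral>x. f x * cis (of_int k * x) \<partial>lam) = 0"
  shows "trig t \<Longrightarrow> integrable lam (\<lambda>x. f x * t x) \<and> (\<integral>x. f x * t x \<partial>lam) = 0"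
proof (induction rule: trig.induct)
  case (base c k)
  have "(\<lambda>x. f x * (c * cis (of_int k * x))) = (\<lambda>x. c * (f x * cis (of_int k * x)))" by (simp add: mult_ac)
  then show ?case using lam_integrable_mult_cis[OF f, of k] z[of k] by simp
next
  case (add s t)
  then show ?case by (simp add: distrib_left)
qed

text \<open>
  Orthogonality to all exponentials passes to trigonometric polynomials by linearity and to
  continuous functions by uniform approximation, since \<open>f\<close> is integrable.
\<close>

lemma orthogonal_cper:
  fixes f u :: "real \<Rightarrow> complex"
  assumes f: "f \<in> borel_measurable borel" "integrable lam f"
    and z: "\<And>k. (\<integral>x. f x * cis (of_int k * x) \<partial>lam) = 0" and u: "cper u"
  shows "(\<integral>x. f x * u x \<partial>lam) = 0"
proof -
  have ic: "integrable lam (\<lambda>x. f x * g x)" if g: "cper g" for g :: "real \<Rightarrow> complex"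
  proof -
    obtain B where "B > 0" "\<And>x. norm (g x) \<le> B" using cper_bounded[OF g] by blast
    then show ?thesis
      using f cper_measurable[OF g]
      by (intro Bochner_Integration.integrable_bound[OF integrable_mult_right[OF f(2), of "of_real B"]])
         (auto simp: norm_mult mult.commute[of _ "cmod (f _)"] intro!: AE_I2 mult_left_mono)
  qed
  have real: "(\<integral>x. f x * of_real (w x) \<partial>lam) = 0" if w: "cper w" for w :: "real \<Rightarrow> real"
  proof (rule ccontr)
    assume ne: "(\<integral>x. f x * of_real (w x) \<partial>lam) \<noteq> 0"
    define N where "N = (\<integral>x. cmod (f x) \<partial>lam)"
    have N: "N \<ge> 0" by (simp add: N_def)
    \<comment> \<open>With this \<open>e\<close>, an approximation error below \<open>e\<close> bounds the integral strictly by itself.\<close>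
    define e where "e = cmod (\<integral>x. f x * of_real (w x) \<partial>lam) / (N + 1)"
    have e: "e > 0" using ne N by (simp add: e_def)
    obtain t where t: "trig t" "\<And>x. cmod (of_real (w x) - t x) < e" using trig_dense[OF w e] by blast
    have cw: "cper (\<lambda>x. complex_of_real (w x))"
      using w by (auto simp: cper_def periodic_def intro!: continuous_intros)
    have d: "cper (\<lambda>x. of_real (w x) - t x)" using cw cper_trig[OF t(1)] by (rule cper_diff)
    have "(\<integral>x. f x * of_real (w x) \<partial>lam) = (\<integral>x. f x * (of_real (w x) - t x) \<partial>lam)"
      using trig_orthogonal[OF f z t(1)] ic[OF cw] by (simp add: right_diff_distrib)
    also have "cmod \<dots> \<le> (\<integral>x. cmod (f x * (of_real (w x) - t x)) \<partial>lam)" by (rule integral_norm_bound)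
    also have "\<dots> \<le> (\<integral>x. cmod (f x) * e \<partial>lam)"
    proof (rule integral_mono)
      show "integrable lam (\<lambda>x. cmod (f x * (of_real (w x) - t x)))" by (rule integrable_norm[OF ic[OF d]])
      show "integrable lam (\<lambda>x. cmod (f x) * e)" using f(2) by simp
      show "cmod (f x * (of_real (w x) - t x)) \<le> cmod (f x) * e" for x
        unfolding norm_mult by (rule mult_left_mono) (use t(2)[of x] in auto)
    qed
    also have "\<dots> = N * e" by (simp add: N_def)
    also have "\<dots> < (N + 1) * e" using e by simp
    also have "\<dots> = cmod (\<integral>x. f x * of_real (w x) \<partial>lam)" using N by (simp add: e_def)
    finally show False by simp
  qed
  have "cper (\<lambda>x. Re (u x))" "cper (\<lambda>x. Im (u x))"
    using u by (auto simp: cper_def periodic_def intro!: continuous_intros)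
  note R = this
  have C: "cper (\<lambda>x. complex_of_real (Re (u x)))" "cper (\<lambda>x. complex_of_real (Im (u x)))"
    using u by (auto simp: cper_def periodic_def intro!: continuous_intros)
  have eq: "f x * u x = f x * of_real (Re (u x)) + \<i> * (f x * of_real (Im (u x)))" for x
    by (simp add: complex_eq_iff)
  have "(\<integral>x. f x * u x \<partial>lam) = (\<integral>x. f x * of_real (Re (u x)) \<partial>lam) + \<i> * (\<integral>x. f x * of_real (Im (u x)) \<partial>lam)"
    unfolding eq using ic[OF C(1)] ic[OF C(2)] by (subst Bochner_Integration.integral_add) auto
  then show ?thesis using real R by simp
qed

lemma fc_zero_iff: "fc f k = 0 \<longleftrightarrow> (\<integral>x. f x * cis (of_int (- k) * x) \<partial>lam) = 0"
  by (simp add: fc_def)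

text \<open>
  Test with the conjugate of \<open>v\<close> itself.
\<close>

lemma fc_unique:
  assumes v: "cper v" and z: "\<And>k. fc v k = 0"
  shows "v x = 0"
proof (rule lam_zero_imp_zero[OF v])
  have "(\<integral>x. v x * cnj (v x) \<partial>lam) = 0"
  proof (rule orthogonal_cper)
    show "(\<integral>x. v x * cis (of_int k * x) \<partial>lam) = 0" for k
      using z[of "- k"] by (simp add: fc_zero_iff)
  qed (use v in \<open>auto intro: cper_measurable cper_integrable finite_measure_lam cper_cnj\<close>)
  then have "(\<integral>x. complex_of_real ((cmod (v x))\<^sup>2) \<partial>lam) = 0"
    by (simp only: complex_norm_square)
  then show "(\<integral>x. (cmod (v x))\<^sup>2 \<partial>lam) = 0"
    unfolding integral_complex_of_real by simp
qed

lemma fc_diff: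
  assumes "cper v" "cper w"
  shows "fc (\<lambda>x. v x - w x) k = fc v k - fc w k"
proof -
  have "integrable lam (\<lambda>x. v x * cis (- (of_int k * x)))" "integrable lam (\<lambda>x. w x * cis (- (of_int k * x)))"
    using assms by (auto intro!: cper_integrable finite_measure_lam cper_intros)
  then show ?thesis by (simp add: fc_def left_diff_distrib diff_divide_distrib)
qed

lemma fourier_expansion:
  assumes v: "cper v" and s: "(\<lambda>k. cmod (fc v k)) summable_on UNIV"
  shows "v = fsum (fc v)"
proof
  fix x
  have "v x - fsum (fc v) x = 0"
    by (rule fc_unique[where v = "\<lambda>x. v x - fsum (fc v) x"])
       (simp_all add: cper_diff v cper_fsum[OF s] fc_diff fc_fsum[OF s])
  then show "v x = fsum (fc v) x" by simp
qed

section \<open>The Sobolev space of order one in Fourier coefficients\<close>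

text \<open>
  By \<open>H1_per_iff\<close>, these are the coefficient sequences of the elements of \<open>H1_per\<close>. All later variational
  arguments are carried out on such sequences.
\<close>

definition H1seq :: "(int \<Rightarrow> complex) \<Rightarrow> bool"
  where "H1seq c \<longleftrightarrow> (\<lambda>k. (1 + (real_of_int k)\<^sup>2) * (cmod (c k))\<^sup>2) summable_on UNIV"

text \<open>
  This sum is what makes \<open>H\<^sup>1\<close> functions in one dimension have absolutely convergent Fourier
  series, hence continuous.
\<close>

lemma inverse_weight_summable: "(\<lambda>k. 1 / (1 + (real_of_int k)\<^sup>2)) summable_on UNIV"
proof -
  let ?g = "\<lambda>k::int. 1 / (1 + (real_of_int k)\<^sup>2)"
  have "summable (\<lambda>n. 1 / (1 + (real n)\<^sup>2))"
  proof (rule summable_comparison_test'[OF inverse_power_summable[of 2], of 1])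
    show "norm (1 / (1 + (real n)\<^sup>2)) \<le> inverse (real n ^ 2)" if "1 \<le> n" for n
      using le_imp_inverse_le[of "real n ^ 2" "1 + (real n)\<^sup>2"] that by (simp add: divide_inverse)
  qed auto
  then have n: "(\<lambda>n. 1 / (1 + (real n)\<^sup>2)) summable_on UNIV"
    by (intro summable_nonneg_imp_summable_on) auto
  have "?g summable_on (range int)" using n by (subst summable_on_reindex) (auto simp: o_def inj_on_def)
  moreover have "?g summable_on (range (\<lambda>n. - int n))" using n by (subst summable_on_reindex) (auto simp: o_def inj_on_def)
  ultimately have "?g summable_on (range int \<union> range (\<lambda>n. - int n))" by (rule summable_on_union)
  moreover have "range int \<union> range (\<lambda>n. - int n) = UNIV"
  proof (intro UNIV_eq_I[symmetric])
    show "x \<in> range int \<union> range (\<lambda>n. - int n)" for x by (cases x rule: int_cases2) auto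
  qed
  ultimately show ?thesis by simp
qed

text \<open>
  The inequality of the arithmetic and geometric means. The free parameter \<open>\<eta>\<close> is used in
  \<open>H1_compactness\<close> to make the first term small uniformly on bounded sets.
\<close>

lemma young_weight:
  assumes "\<eta> > 0"
  shows "cmod z \<le> \<eta> * ((1 + (real_of_int k)\<^sup>2) * (cmod z)\<^sup>2) + (1 / \<eta>) * (1 / (1 + (real_of_int k)\<^sup>2))"
proof -
  define w where "w = 1 + (real_of_int k)\<^sup>2"
  have w: "w > 0" unfolding w_def by (simp add: add_pos_nonneg)
  have "0 \<le> (\<eta> * w * cmod z - 1)\<^sup>2" by simp
  then have "2 * (\<eta> * w * cmod z) \<le> (\<eta> * w * cmod z)\<^sup>2 + 1" by (simp add: power2_diff)
  moreover have "0 \<le> \<eta> * w * cmod z" using assms w by simp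
  ultimately have "\<eta> * w * cmod z \<le> (\<eta> * w * cmod z)\<^sup>2 + 1" by linarith
  then have "(\<eta> * w * cmod z) / (\<eta> * w) \<le> ((\<eta> * w * cmod z)\<^sup>2 + 1) / (\<eta> * w)"
    using assms w by (intro divide_right_mono) auto
  also have "\<dots> = \<eta> * (w * (cmod z)\<^sup>2) + (1 / \<eta>) * (1 / w)"
    using assms w by (simp add: field_simps power2_eq_square)
  finally show ?thesis using assms w by (simp add: w_def)
qed

lemma H1seq_summable:
  assumes "H1seq c"
  shows "(\<lambda>k. cmod (c k)) summable_on UNIV"
proof (rule summable_on_comparison_test)
  show "(\<lambda>k. 1 * ((1 + (real_of_int k)\<^sup>2) * (cmod (c k))\<^sup>2) + (1 / 1) * (1 / (1 + (real_of_int k)\<^sup>2))) summable_on UNIV"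
    using assms inverse_weight_summable unfolding H1seq_def by (intro summable_on_add) auto
  show "cmod (c k) \<le> 1 * ((1 + (real_of_int k)\<^sup>2) * (cmod (c k))\<^sup>2) + (1 / 1) * (1 / (1 + (real_of_int k)\<^sup>2))" for k
    by (rule young_weight) simp
qed auto

lemma H1seq_cper: "H1seq c \<Longrightarrow> cper (fsum c)"
  by (intro cper_fsum H1seq_summable)

lemma H1seq_fc_fsum: "H1seq c \<Longrightarrow> fc (fsum c) = c"
  using fc_fsum[OF H1seq_summable] by (simp add: fun_eq_iff)

lemma H1seq_weighted_summable:
  assumes "H1seq c" "\<And>k. 0 \<le> a k" "\<And>k. a k \<le> C * (1 + (real_of_int k)\<^sup>2)"
  shows "(\<lambda>k. a k * (cmod (c k))\<^sup>2) summable_on UNIV"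
proof (rule summable_on_comparison_test)
  show "(\<lambda>k. C * ((1 + (real_of_int k)\<^sup>2) * (cmod (c k))\<^sup>2)) summable_on UNIV"
    using assms(1) unfolding H1seq_def by (rule summable_on_cmult_right)
  show "a k * (cmod (c k))\<^sup>2 \<le> C * ((1 + (real_of_int k)\<^sup>2) * (cmod (c k))\<^sup>2)" for k
    using mult_right_mono[OF assms(3)[of k], of "(cmod (c k))\<^sup>2"] by (simp add: mult.assoc)
qed (use assms in auto)

lemma shifted_square_le: "(real_of_int k + q)\<^sup>2 \<le> (2 + 2 * q\<^sup>2) * (1 + (real_of_int k)\<^sup>2)"
proof -
  have "(real_of_int k + q)\<^sup>2 \<le> 2 * (real_of_int k)\<^sup>2 + 2 * q\<^sup>2"
    using sum_squares_bound[of "real_of_int k" q] by (simp add: power2_sum)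
  also have "\<dots> \<le> (2 + 2 * q\<^sup>2) * (1 + (real_of_int k)\<^sup>2)"
    by (simp add: algebra_simps)
  finally show ?thesis .
qed

text \<open>
  The integral of \<open>|(-i d/dx + q) v|\<^sup>2\<close> over a period for \<open>v = fsum c\<close>, by \<open>momentum_integral\<close>.
\<close>

definition kin :: "real \<Rightarrow> (int \<Rightarrow> complex) \<Rightarrow> real"
  where "kin q c = 2 * pi * (\<Sum>\<^sub>\<infinity>k. (of_int k + q)\<^sup>2 * (cmod (c k))\<^sup>2)"

text \<open>
  The squared \<open>L\<^sup>2\<close> norm of \<open>fsum c\<close> over a period, by \<open>nsq_integral\<close>.
\<close>

definition nsq :: "(int \<Rightarrow> complex) \<Rightarrow> real"
  where "nsq c = 2 * pi * (\<Sum>\<^sub>\<infinity>k. (cmod (c k))\<^sup>2)"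

lemma kin_summable: "H1seq c \<Longrightarrow> (\<lambda>k. (real_of_int k + q)\<^sup>2 * (cmod (c k))\<^sup>2) summable_on UNIV"
  by (rule H1seq_weighted_summable[OF _ _ shifted_square_le]) auto

lemma nsq_summable: "H1seq c \<Longrightarrow> (\<lambda>k. (cmod (c k))\<^sup>2) summable_on UNIV"
  using H1seq_weighted_summable[of c "\<lambda>_. 1" 1] by simp

lemma nsq_integral:
  assumes "H1seq c"
  shows "nsq c = (\<integral>x. (cmod (fsum c x))\<^sup>2 \<partial>lam)"
proof -
  have "(\<Sum>\<^sub>\<infinity>k. 2 * pi * (cmod (c k))\<^sup>2) = (\<integral>x. (cmod (fsum c x))\<^sup>2 \<partial>lam)"
    using parseval_fsum[OF H1seq_summable[OF assms]] by (rule infsumI)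
  then show ?thesis by (simp add: nsq_def infsum_cmult_right')
qed

section \<open>Kinetic energy through difference quotients\<close>

lemma norm_cis_minus_1: "cmod (cis t - 1) = 2 * \<bar>sin (t / 2)\<bar>"
proof -
  have "(cmod (cis t - 1))\<^sup>2 = (cos t - 1)\<^sup>2 + (sin t)\<^sup>2"
    by (simp add: cmod_power2)
  also have "\<dots> = 2 - 2 * cos t"
    using sin_cos_squared_add[of t] by (simp add: power2_diff)
  also have "\<dots> = (2 * \<bar>sin (t / 2)\<bar>)\<^sup>2"
    using cos_double_sin[of "t / 2"] by (simp add: power_mult_distrib)
  finally show ?thesis by (rule power2_eq_imp_eq) auto
qed

lemma difference_quotient_limit:
  "((\<lambda>h. (cmod (cis (y * h) - 1))\<^sup>2 / h\<^sup>2) \<longlongrightarrow> y\<^sup>2) (at_right 0)"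
proof -
  have "((\<lambda>h. 2 * sin (y * h / 2)) has_field_derivative y) (at 0)"
    by (auto intro!: derivative_eq_intros)
  then have "((\<lambda>h. 2 * sin (y * h / 2) / h) \<longlongrightarrow> y) (at 0)"
    by (simp add: DERIV_def)
  then have "((\<lambda>h. (2 * sin (y * h / 2) / h)\<^sup>2) \<longlongrightarrow> y\<^sup>2) (at_right 0)"
    by (intro tendsto_power) (rule filterlim_mono[OF _ order_refl], auto intro: at_le)
  then show ?thesis
    by (simp add: norm_cis_minus_1 power_mult_distrib power_divide)
qed

lemma fc_shift:
  assumes w: "cper w" and h: "h \<ge> 0"
  shows "fc (\<lambda>x. w (x + h)) k = cis (of_int k * h) * fc w k"
proof -
  have eq: "w (x + h) * cis (- (of_int k * x)) = cis (of_int k * h) * (w (x + h) * cis (- (of_int k * (x + h))))" for x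
  proof -
    have "cis (- (of_int k * x)) = cis (of_int k * h) * cis (- (of_int k * (x + h)))"
      by (simp add: cis_mult algebra_simps)
    then show ?thesis by (simp add: mult_ac)
  qed
  have "(\<integral>x. w (x + h) * cis (- (of_int k * x)) \<partial>lam) = cis (of_int k * h) * (\<integral>x. w (x + h) * cis (- (of_int k * (x + h))) \<partial>lam)"
    by (simp only: eq integral_mult_right_zero)
  also have "(\<integral>x. w (x + h) * cis (- (of_int k * (x + h))) \<partial>lam) = (\<integral>x. w x * cis (- (of_int k * x)) \<partial>lam)"
    by (rule lam_integral_shift[OF _ h, of "\<lambda>x. w x * cis (- (of_int k * x))"]) (intro cper_intros w)
  finally show ?thesis by (simp add: fc_def)
qed

lemma fc_cmult: "fc (\<lambda>x. a * v x) k = a * fc v k"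
  by (simp add: fc_def mult.assoc)

lemma fc_difference:
  assumes w: "cper w" and h: "h \<ge> 0"
  shows "fc (\<lambda>x. cis (q * h) * w (x + h) - w x) k = (cis ((of_int k + q) * h) - 1) * fc w k"
proof -
  have "cper (\<lambda>x. cis (q * h) * w (x + h))" using w by (intro cper_intros) 
  then have "fc (\<lambda>x. cis (q * h) * w (x + h) - w x) k = fc (\<lambda>x. cis (q * h) * w (x + h)) k - fc w k"
    by (rule fc_diff[OF _ w])
  also have "\<dots> = cis (q * h) * (cis (of_int k * h) * fc w k) - fc w k"
    by (simp only: fc_cmult fc_shift[OF w h])
  also have "cis (q * h) * (cis (of_int k * h) * fc w k) = cis ((of_int k + q) * h) * fc w k"
  proof -
    have "cis (q * h) * cis (of_int k * h) = cis ((of_int k + q) * h)" by (simp add: cis_mult algebra_simps)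
    then show ?thesis by (simp only: mult.assoc[symmetric])
  qed
  finally show ?thesis by (simp add: left_diff_distrib)
qed

lemma bessel_cper:
  assumes "cper w" "finite F"
  shows "2 * pi * (\<Sum>k\<in>F. (cmod (fc w k))\<^sup>2) \<le> (\<integral>x. (cmod (w x))\<^sup>2 \<partial>lam)"
  using assms by (intro bessel_inequality) (auto intro!: cper_measurable cper_integrable finite_measure_lam cper_intros)

text \<open>
  Difference quotients allow \<open>H\<^sup>1\<close> bounds for functions, such as \<open>|v|\<^sup>2\<close> or a nonlinear truncation
  of \<open>v\<close>, whose derivatives would need a chain rule. By Bessel, the hypothesis bounds
  the weighted sum of the squared coefficients over each finite set, with weight
  \<open>|cis ((k + q) h) - 1|\<^sup>2 / h\<^sup>2\<close>, which tends to \<open>(k + q)\<^sup>2\<close> as \<open>h\<close> tends to \<open>0\<close>.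
\<close>

lemma H1seq_from_differences:
  assumes w: "cper w" and r: "r > 0"
    and D: "\<And>h. 0 < h \<Longrightarrow> h < r \<Longrightarrow> (\<integral>x. (cmod (cis (q * h) * w (x + h) - w x))\<^sup>2 \<partial>lam) \<le> C * h\<^sup>2"
  shows "H1seq (fc w)" "kin q (fc w) \<le> C"
proof -
  have fin: "2 * pi * (\<Sum>k\<in>F. (of_int k + q)\<^sup>2 * (cmod (fc w k))\<^sup>2) \<le> C" if F: "finite F" for F :: "int set"
  proof (rule tendsto_upperbound)
    show "((\<lambda>h. 2 * pi * (\<Sum>k\<in>F. (cmod (cis ((of_int k + q) * h) - 1))\<^sup>2 / h\<^sup>2 * (cmod (fc w k))\<^sup>2)) \<longlongrightarrow>
        2 * pi * (\<Sum>k\<in>F. (of_int k + q)\<^sup>2 * (cmod (fc w k))\<^sup>2)) (at_right 0)"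
      by (intro tendsto_intros difference_quotient_limit)
    have "2 * pi * (\<Sum>k\<in>F. (cmod (cis ((of_int k + q) * h) - 1))\<^sup>2 / h\<^sup>2 * (cmod (fc w k))\<^sup>2) \<le> C"
      if h: "0 < h" "h < r" for h
    proof -
      have "2 * pi * (\<Sum>k\<in>F. (cmod (fc (\<lambda>x. cis (q * h) * w (x + h) - w x) k))\<^sup>2) \<le> C * h\<^sup>2"
        using h w by (intro order_trans[OF bessel_cper D] cper_intros F) auto
      then have "2 * pi * (\<Sum>k\<in>F. (cmod (cis ((of_int k + q) * h) - 1))\<^sup>2 * (cmod (fc w k))\<^sup>2) \<le> C * h\<^sup>2"
        using h by (simp add: fc_difference[OF w] norm_mult power_mult_distrib)
      then have "2 * pi * (\<Sum>k\<in>F. (cmod (cis ((of_int k + q) * h) - 1))\<^sup>2 * (cmod (fc w k))\<^sup>2) / h\<^sup>2 \<le> C"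
        using h by (simp add: divide_le_eq)
      then show ?thesis by (simp add: sum_divide_distrib[symmetric])
    qed
    then show "eventually (\<lambda>h. 2 * pi * (\<Sum>k\<in>F. (cmod (cis ((of_int k + q) * h) - 1))\<^sup>2 / h\<^sup>2 * (cmod (fc w k))\<^sup>2) \<le> C) (at_right 0)"
      using r unfolding eventually_at_right_field by blast
  qed simp
  define N where "N = (\<integral>x. (cmod (w x))\<^sup>2 \<partial>lam)"
  have "(\<Sum>k\<in>F. (1 + (real_of_int k)\<^sup>2) * (cmod (fc w k))\<^sup>2) \<le> (1 + 2 * q\<^sup>2) * (N / (2 * pi)) + 2 * (C / (2 * pi))"
    if F: "finite F" for F :: "int set"
  proof -
    have "1 + (real_of_int k)\<^sup>2 \<le> (1 + 2 * q\<^sup>2) + 2 * (of_int k + q)\<^sup>2" for k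
      using zero_le_power2[of "of_int k + 2 * q"] by (simp add: power2_sum power_mult_distrib)
    then have "(1 + (real_of_int k)\<^sup>2) * (cmod (fc w k))\<^sup>2 \<le> (1 + 2 * q\<^sup>2) * (cmod (fc w k))\<^sup>2 + 2 * ((of_int k + q)\<^sup>2 * (cmod (fc w k))\<^sup>2)" for k
      using mult_right_mono[of "1 + (real_of_int k)\<^sup>2" "(1 + 2 * q\<^sup>2) + 2 * (of_int k + q)\<^sup>2" "(cmod (fc w k))\<^sup>2"]
      by (simp add: distrib_right mult.assoc)
    then have "(\<Sum>k\<in>F. (1 + (real_of_int k)\<^sup>2) * (cmod (fc w k))\<^sup>2) \<le> (\<Sum>k\<in>F. (1 + 2 * q\<^sup>2) * (cmod (fc w k))\<^sup>2 + 2 * ((of_int k + q)\<^sup>2 * (cmod (fc w k))\<^sup>2))"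
      by (intro sum_mono)
    also have "\<dots> = (1 + 2 * q\<^sup>2) * (\<Sum>k\<in>F. (cmod (fc w k))\<^sup>2) + 2 * (\<Sum>k\<in>F. (of_int k + q)\<^sup>2 * (cmod (fc w k))\<^sup>2)"
      by (simp only: sum.distrib sum_distrib_left)
    also have "\<dots> \<le> (1 + 2 * q\<^sup>2) * (N / (2 * pi)) + 2 * (C / (2 * pi))"
    proof (intro add_mono mult_left_mono)
      show "(\<Sum>k\<in>F. (cmod (fc w k))\<^sup>2) \<le> N / (2 * pi)"
        using bessel_cper[OF w F] by (simp add: N_def le_divide_eq mult.commute)
      show "(\<Sum>k\<in>F. (of_int k + q)\<^sup>2 * (cmod (fc w k))\<^sup>2) \<le> C / (2 * pi)"
        using fin[OF F] by (simp add: le_divide_eq mult.commute)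
    qed auto
    finally show ?thesis .
  qed
  then show H: "H1seq (fc w)"
    unfolding H1seq_def
    by (intro nonneg_bdd_above_summable_on bdd_aboveI2[where M = "(1 + 2 * q\<^sup>2) * (N / (2 * pi)) + 2 * (C / (2 * pi))"]) auto
  have "(\<Sum>\<^sub>\<infinity>k. (of_int k + q)\<^sup>2 * (cmod (fc w k))\<^sup>2) \<le> C / (2 * pi)"
    using fin by (intro infsum_le_finite_sums kin_summable H) (simp add: le_divide_eq mult.commute)
  then show "kin q (fc w) \<le> C" by (simp add: kin_def le_divide_eq mult.commute)
qed

lemma has_sum_minus:
  fixes f g :: "'b \<Rightarrow> 'a::real_normed_vector"
  assumes "(f has_sum a) A" "(g has_sum b) A"
  shows "((\<lambda>x. f x - g x) has_sum (a - b)) A"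
  using has_sum_add[OF assms(1), of "\<lambda>x. - g x" "- b"] assms(2) by (simp add: has_sum_uminus)

lemma fsum_difference:
  assumes c: "H1seq c"
  shows "cis (q * h) * fsum c (x + h) - fsum c x = fsum (\<lambda>k. (cis ((of_int k + q) * h) - 1) * c k) x"
proof -
  note s = H1seq_summable[OF c]
  have "((\<lambda>k. cis (q * h) * (c k * cis (of_int k * (x + h))) - c k * cis (of_int k * x)) has_sum (cis (q * h) * fsum c (x + h) - fsum c x)) UNIV"
    by (intro has_sum_minus has_sum_cmult_right fsum_has_sum s)
  moreover have "cis (q * h) * (c k * cis (of_int k * (x + h))) - c k * cis (of_int k * x) = (cis ((of_int k + q) * h) - 1) * c k * cis (of_int k * x)" for k
  proof -
    have "cis (q * h) * cis (of_int k * (x + h)) = cis ((of_int k + q) * h) * cis (of_int k * x)"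
      by (simp add: cis_mult algebra_simps)
    then have "c k * (cis (q * h) * cis (of_int k * (x + h))) = c k * (cis ((of_int k + q) * h) * cis (of_int k * x))"
      by (simp only:)
    then show ?thesis by (simp only: left_diff_distrib right_diff_distrib mult_1_left mult_1_right mult_ac)
  qed
  ultimately show ?thesis by (simp add: fsum_def infsumI)
qed

text \<open>
  The converse bound, from Parseval and \<open>|cis t - 1| \<le> |t|\<close>.
\<close>

lemma difference_le_kin:
  assumes c: "H1seq c"
  shows "(\<integral>x. (cmod (cis (q * h) * fsum c (x + h) - fsum c x))\<^sup>2 \<partial>lam) \<le> kin q c * h\<^sup>2"
proof -
  define d where "d k = (cis ((of_int k + q) * h) - 1) * c k" for k :: int
  have "cmod (d k) \<le> 2 * cmod (c k)" for k
    using norm_triangle_ineq4[of "cis ((of_int k + q) * h)" 1] by (auto simp: d_def norm_mult intro!: mult_right_mono)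
  then have sd: "(\<lambda>k. cmod (d k)) summable_on UNIV"
    by (intro summable_on_comparison_test[OF summable_on_cmult_right[OF H1seq_summable[OF c], of 2]]) auto
  have le: "(cmod (d k))\<^sup>2 \<le> (of_int k + q)\<^sup>2 * (cmod (c k))\<^sup>2 * h\<^sup>2" for k
  proof -
    have "cmod (cis ((of_int k + q) * h) - 1) \<le> \<bar>(of_int k + q) * h\<bar>"
      using abs_sin_x_le_abs_x[of "(of_int k + q) * h / 2"] by (simp add: norm_cis_minus_1)
    then have "(cmod (cis ((of_int k + q) * h) - 1))\<^sup>2 \<le> ((of_int k + q) * h)\<^sup>2"
      using abs_le_square_iff by fastforce
    then have "(cmod (cis ((of_int k + q) * h) - 1))\<^sup>2 * (cmod (c k))\<^sup>2 \<le> ((of_int k + q) * h)\<^sup>2 * (cmod (c k))\<^sup>2"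
      by (rule mult_right_mono) simp
    then show ?thesis by (simp add: d_def norm_mult power_mult_distrib mult_ac)
  qed
  have "(\<integral>x. (cmod (fsum d x))\<^sup>2 \<partial>lam) \<le> kin q c * h\<^sup>2"
  proof (rule has_sum_mono[OF parseval_fsum[OF sd]])
    show "((\<lambda>k. 2 * pi * ((of_int k + q)\<^sup>2 * (cmod (c k))\<^sup>2) * h\<^sup>2) has_sum kin q c * h\<^sup>2) UNIV"
      unfolding kin_def by (intro has_sum_cmult_left has_sum_cmult_right has_sum_infsum kin_summable c)
    show "2 * pi * (cmod (d k))\<^sup>2 \<le> 2 * pi * ((of_int k + q)\<^sup>2 * (cmod (c k))\<^sup>2) * h\<^sup>2" for k
      using mult_left_mono[OF le[of k], of "2 * pi"] by (simp add: mult_ac)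
  qed
  moreover have "d = (\<lambda>k. (cis ((of_int k + q) * h) - 1) * c k)" by (simp add: fun_eq_iff d_def)
  ultimately show ?thesis by (simp only: fsum_difference[OF c])
qed

lemma kin_nonneg: "kin q c \<ge> 0"
  unfolding kin_def by (intro mult_nonneg_nonneg infsum_nonneg) auto

text \<open>
  A pointwise comparison of the twisted differences of two functions, for small steps only,
  transfers to their kinetic energies, even at different quasimomenta.
\<close>

lemma kin_comparison:
  assumes c: "H1seq c" and w: "cper w" and r: "r > 0"
    and le: "\<And>h x. 0 < h \<Longrightarrow> h < r \<Longrightarrow> 
       cmod (cis (q' * h) * w (x + h) - w x) \<le> L * cmod (cis (q * h) * fsum c (x + h) - fsum c x)"
  shows "H1seq (fc w)" "kin q' (fc w) \<le> L\<^sup>2 * kin q c"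
proof -
  have D: "(\<integral>x. (cmod (cis (q' * h) * w (x + h) - w x))\<^sup>2 \<partial>lam) \<le> (L\<^sup>2 * kin q c) * h\<^sup>2" if h: "0 < h" "h < r" for h
  proof -
    have "(\<integral>x. (cmod (cis (q' * h) * w (x + h) - w x))\<^sup>2 \<partial>lam) \<le> (\<integral>x. L\<^sup>2 * (cmod (cis (q * h) * fsum c (x + h) - fsum c x))\<^sup>2 \<partial>lam)"
    proof (rule integral_mono)
      show "integrable lam (\<lambda>x. (cmod (cis (q' * h) * w (x + h) - w x))\<^sup>2)"
        using w by (intro cper_integrable finite_measure_lam cper_intros) auto
      show "integrable lam (\<lambda>x. L\<^sup>2 * (cmod (cis (q * h) * fsum c (x + h) - fsum c x))\<^sup>2)"
        using H1seq_cper[OF c] by (intro cper_integrable finite_measure_lam cper_intros) auto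
      show "(cmod (cis (q' * h) * w (x + h) - w x))\<^sup>2 \<le> L\<^sup>2 * (cmod (cis (q * h) * fsum c (x + h) - fsum c x))\<^sup>2" for x
        using power_mono[OF le[OF h, of x], of 2] by (simp add: power_mult_distrib)
    qed
    also have "\<dots> = L\<^sup>2 * (\<integral>x. (cmod (cis (q * h) * fsum c (x + h) - fsum c x))\<^sup>2 \<partial>lam)" by simp
    also have "\<dots> \<le> L\<^sup>2 * (kin q c * h\<^sup>2)"
      by (intro mult_left_mono difference_le_kin c) simp
    finally show ?thesis by (simp add: mult_ac)
  qed
  show "H1seq (fc w)" "kin q' (fc w) \<le> L\<^sup>2 * kin q c"
    using H1seq_from_differences[OF w r D] by auto
qed

lemma H1seq_expansion:
  assumes "cper w" "H1seq (fc w)"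
  shows "w = fsum (fc w)"
  by (rule fourier_expansion[OF assms(1) H1seq_summable[OF assms(2)]])

text \<open>
  The difference of \<open>|v|\<^sup>2\<close> at two points is at most \<open>2 B\<close> times the difference of \<open>v\<close>, where
  \<open>B\<close> bounds \<open>|v|\<close>. This is the only instance of the algebra property of \<open>H\<^sup>1\<close> that the quadratic form calls for.
\<close>

lemma H1seq_norm_square:
  assumes c: "H1seq c"
  shows "H1seq (fc (\<lambda>x. cnj (fsum c x) * fsum c x))"
proof -
  let ?v = "fsum c"
  obtain B where B: "B > 0" "\<And>x. cmod (?v x) \<le> B" using cper_bounded[OF H1seq_cper[OF c]] by blast
  show ?thesis
  proof (rule kin_comparison(1)[OF c, where q = 0 and q' = 0 and L = "2 * B" and r = 1])
    show "cper (\<lambda>x. cnj (?v x) * ?v x)" using H1seq_cper[OF c] by (intro cper_intros)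
    fix h x :: real
    have "cnj a * a - cnj b * b = cnj a * (a - b) + cnj (a - b) * b" for a b :: complex
      by (simp add: algebra_simps)
    then have "cmod (cnj (?v (x + h)) * ?v (x + h) - cnj (?v x) * ?v x)
      \<le> cmod (?v (x + h)) * cmod (?v (x + h) - ?v x) + cmod (?v (x + h) - ?v x) * cmod (?v x)"
      using norm_triangle_ineq[of "cnj (?v (x + h)) * (?v (x + h) - ?v x)" "cnj (?v (x + h) - ?v x) * ?v x"]
      by (simp only: norm_mult complex_mod_cnj)
    also have "\<dots> \<le> B * cmod (?v (x + h) - ?v x) + cmod (?v (x + h) - ?v x) * B"
      using B by (intro add_mono mult_mono) (auto intro: less_imp_le)
    finally show "cmod (cis (0 * h) * (cnj (?v (x + h)) * ?v (x + h)) - cnj (?v x) * ?v x)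
         \<le> 2 * B * cmod (cis (0 * h) * ?v (x + h) - ?v x)" by (simp add: mult.commute)
  qed auto
qed

section \<open>Test functions, distributions and the energy space\<close>

lemma test_fun_derivative:
  assumes "\<phi> \<in> test_funs"
  shows "(\<phi> has_vector_derivative Defs.D \<phi> x) (at x)"
proof -
  have "\<phi> differentiable (at x)"
    using assms unfolding test_funs_def by (auto dest: spec[of _ 0])
  then show ?thesis by (simp add: Defs.D_def vector_derivative_works)
qed

lemma test_fun_cper:
  assumes "\<phi> \<in> test_funs"
  shows "cper \<phi>"
proof -
  have "isCont \<phi> x" for x
    using test_fun_derivative[OF assms] has_vector_derivative_continuous by blast
  then show ?thesis using assms by (auto simp: cper_def test_funs_def continuous_on_eq_continuous_at)
qed

lemma test_fun_D:
  assumes "\<phi> \<in> test_funs"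
  shows "Defs.D \<phi> \<in> test_funs"
proof -
  have p: "periodic \<phi>" and d: "(Defs.D ^^ n) \<phi> differentiable (at x)" for n x
    using assms by (auto simp: test_funs_def)
  have "Defs.D \<phi> (x + 2 * pi) = Defs.D \<phi> x" for x
  proof -
    have "((\<phi> \<circ> (\<lambda>x. x + 2 * pi)) has_vector_derivative (1 *\<^sub>R Defs.D \<phi> (x + 2 * pi))) (at x)"
      by (intro vector_diff_chain_at test_fun_derivative assms) (auto intro!: derivative_eq_intros)
    moreover have "\<phi> \<circ> (\<lambda>x. x + 2 * pi) = \<phi>" using p by (auto simp: periodic_def)
    ultimately show ?thesis
      using vector_derivative_unique_at[OF test_fun_derivative[OF assms]] by fastforce
  qed
  moreover have "(Defs.D ^^ n) (Defs.D \<phi>) differentiable (at x)" for n x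
    using d[of "Suc n" x] by (simp add: funpow_swap1)
  ultimately show ?thesis by (auto simp: test_funs_def periodic_def)
qed

lemma D_cis: "Defs.D (\<lambda>x. a * cis (of_int k * x)) = (\<lambda>x. (\<i> * of_int k * a) * cis (of_int k * x))"
  and differentiable_cis: "(\<lambda>x. a * cis (of_int k * x)) differentiable (at x)"
proof -
  have d: "((\<lambda>x. a * cis (of_int k * x)) has_vector_derivative (\<i> * of_int k * a) * cis (of_int k * x)) (at x)" for x
  proof -
    have "((\<lambda>x. a * exp (\<i> * of_int k * of_real x)) has_vector_derivative 
       (\<i> * of_int k * a) * exp (\<i> * of_int k * of_real x)) (at x)"
      by (auto intro!: derivative_eq_intros has_vector_derivative_real_field simp: field_simps)
    then show ?thesis by (simp add: cis_conv_exp mult.assoc)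
  qed
  then show "Defs.D (\<lambda>x. a * cis (of_int k * x)) = (\<lambda>x. (\<i> * of_int k * a) * cis (of_int k * x))"
    by (auto simp: Defs.D_def fun_eq_iff intro!: vector_derivative_at)
  show "(\<lambda>x. a * cis (of_int k * x)) differentiable (at x)"
    using d[of x] by (rule differentiableI_vector)
qed

lemma test_fun_cis: "(\<lambda>x. a * cis (of_int k * x)) \<in> test_funs"
proof -
  have iter: "(Defs.D ^^ n) (\<lambda>x. a * cis (of_int k * x)) = (\<lambda>x. ((\<i> * of_int k) ^ n * a) * cis (of_int k * x))" for n
  proof (induction n)
    case (Suc n)
    have "(Defs.D ^^ Suc n) (\<lambda>x. a * cis (of_int k * x)) = Defs.D (\<lambda>x. ((\<i> * of_int k) ^ n * a) * cis (of_int k * x))"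
      by (simp only: funpow.simps o_apply Suc)
    also have "\<dots> = (\<lambda>x. ((\<i> * of_int k) ^ Suc n * a) * cis (of_int k * x))"
      unfolding D_cis power_Suc by (simp only: mult.assoc)
    finally show ?case .
  qed simp
  have "cper (\<lambda>x. a * cis (of_int k * x))" by (intro cper_intros)
  then show ?thesis unfolding test_funs_def mem_Collect_eq iter using differentiable_cis by (simp only: cper_def simp_thms)
qed

lemma fourier_basis_eq:
  "(\<lambda>x. exp (- \<i> * of_int k * of_real x) / of_real (sqrt (2 * pi))) = (\<lambda>x. (1 / of_real (sqrt (2 * pi))) * cis (of_int (- k) * x))"
  by (simp add: fun_eq_iff cis_conv_exp mult.assoc)

lemma fourier_basis_test_fun:
  "(\<lambda>x. exp (- \<i> * of_int k * of_real x) / of_real (sqrt (2 * pi))) \<in> test_funs"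
  unfolding fourier_basis_eq by (rule test_fun_cis)

lemma distr_of_fun_apply:
  assumes "f \<in> borel_measurable borel" "\<phi> \<in> test_funs"
  shows "distr_of_fun f \<phi> = (\<integral>x. f x * \<phi> x \<partial>lam)"
  using assms cper_measurable[OF test_fun_cper[OF assms(2)]]
  by (simp add: distr_of_fun_def set_integral_cell_measure borel_measurable_times)

lemma fourier_coeff_distr_of_fun:
  assumes "f \<in> borel_measurable borel"
  shows "fourier_coeff (distr_of_fun f) k = of_real (sqrt (2 * pi)) * fc f k"
proof -
  have "fourier_coeff (distr_of_fun f) k = (\<integral>x. f x * ((1 / of_real (sqrt (2 * pi))) * cis (of_int (- k) * x)) \<partial>lam)"
    unfolding fourier_coeff_def fourier_basis_eq by (rule distr_of_fun_apply[OF assms test_fun_cis])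
  also have "\<dots> = (\<integral>x. (1 / of_real (sqrt (2 * pi))) * (f x * cis (- (of_int k * x))) \<partial>lam)"
    by (simp add: mult_ac)
  also have "\<dots> = (1 / of_real (sqrt (2 * pi))) * (2 * of_real pi * fc f k)"
    by (simp only: integral_mult_right_zero) (simp add: fc_def)
  also have "\<dots> = (of_real (sqrt (2 * pi)) * of_real (sqrt (2 * pi)) / of_real (sqrt (2 * pi))) * fc f k"
    by (simp only: of_real_mult[symmetric] real_sqrt_mult_self) simp
  finally show ?thesis by simp
qed

lemma integrable_mult_bounded:
  fixes f g :: "real \<Rightarrow> complex"
  assumes "sets \<mu> = sets borel" "integrable \<mu> f" "g \<in> borel_measurable borel" "\<And>x. cmod (g x) \<le> B"
  shows "integrable \<mu> (\<lambda>x. f x * g x)"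
proof (rule Bochner_Integration.integrable_bound)
  have [measurable_cong]: "sets \<mu> = sets borel" by fact
  have [measurable]: "g \<in> borel_measurable borel" "f \<in> borel_measurable \<mu>" using assms by auto
  show "integrable \<mu> (\<lambda>x. f x * of_real B)" using assms by simp
  show "(\<lambda>x. f x * g x) \<in> borel_measurable \<mu>" by measurable
  have "cmod (g x) \<le> \<bar>B\<bar>" for x using assms(4)[of x] by linarith
  then show "AE x in \<mu>. norm (f x * g x) \<le> norm (f x * of_real B)"
    by (auto simp: norm_mult intro!: AE_I2 mult_left_mono)
qed

lemma integrable_mult_cper:
  fixes f g :: "real \<Rightarrow> complex"
  assumes "sets \<mu> = sets borel" "integrable \<mu> f" "cper g"
  shows "integrable \<mu> (\<lambda>x. f x * g x)"
proof -
  obtain B where "B > 0" "\<And>x. cmod (g x) \<le> B" using cper_bounded[OF assms(3)] by blast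
  then show ?thesis using assms by (intro integrable_mult_bounded[of \<mu> f g B] cper_measurable)
qed

lemma test_fun_add:
  assumes "\<phi> \<in> test_funs" "\<psi> \<in> test_funs"
  shows "(\<lambda>x. \<phi> x + \<psi> x) \<in> test_funs"
proof -
  have "(Defs.D ^^ n) (\<lambda>x. \<phi> x + \<psi> x) = (\<lambda>x. (Defs.D ^^ n) \<phi> x + (Defs.D ^^ n) \<psi> x)" for n
  proof (induction n)
    case (Suc n)
    have "Defs.D (\<lambda>x. (Defs.D ^^ n) \<phi> x + (Defs.D ^^ n) \<psi> x) = (\<lambda>x. Defs.D ((Defs.D ^^ n) \<phi>) x + Defs.D ((Defs.D ^^ n) \<psi>) x)"
      using assms by (auto simp: Defs.D_def test_funs_def fun_eq_iff)
    then show ?case using Suc by simp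
  qed simp
  then show ?thesis using assms unfolding test_funs_def by (auto simp: periodic_def intro!: differentiable_add)
qed

lemma test_fun_cmult:
  assumes "\<phi> \<in> test_funs"
  shows "(\<lambda>x. c * \<phi> x) \<in> test_funs"
proof -
  have "(Defs.D ^^ n) (\<lambda>x. c * \<phi> x) = (\<lambda>x. c * (Defs.D ^^ n) \<phi> x)" for n
  proof (induction n)
    case (Suc n)
    have "Defs.D (\<lambda>x. c * (Defs.D ^^ n) \<phi> x) = (\<lambda>x. c * Defs.D ((Defs.D ^^ n) \<phi>) x)"
      using assms by (auto simp: Defs.D_def test_funs_def fun_eq_iff)
    then show ?case using Suc by simp
  qed simp
  then show ?thesis using assms unfolding test_funs_def by (auto simp: periodic_def intro!: differentiable_mult)
qed

text \<open>
  The functional is bounded by the supremum norm of the test function, so order zero suffices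
  in the continuity estimate.
\<close>

lemma distribution_of_integral:
  fixes f :: "real \<Rightarrow> complex"
  assumes s: "sets \<mu> = sets borel" and f: "integrable \<mu> f"
  shows "(\<lambda>\<phi>\<in>test_funs. \<integral>x. f x * \<phi> x \<partial>\<mu>) \<in> distributions"
proof -
  let ?T = "\<lambda>\<phi>\<in>test_funs. \<integral>x. f x * \<phi> x \<partial>\<mu>"
  have i: "integrable \<mu> (\<lambda>x. f x * \<phi> x)" if "\<phi> \<in> test_funs" for \<phi>
    by (rule integrable_mult_cper[OF s f test_fun_cper[OF that]])
  have "cmod (?T \<phi>) \<le> (\<integral>x. cmod (f x) \<partial>\<mu>) * (\<Sum>n\<le>0. SUP x. cmod ((Defs.D ^^ n) \<phi> x))" if t: "\<phi> \<in> test_funs" for \<phi>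
  proof -
    obtain B where B: "B > 0" "\<And>x. cmod (\<phi> x) \<le> B" using cper_bounded[OF test_fun_cper[OF t]] by blast
    define S where "S = (SUP x. cmod (\<phi> x))"
    have S: "cmod (\<phi> x) \<le> S" for x unfolding S_def using B by (intro cSUP_upper bdd_aboveI2) auto
    have "cmod (\<integral>x. f x * \<phi> x \<partial>\<mu>) \<le> (\<integral>x. cmod (f x * \<phi> x) \<partial>\<mu>)" by (rule integral_norm_bound)
    also have "\<dots> \<le> (\<integral>x. cmod (f x) * S \<partial>\<mu>)"
    proof (rule integral_mono)
      show "integrable \<mu> (\<lambda>x. cmod (f x * \<phi> x))" by (rule integrable_norm[OF i[OF t]])
      show "integrable \<mu> (\<lambda>x. cmod (f x) * S)" using f by simp
      show "cmod (f x * \<phi> x) \<le> cmod (f x) * S" for x unfolding norm_mult by (rule mult_left_mono[OF S]) simp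
    qed
    finally show ?thesis using t by (simp add: S_def)
  qed
  then have "\<exists>C N. \<forall>\<phi>\<in>test_funs. cmod (?T \<phi>) \<le> C * (\<Sum>n\<le>N. SUP x. cmod ((Defs.D ^^ n) \<phi> x))"
    by blast
  moreover have "?T (\<lambda>x. \<phi> x + \<psi> x) = ?T \<phi> + ?T \<psi>" if "\<phi> \<in> test_funs" "\<psi> \<in> test_funs" for \<phi> \<psi>
    using that i by (simp add: test_fun_add distrib_left)
  moreover have "?T (\<lambda>x. c * \<phi> x) = c * ?T \<phi>" if "\<phi> \<in> test_funs" for \<phi> c
    using that by (simp add: test_fun_cmult mult.left_commute[of "f _"])
  ultimately show ?thesis
    unfolding distributions_def using restrict_extensional by blast
qed

lemma distr_of_fun_eq:
  assumes "f \<in> borel_measurable borel"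
  shows "distr_of_fun f = (\<lambda>\<phi>\<in>test_funs. \<integral>x. f x * \<phi> x \<partial>lam)"
  using distr_of_fun_apply[OF assms] by (auto simp: fun_eq_iff distr_of_fun_def)

text \<open>
  The weight \<open>(1 + k\<^sup>2) powr 1\<close> and the factor \<open>sqrt (2 \<pi>)\<close> between the two normalisations of the
  coefficients are all that separates the two descriptions.
\<close>

lemma H1_per_iff: "v \<in> H1_per \<longleftrightarrow> cper v \<and> H1seq (fc v)"
proof (cases "cper v")
  case True
  have m: "v \<in> borel_measurable borel" using True by (rule cper_measurable)
  have "integrable lam v" using True by (intro cper_integrable finite_measure_lam) auto
  then have d: "distr_of_fun v \<in> distributions"
    unfolding distr_of_fun_eq[OF m] by (intro distribution_of_integral) auto
  have "(cmod (fourier_coeff (distr_of_fun v) k))\<^sup>2 = 2 * pi * (cmod (fc v k))\<^sup>2" for k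
    by (simp add: fourier_coeff_distr_of_fun[OF m] norm_mult power_mult_distrib)
  moreover have "(1 + \<bar>real_of_int k\<bar>\<^sup>2) powr 1 = 1 + (real_of_int k)\<^sup>2" for k
    by (simp add: add_pos_nonneg)
  ultimately have "distr_of_fun v \<in> sobolev_per 1 \<longleftrightarrow> (\<lambda>k. (2 * pi) * ((1 + (real_of_int k)\<^sup>2) * (cmod (fc v k))\<^sup>2)) summable_on UNIV"
    using d by (simp add: sobolev_per_def mult_ac)
  also have "\<dots> \<longleftrightarrow> H1seq (fc v)"
    unfolding H1seq_def by (rule summable_on_cmult_right') simp
  finally show ?thesis using True by (simp add: H1_per_def cper_def)
qed (auto simp: H1_per_def cper_def)

lemma H1_per_fsum: "H1seq c \<Longrightarrow> fsum c \<in> H1_per"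
  by (simp add: H1_per_iff H1seq_cper H1seq_fc_fsum)

lemma H1_perE:
  assumes "v \<in> H1_per"
  obtains c where "H1seq c" "v = fsum c"
  using assms H1seq_expansion unfolding H1_per_iff by blast

lemma integration_by_parts_periodic:
  fixes \<phi> :: "real \<Rightarrow> complex"
  assumes t: "\<phi> \<in> test_funs"
  shows "(\<integral>x. (\<i> * of_int k) * cis (of_int k * x) * \<phi> x \<partial>lam) = - (\<integral>x. cis (of_int k * x) * Defs.D \<phi> x \<partial>lam)"
proof -
  let ?e = "\<lambda>x. cis (of_int k * x)"
  have e: "(?e has_vector_derivative (\<i> * of_int k) * ?e x) (at x)" for x
    using test_fun_derivative[OF test_fun_cis[of 1 k], of x] D_cis[of 1 k] by simp
  have d: "((\<lambda>x. ?e x * \<phi> x) has_vector_derivative (?e x * Defs.D \<phi> x + (\<i> * of_int k) * ?e x * \<phi> x)) (at x)" for x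
    by (rule has_vector_derivative_mult[OF e test_fun_derivative[OF t]])
  have c1: "cper (\<lambda>x. ?e x * Defs.D \<phi> x)" and c2: "cper (\<lambda>x. (\<i> * of_int k) * ?e x * \<phi> x)" and c3: "cper (\<lambda>x. ?e x * \<phi> x)"
    using test_fun_cper[OF t] test_fun_cper[OF test_fun_D[OF t]] by (auto intro!: cper_intros)
  have "((\<lambda>x. ?e x * Defs.D \<phi> x + (\<i> * of_int k) * ?e x * \<phi> x) has_integral (?e pi * \<phi> pi - ?e (-pi) * \<phi> (-pi))) {-pi..pi}"
    using d by (intro fundamental_theorem_of_calculus) (auto intro: has_vector_derivative_at_within)
  moreover have "?e pi * \<phi> pi = ?e (-pi) * \<phi> (-pi)"
    using c3 by (auto simp: cper_def periodic_def dest: spec[of _ "-pi"])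
  ultimately have "integral {-pi..pi} (\<lambda>x. ?e x * Defs.D \<phi> x + (\<i> * of_int k) * ?e x * \<phi> x) = 0"
    by (simp add: integral_unique)
  then have "(\<integral>x. ?e x * Defs.D \<phi> x + (\<i> * of_int k) * ?e x * \<phi> x \<partial>lam) = 0"
    using cper_add[OF c1 c2] by (subst lam_integral_eq_HK) (auto simp: cper_def)
  moreover have "integrable lam (\<lambda>x. ?e x * Defs.D \<phi> x)" "integrable lam (\<lambda>x. (\<i> * of_int k) * ?e x * \<phi> x)"
    using c1 c2 by (auto intro: cper_integrable finite_measure_lam)
  ultimately show ?thesis by (simp add: eq_neg_iff_add_eq_0 add.commute)
qed

section \<open>Integrable functions with vanishing Fourier coefficients\<close>

text \<open>
  The indicator of an open subset of the circle is an increasing limit of the continuous functions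
  \<open>min 1 (n * infdist (cis x) (- U))\<close>.
\<close>

lemma orthogonal_open_arc:
  fixes f :: "real \<Rightarrow> complex"
  assumes f: "f \<in> borel_measurable borel" "integrable lam f"
    and z: "\<And>k. (\<integral>x. f x * cis (of_int k * x) \<partial>lam) = 0" and U: "open U"
  shows "(\<integral>x. indicator {x. cis x \<in> U} x *\<^sub>R f x \<partial>lam) = 0"
\<comment> \<open>Distances to the complement degenerate when the complement is empty.\<close>
proof (cases "U = UNIV")
  case True
  then show ?thesis using z[of 0] by simp
next
  case False
  define u where "u n x = min 1 (real n * infdist (cis x) (- U))" for n x
  have cu: "cper (\<lambda>x. complex_of_real (u n x))" for n
  proof -
    have "cis (x + 2 * pi) = cis x" for x
      using cper_cis[of 1] by (simp add: cper_def periodic_def)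
    then show ?thesis
      unfolding u_def by (auto simp: cper_def periodic_def intro!: continuous_intros)
  qed
  have "(\<lambda>n. \<integral>x. f x * complex_of_real (u n x) \<partial>lam) \<longlonglongrightarrow> (\<integral>x. indicator {x. cis x \<in> U} x *\<^sub>R f x \<partial>lam)"
  proof (rule integral_dominated_convergence[where w = "\<lambda>x. cmod (f x)"])
    show "AE x in lam. (\<lambda>n. f x * complex_of_real (u n x)) \<longlonglongrightarrow> indicator {x. cis x \<in> U} x *\<^sub>R f x"
    proof (rule AE_I2)
      fix x
      show "(\<lambda>n. f x * complex_of_real (u n x)) \<longlonglongrightarrow> indicator {x. cis x \<in> U} x *\<^sub>R f x"
      proof (cases "cis x \<in> U")
        case True
        have "infdist (cis x) (- U) > 0"
          using True U False by (intro infdist_pos_not_in_closed) auto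
        then obtain N where N: "1 < real N * infdist (cis x) (- U)" using reals_Archimedean3 by blast
        have "u n x = 1" if "n \<ge> N" for n
        proof -
          have "real N * infdist (cis x) (- U) \<le> real n * infdist (cis x) (- U)"
            using that infdist_nonneg by (intro mult_right_mono) auto
          then show ?thesis using N by (simp add: u_def)
        qed
        then have "eventually (\<lambda>n. f x * complex_of_real (u n x) = f x) sequentially"
          by (auto simp: eventually_sequentially)
        then show ?thesis using True by (simp add: tendsto_eventually)
      next
        case False
        then have "infdist (cis x) (- U) = 0" by (intro infdist_zero) auto
        then show ?thesis using False by (simp add: u_def)
      qed
    qed
    show "(\<lambda>x. indicator {x. cis x \<in> U} x *\<^sub>R f x) \<in> borel_measurable lam"
    proof -
      have "open (cis -` U)" using U by (intro open_vimage) (auto intro!: continuous_intros)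
      then have "{x. cis x \<in> U} \<in> sets borel" by (simp add: vimage_def)
      then show ?thesis using f(1) by simp
    qed
    show "(\<lambda>x. f x * complex_of_real (u n x)) \<in> borel_measurable lam" for n
      using f(1) cper_measurable[OF cu] by simp
    have "\<bar>u n x\<bar> \<le> 1" for n x unfolding u_def by (auto simp: infdist_nonneg)
    then show "AE x in lam. norm (f x * complex_of_real (u n x)) \<le> cmod (f x)" for n
      by (auto simp: norm_mult intro!: AE_I2 mult_left_le)
  qed (use f in auto)
  moreover have "(\<integral>x. f x * complex_of_real (u n x) \<partial>lam) = 0" for n
    by (rule orthogonal_cper[OF f z cu])
  ultimately show ?thesis by (simp add: LIMSEQ_const_iff)
qed

text \<open>
  Up to the null set \<open>{- \<pi>}\<close>, the part of a ray inside the cell is an open arc of the circle.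
\<close>

lemma orthogonal_ray:
  fixes f :: "real \<Rightarrow> complex"
  assumes f: "f \<in> borel_measurable borel" "integrable lam f"
    and z: "\<And>k. (\<integral>x. f x * cis (of_int k * x) \<partial>lam) = 0"
  shows "(\<integral>x. indicator {a<..} x *\<^sub>R f x \<partial>lam) = 0"
proof -
  let ?S = "- \<real>\<^sub>\<le>\<^sub>0 :: complex set"
  let ?U = "?S \<inter> Arg -` {a<..}"
  have "open ?U" by (intro continuous_open_preimage continuous_on_Arg) auto
  then have U: "(\<integral>x. indicator {x. cis x \<in> ?U} x *\<^sub>R f x \<partial>lam) = 0" by (rule orthogonal_open_arc[OF f z])
  have ae: "AE x in lam. x \<in> cell \<and> x \<noteq> - pi"
  proof -
    have "AE x in lborel. 0 < (indicator cell x :: ennreal) \<longrightarrow> x \<in> cell \<and> x \<noteq> - pi"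
      using AE_lborel_singleton[of "- pi"] by eventually_elim (auto simp: indicator_def)
    then show ?thesis unfolding cell_measure_def by (subst AE_density) auto
  qed
  have "indicator {x. cis x \<in> ?U} x = (indicator {a<..} x :: real)" if "x \<in> cell" "x \<noteq> - pi" for x
  proof -
    have x: "-pi < x" "x < pi" using that by (auto simp: cell_def)
    then have A: "Arg (cis x) = x" by (intro Arg_cis) auto
    have "cis x \<notin> \<real>\<^sub>\<le>\<^sub>0"
    proof
      assume "cis x \<in> \<real>\<^sub>\<le>\<^sub>0"
      then have "cis x = - 1" using sin_cos_squared_add[of x]
        by (auto simp: complex_nonpos_Reals_iff complex_eq_iff power2_eq_1_iff)
      then have "cis x = cis pi" by simp
      then have "Arg (cis x) = pi" using Arg_cis[of pi] by simp
      then show False using A x by simp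
    qed
    then show ?thesis using A by (auto simp: indicator_def)
  qed
  then have "(\<integral>x. indicator {a<..} x *\<^sub>R f x \<partial>lam) = (\<integral>x. indicator {x. cis x \<in> ?U} x *\<^sub>R f x \<partial>lam)"
    using \<open>open ?U\<close> f(1)
  proof (intro integral_cong_AE)
    have "open (cis -` ?U)" using \<open>open ?U\<close> by (intro open_vimage) (auto intro!: continuous_intros)
    then have "{x. cis x \<in> ?U} \<in> sets borel" unfolding vimage_def by (rule borel_open)
    then show "(\<lambda>x. indicator {x. cis x \<in> ?U} x *\<^sub>R f x) \<in> borel_measurable lam" using f(1) by simp
    show "AE x in lam. indicator {a<..} x *\<^sub>R f x = indicator {x. cis x \<in> ?U} x *\<^sub>R f x"
      using ae by eventually_elim (use \<open>\<And>x. x \<in> cell \<Longrightarrow> x \<noteq> - pi \<Longrightarrow> indicator {x. cis x \<in> ?U} x = (indicator {a<..} x :: real)\<close> in auto)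
  qed auto
  then show ?thesis using U by simp
qed

text \<open>
  Uniqueness for \<open>L\<^sup>1\<close> functions, where testing with the function itself is impossible. The Borel sets over which \<open>f\<close>
  integrates to zero contain all rays \<open>{a<..}\<close> and form a Dynkin system, so they are all Borel
  sets.
\<close>

lemma zero_coefficients_AE_zero:
  fixes f :: "real \<Rightarrow> complex"
  assumes f: "f \<in> borel_measurable borel" "integrable lam f"
    and z: "\<And>k. (\<integral>x. f x * cis (of_int k * x) \<partial>lam) = 0"
  shows "AE x in lam. f x = 0"
proof -
  interpret finite_measure lam by (rule finite_measure_lam)
  let ?G = "range greaterThan :: real set set"
  have tot: "(\<integral>x. f x \<partial>lam) = 0" using z[of 0] by simp
  have si: "set_integrable lam A f" if "A \<in> sets borel" for A
    unfolding set_integrable_def using f(2) that by (intro integrable_mult_indicator) auto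
  have borel_gen: "sets borel = sigma_sets UNIV ?G"
    by (subst borel_Ioi) (simp add: sets_measure_of)
  have "Int_stable ?G"
  proof (rule Int_stableI)
    fix a b assume "a \<in> ?G" "b \<in> ?G"
    then obtain s t where "a = {s<..}" "b = {t<..}" by auto
    then have "a \<inter> b = {max s t<..}" by auto
    then show "a \<inter> b \<in> ?G" by blast
  qed
  moreover have "?G \<subseteq> Pow UNIV" by simp
  ultimately have "(LINT x:A|lam. f x) = 0" if "A \<in> sigma_sets UNIV ?G" for A
    using that
  proof (induction rule: sigma_sets_induct_disjoint)
    case (basic A)
    then show ?case using orthogonal_ray[OF f z] by (auto simp: set_lebesgue_integral_def)
  next
    case empty
    then show ?case by (simp add: set_lebesgue_integral_def)
  next
    case (compl A)
    then have A: "A \<in> sets borel" by (simp add: borel_gen)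
    have "(LINT x:A \<union> (UNIV - A)|lam. f x) = (LINT x:A|lam. f x) + (LINT x:UNIV - A|lam. f x)"
      using A by (intro set_integral_Un si) auto
    moreover have "(LINT x:A \<union> (UNIV - A)|lam. f x) = 0"
      using tot by (simp add: set_lebesgue_integral_def)
    ultimately show ?case using compl by simp
  next
    case (union A)
    then have A: "A i \<in> sets borel" for i by (simp add: borel_gen image_subset_iff)
    have "(LINT x:(\<Union>i. A i)|lam. f x) = (\<Sum>i. LINT x:A i|lam. f x)"
      using A union(1) by (intro lebesgue_integral_countable_add si) (auto simp: disjoint_family_on_def)
    then show ?case using union by simp
  qed
  then have "(LINT x:A|lam. f x) = (LINT x:A|lam. 0)" if "A \<in> sets lam" for A
    using that borel_gen by simp
  then show ?thesis
    using f(2) by (intro density_unique_banach[of f "\<lambda>_. 0"]) auto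
qed

section \<open>The weak derivative and its energy\<close>

lemma symmetric_intervals_exhaust:
  "filterlim (\<lambda>N. {- int N..int N}) (finite_subsets_at_top UNIV) sequentially"
  unfolding filterlim_finite_subsets_at_top
proof (intro allI impI)
  fix X :: "int set" assume "finite X \<and> X \<subseteq> UNIV"
  then have "bdd_above (nat ` abs ` X)" by (intro bdd_above_finite) auto
  then obtain M where M: "nat \<bar>k\<bar> \<le> M" if "k \<in> X" for k by (auto simp: bdd_above_def)
  show "\<forall>\<^sub>F N in sequentially. finite {- int N..int N} \<and> X \<subseteq> {- int N..int N} \<and> {- int N..int N} \<subseteq> UNIV"
    unfolding eventually_sequentially
  proof (intro exI[of _ M] allI impI)
    fix N assume "M \<le> N"
    have "k \<in> {- int N..int N}" if "k \<in> X" for k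
      using M[OF that] \<open>M \<le> N\<close> by auto
    then show "finite {- int N..int N} \<and> X \<subseteq> {- int N..int N} \<and> {- int N..int N} \<subseteq> UNIV" by auto
  qed
qed

lemma has_sum_symmetric_limit:
  assumes "(f has_sum S) (UNIV :: int set)" "filterlim n at_top sequentially"
  shows "(\<lambda>j. \<Sum>k\<in>{- int (n j)..int (n j)}. f k) \<longlonglongrightarrow> S"
  using filterlim_compose[OF assms(1)[unfolded has_sum_def] filterlim_compose[OF symmetric_intervals_exhaust assms(2)]] .

lemma parseval_finite:
  assumes "finite F"
  shows "(\<integral>x. (cmod (\<Sum>k\<in>F. d k * cis (of_int k * x)))\<^sup>2 \<partial>lam) = 2 * pi * (\<Sum>k\<in>F. (cmod (d k))\<^sup>2)"
proof -
  define e where "e k = (if k \<in> F then d k else 0)" for k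
  have s: "(\<lambda>k. cmod (e k)) summable_on UNIV"
    by (rule has_sum_imp_summable[OF has_sum_finite_neutralI[OF assms]]) (auto simp: e_def)
  have "fsum e x = (\<Sum>k\<in>F. d k * cis (of_int k * x))" for x
    unfolding fsum_def by (rule infsumI, rule has_sum_finite_neutralI[OF assms]) (auto simp: e_def)
  moreover have "((\<lambda>k. 2 * pi * (cmod (e k))\<^sup>2) has_sum 2 * pi * (\<Sum>k\<in>F. (cmod (d k))\<^sup>2)) UNIV"
    by (rule has_sum_finite_neutralI[OF assms]) (auto simp: e_def sum_distrib_left)
  ultimately show ?thesis using has_sum_unique[OF parseval_fsum[OF s]] by simp
qed

lemma AE_summable_of_summable_integrals:
  fixes b :: "nat \<Rightarrow> real \<Rightarrow> complex"
  assumes i: "\<And>j. integrable M (b j)" and s: "summable (\<lambda>j. \<integral>x. cmod (b j x) \<partial>M)"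
  shows "AE x in M. summable (\<lambda>j. cmod (b j x))"
proof -
  have [measurable]: "b j \<in> borel_measurable M" for j using i by auto
  have "(\<integral>\<^sup>+x. (\<Sum>j. ennreal (cmod (b j x))) \<partial>M) = (\<Sum>j. \<integral>\<^sup>+x. ennreal (cmod (b j x)) \<partial>M)"
    by (rule nn_integral_suminf) simp
  also have "\<dots> = (\<Sum>j. ennreal (\<integral>x. cmod (b j x) \<partial>M))"
    using i by (intro suminf_cong nn_integral_eq_integral) auto
  also have "\<dots> = ennreal (\<Sum>j. \<integral>x. cmod (b j x) \<partial>M)"
    by (rule suminf_ennreal2[OF _ s]) simp
  finally have "(\<integral>\<^sup>+x. (\<Sum>j. ennreal (cmod (b j x))) \<partial>M) \<noteq> \<infinity>" by simp
  then have "AE x in M. (\<Sum>j. ennreal (cmod (b j x))) \<noteq> \<infinity>"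
    by (intro nn_integral_PInf_AE) auto
  then show ?thesis
    by eventually_elim (rule summable_suminf_not_top, auto)
qed

text \<open>
  The differentiated Fourier series converges in \<open>L\<^sup>2\<close>, but a pointwise representative is needed. Along
  partial sums over \<open>{- n j..n j}\<close>, chosen so sparse that the remaining square sum is below \<open>(1/4) ^ j\<close>,
  consecutive differences have \<open>L\<^sup>1\<close> norms at most \<open>2 \<pi> (1/2) ^ j\<close>; so the series of differences converges
  absolutely almost everywhere. The limit \<open>g\<close> is the weak derivative by summing the partial
  integrations term by term, and Fatou's lemma bounds its energy.
\<close>

lemma weak_derivative_exists:
  assumes c: "H1seq c"
  obtains g where "g \<in> borel_measurable borel" "periodic g" 
    "\<And>\<phi>. \<phi> \<in> test_funs \<Longrightarrow> (\<integral>x. g x * \<phi> x \<partial>lam) = - (\<integral>x. fsum c x * Defs.D \<phi> x \<partial>lam)"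
    "\<And>q. integrable lam (\<lambda>x. (cmod (- \<i> * g x + of_real q * fsum c x))\<^sup>2)"
    "\<And>q. (\<integral>x. (cmod (- \<i> * g x + of_real q * fsum c x))\<^sup>2 \<partial>lam) \<le> kin q c"
proof -
  interpret finite_measure lam by (rule finite_measure_lam)
  define d where "d k = \<i> * of_int k * c k" for k
  define F where "F N = {- int N..int N}" for N
  have d2: "(cmod (d k))\<^sup>2 = (of_int k + 0)\<^sup>2 * (cmod (c k))\<^sup>2" for k
    by (simp add: d_def norm_mult power_mult_distrib)
  define S where "S = (\<Sum>\<^sub>\<infinity>k. (cmod (d k))\<^sup>2)"
  have hs: "((\<lambda>k. (cmod (d k))\<^sup>2) has_sum S) UNIV"
    unfolding S_def d2 by (intro has_sum_infsum kin_summable c)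
  have lim: "(\<lambda>N. \<Sum>k\<in>F N. (cmod (d k))\<^sup>2) \<longlonglongrightarrow> S"
    unfolding F_def by (rule has_sum_symmetric_limit[OF hs filterlim_ident])
  have leS: "(\<Sum>k\<in>F N. (cmod (d k))\<^sup>2) \<le> S" for N
    by (rule finite_sum_le_has_sum[OF hs]) (auto simp: F_def)
  have "\<exists>n. \<forall>j. S - (1/4) ^ j < (\<Sum>k\<in>F (n j). (cmod (d k))\<^sup>2) \<and> n j < n (Suc j)"
  proof (rule dependent_nat_choice)
    have ev: "eventually (\<lambda>N. S - (1/4) ^ j < (\<Sum>k\<in>F N. (cmod (d k))\<^sup>2)) sequentially" for j :: nat
      by (rule order_tendstoD(1)[OF lim]) simp
    show "\<exists>N. S - (1/4) ^ 0 < (\<Sum>k\<in>F N. (cmod (d k))\<^sup>2)"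
      using ev[of 0] by (rule eventually_happens'[rotated]) simp
    fix x j
    show "\<exists>N. S - (1/4) ^ Suc j < (\<Sum>k\<in>F N. (cmod (d k))\<^sup>2) \<and> x < N"
      using eventually_conj[OF ev[of "Suc j"] eventually_gt_at_top[of x]] 
      by (rule eventually_happens'[rotated]) simp
  qed
  then obtain n where n: "\<And>j. S - (1/4) ^ j < (\<Sum>k\<in>F (n j). (cmod (d k))\<^sup>2)" "\<And>j. n j < n (Suc j)" by blast
  have "strict_mono n" using n(2) by (simp add: strict_mono_Suc_iff)
  then have nlim: "filterlim n at_top sequentially" by (rule filterlim_subseq)
  define p where "p j x = (\<Sum>k\<in>F (n j). d k * cis (of_int k * x))" for j x
  define b where "b j x = (case j of 0 \<Rightarrow> p 0 x | Suc i \<Rightarrow> p (Suc i) x - p i x)" for j x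
  define v where "v j x = (\<Sum>k\<in>F (n j). c k * cis (of_int k * x))" for j x
  have cper_sum: "cper (\<lambda>x. \<Sum>k\<in>G. a k * cis (of_int k * x))" if "finite G" for G and a :: "int \<Rightarrow> complex"
    using that by (induction G rule: finite_induct) (auto intro!: cper_intros)
  have cp: "cper (p j)" for j
    using cper_sum[of "F (n j)" d] by (simp add: p_def[abs_def] F_def)
  have cb: "cper (b j)" for j
    using cper_diff[OF cp cp] cp by (cases j) (auto simp: b_def[abs_def])
  have sumb: "(\<Sum>j<Suc J. b j x) = p J x" for J x
    by (induction J) (auto simp: b_def)
  have bi: "integrable lam (b j)" for j by (intro cper_integrable finite_measure_lam cb) simp
  have bn: "(\<integral>x. cmod (b (Suc j) x) \<partial>lam) \<le> 2 * pi * (1/2) ^ j" for j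
  proof -
    have sub: "F (n j) \<subseteq> F (n (Suc j))" using n(2)[of j] by (auto simp: F_def)
    have fin: "finite (F (n (Suc j)))" by (simp add: F_def)
    have "b (Suc j) x = (\<Sum>k\<in>F (n (Suc j)) - F (n j). d k * cis (of_int k * x))" for x
      using sum_diff[OF fin sub, of "\<lambda>k. d k * cis (of_int k * x)"] by (simp add: b_def p_def)
    then have "(\<integral>x. (cmod (b (Suc j) x))\<^sup>2 \<partial>lam) = 2 * pi * (\<Sum>k\<in>F (n (Suc j)) - F (n j). (cmod (d k))\<^sup>2)"
      using fin by (simp add: parseval_finite)
    also have "\<dots> = 2 * pi * ((\<Sum>k\<in>F (n (Suc j)). (cmod (d k))\<^sup>2) - (\<Sum>k\<in>F (n j). (cmod (d k))\<^sup>2))"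
      using sum_diff[OF fin sub, of "\<lambda>k. (cmod (d k))\<^sup>2"] by simp
    also have "\<dots> \<le> 2 * pi * (1/4) ^ j"
      using leS[of "n (Suc j)"] n(1)[of j] by (intro mult_left_mono) auto
    finally have sq: "(\<integral>x. (cmod (b (Suc j) x))\<^sup>2 \<partial>lam) \<le> 2 * pi * (1/4) ^ j" .
    \<comment> \<open>With square integrals of size \<open>(1/4) ^ j\<close>, both terms of this Young inequality contribute
      \<open>\<pi> (1/2) ^ j\<close> to the integral.\<close>
    have pw: "t \<le> 2 ^ j / 2 * t\<^sup>2 + (1/2) ^ j / 2" for t :: real
    proof -
      have "0 \<le> (2 ^ j * t - 1)\<^sup>2" by simp
      then have "2 ^ j * (2 * t) \<le> 2 ^ j * (2 ^ j * t\<^sup>2 + (1/2) ^ j)"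
        by (simp add: power2_diff power_mult_distrib power2_eq_square algebra_simps power_one_over)
      then have "2 * t \<le> 2 ^ j * t\<^sup>2 + (1/2) ^ j" by simp
      then show ?thesis by simp
    qed
    have i2: "integrable lam (\<lambda>x. (cmod (b (Suc j) x))\<^sup>2)"
      by (intro cper_integrable finite_measure_lam cper_intros cb) simp
    have "(\<integral>x. cmod (b (Suc j) x) \<partial>lam) \<le> (\<integral>x. 2 ^ j / 2 * (cmod (b (Suc j) x))\<^sup>2 + (1/2) ^ j / 2 \<partial>lam)"
      using bi[of "Suc j"] i2 pw by (intro integral_mono) auto
    also have "\<dots> = 2 ^ j / 2 * (\<integral>x. (cmod (b (Suc j) x))\<^sup>2 \<partial>lam) + 2 * pi * ((1/2) ^ j / 2)"
      using i2 by (simp add: measure_lam)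
    also have "\<dots> \<le> 2 ^ j / 2 * (2 * pi * (1/4) ^ j) + 2 * pi * ((1/2) ^ j / 2)"
      using sq by (intro add_mono mult_left_mono) auto
    also have "\<dots> = 2 * pi * (1/2) ^ j"
    proof -
      have "(2::real) ^ j * (1/4) ^ j = (1/2) ^ j" by (simp flip: power_mult_distrib)
      then show ?thesis by (simp add: algebra_simps)
    qed
    finally show ?thesis .
  qed
  have sb: "summable (\<lambda>j. \<integral>x. cmod (b j x) \<partial>lam)"
  proof (subst summable_Suc_iff[symmetric], rule summable_comparison_test'[of "\<lambda>j. 2 * pi * (1/2) ^ j" 0])
    show "summable (\<lambda>j. 2 * pi * (1/2::real) ^ j)" by (intro summable_mult summable_geometric) simp
    show "norm (\<integral>x. cmod (b (Suc j) x) \<partial>lam) \<le> 2 * pi * (1/2) ^ j" for j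
      using bn[of j] by simp
  qed
  have ae: "AE x in lam. summable (\<lambda>j. cmod (b j x))"
    by (rule AE_summable_of_summable_integrals[OF bi sb])
  define g where "g x = (\<Sum>j. b j x)" for x
  have gm: "g \<in> borel_measurable borel"
    unfolding g_def using cper_measurable[OF cb] by (intro borel_measurable_suminf)
  have gp: "periodic g" using cb by (simp add: g_def periodic_def cper_def)
  have vlim: "(\<lambda>j. v j x) \<longlonglongrightarrow> fsum c x" for x
    unfolding v_def F_def by (rule has_sum_symmetric_limit[OF fsum_has_sum[OF H1seq_summable[OF c]] nlim])
  have plim: "AE x in lam. (\<lambda>j. p j x) \<longlonglongrightarrow> g x"
    using ae
  proof eventually_elim
    case (elim x)
    have "(\<lambda>j. b j x) sums g x"
      unfolding g_def by (rule summable_sums[OF summable_norm_cancel[OF elim]])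
    then have "(\<lambda>J. \<Sum>j<Suc J. b j x) \<longlonglongrightarrow> g x"
      unfolding sums_def by (rule LIMSEQ_Suc)
    then show ?case by (simp only: sumb)
  qed
  have weak: "(\<integral>x. g x * \<phi> x \<partial>lam) = - (\<integral>x. fsum c x * Defs.D \<phi> x \<partial>lam)" if t: "\<phi> \<in> test_funs" for \<phi>
  proof -
    have cphi: "cper \<phi>" by (rule test_fun_cper[OF t])
    obtain B where B: "B > 0" "\<And>x. cmod (\<phi> x) \<le> B" using cper_bounded[OF cphi] by blast
    have bphi: "cper (\<lambda>x. b j x * \<phi> x)" for j by (intro cper_intros cb cphi)
    have ib: "integrable lam (\<lambda>x. b j x * \<phi> x)" for j by (intro cper_integrable finite_measure_lam bphi) simp
    have nb: "cmod (b j x * \<phi> x) \<le> cmod (b j x) * B" for j x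
      unfolding norm_mult by (rule mult_left_mono[OF B(2)]) simp
    have "(\<lambda>j. \<integral>x. b j x * \<phi> x \<partial>lam) sums (\<integral>x. (\<Sum>j. b j x * \<phi> x) \<partial>lam)"
    proof (rule sums_integral)
      show "AE x in lam. summable (\<lambda>j. norm (b j x * \<phi> x))"
        using ae
      proof eventually_elim
        case (elim x)
        show ?case by (rule summable_comparison_test'[OF summable_mult2[OF elim, of B], of 0]) (use nb in auto)
      qed
      have "(\<integral>x. norm (b j x * \<phi> x) \<partial>lam) \<le> (\<integral>x. cmod (b j x) \<partial>lam) * B" for j
      proof -
        have "(\<integral>x. norm (b j x * \<phi> x) \<partial>lam) \<le> (\<integral>x. cmod (b j x) * B \<partial>lam)"
          by (intro integral_mono nb integrable_norm ib integrable_mult_left bi)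
        then show ?thesis by simp
      qed
      then show "summable (\<lambda>j. \<integral>x. norm (b j x * \<phi> x) \<partial>lam)"
        by (intro summable_comparison_test'[OF summable_mult2[OF sb, of B], of 0]) auto
    qed (rule ib)
    moreover have "(\<integral>x. (\<Sum>j. b j x * \<phi> x) \<partial>lam) = (\<integral>x. g x * \<phi> x \<partial>lam)"
    proof (rule integral_cong_AE)
      show "AE x in lam. (\<Sum>j. b j x * \<phi> x) = g x * \<phi> x"
        using ae
      proof eventually_elim
        case (elim x)
        show ?case unfolding g_def by (rule suminf_mult2[OF summable_norm_cancel[OF elim], symmetric])
      qed
      show "(\<lambda>x. \<Sum>j. b j x * \<phi> x) \<in> borel_measurable lam"
        unfolding measurable_lam using cper_measurable[OF bphi] by (intro borel_measurable_suminf)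
      show "(\<lambda>x. g x * \<phi> x) \<in> borel_measurable lam"
        unfolding measurable_lam using cper_measurable[OF cphi] gm by (intro borel_measurable_times)
    qed
    ultimately have "(\<lambda>J. \<Sum>j<J. \<integral>x. b j x * \<phi> x \<partial>lam) \<longlonglongrightarrow> (\<integral>x. g x * \<phi> x \<partial>lam)"
      by (simp add: sums_def)
    then have 1: "(\<lambda>J. \<Sum>j<Suc J. \<integral>x. b j x * \<phi> x \<partial>lam) \<longlonglongrightarrow> (\<integral>x. g x * \<phi> x \<partial>lam)"
      by (rule LIMSEQ_Suc)
    have part: "(\<Sum>j<Suc J. \<integral>x. b j x * \<phi> x \<partial>lam) = - (\<Sum>k\<in>F (n J). c k * (\<integral>x. Defs.D \<phi> x * cis (of_int k * x) \<partial>lam))" for J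
    proof -
      have "(\<Sum>j<Suc J. \<integral>x. b j x * \<phi> x \<partial>lam) = (\<integral>x. (\<Sum>j<Suc J. b j x * \<phi> x) \<partial>lam)"
        using ib by (intro Bochner_Integration.integral_sum[symmetric])
      also have "\<dots> = (\<integral>x. p J x * \<phi> x \<partial>lam)"
        by (simp only: sum_distrib_right[symmetric] sumb)
      also have "\<dots> = (\<integral>x. (\<Sum>k\<in>F (n J). c k * (\<i> * of_int k * cis (of_int k * x) * \<phi> x)) \<partial>lam)"
        by (simp add: p_def d_def sum_distrib_left mult_ac)
      also have "\<dots> = (\<Sum>k\<in>F (n J). c k * (\<integral>x. \<i> * of_int k * cis (of_int k * x) * \<phi> x \<partial>lam))"
      proof (subst Bochner_Integration.integral_sum)
        show "integrable lam (\<lambda>x. c k * (\<i> * of_int k * cis (of_int k * x) * \<phi> x))" for k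
          by (intro cper_integrable finite_measure_lam cper_intros cphi) simp
      qed simp
      also have "\<dots> = (\<Sum>k\<in>F (n J). c k * (- (\<integral>x. cis (of_int k * x) * Defs.D \<phi> x \<partial>lam)))"
        by (simp only: integration_by_parts_periodic[OF t])
      finally show ?thesis by (simp add: sum_negf mult.commute)
    qed
    have cD: "cper (Defs.D \<phi>)" by (rule test_fun_cper[OF test_fun_D[OF t]])
    obtain B' where B': "\<And>x. cmod (Defs.D \<phi> x) \<le> B'" using cper_bounded[OF cD] by blast
    have "((\<lambda>k. c k * (\<integral>x. Defs.D \<phi> x * cis (of_int k * x) \<partial>lam)) has_sum (\<integral>x. Defs.D \<phi> x * fsum c x \<partial>lam)) UNIV"
      by (rule fsum_integral[OF H1seq_summable[OF c] finite_measure_lam lam_sets_borel cper_measurable[OF cD] B'])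
    then have 2: "(\<lambda>J. - (\<Sum>k\<in>F (n J). c k * (\<integral>x. Defs.D \<phi> x * cis (of_int k * x) \<partial>lam))) \<longlonglongrightarrow> - (\<integral>x. Defs.D \<phi> x * fsum c x \<partial>lam)"
      unfolding F_def by (intro tendsto_minus has_sum_symmetric_limit[OF _ nlim])
    show ?thesis using LIMSEQ_unique[OF 1[unfolded part] 2] by (simp add: mult.commute)
  qed
  \<comment> \<open>Finite Parseval bounds the partial sums by \<open>kin q c\<close>; Fatou passes to the limit.\<close>
  have energy: "(\<integral>\<^sup>+x. ennreal ((cmod (- \<i> * g x + of_real q * fsum c x))\<^sup>2) \<partial>lam) \<le> ennreal (kin q c)" for q
  proof -
    define u where "u j x = ennreal ((cmod (- \<i> * p j x + of_real q * v j x))\<^sup>2)" for j x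
    have cv: "cper (v j)" for j
      using cper_sum[of "F (n j)" c] by (simp add: v_def[abs_def] F_def)
    have [measurable]: "p j \<in> borel_measurable borel" "v j \<in> borel_measurable borel" for j
      using cp cv by (auto intro: cper_measurable)
    have um: "u j \<in> borel_measurable lam" for j
      unfolding u_def measurable_lam by measurable
    have ui: "(\<integral>\<^sup>+x. u j x \<partial>lam) \<le> ennreal (kin q c)" for j
    proof -
      have eq: "- \<i> * p j x + of_real q * v j x = (\<Sum>k\<in>F (n j). ((of_int k + of_real q) * c k) * cis (of_int k * x))" for x
        by (simp add: p_def v_def d_def sum_distrib_left sum.distrib[symmetric] algebra_simps) 
      have "integrable lam (\<lambda>x. (cmod (- \<i> * p j x + of_real q * v j x))\<^sup>2)"
        by (intro cper_integrable finite_measure_lam cper_intros cp cv) simp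
      then have "(\<integral>\<^sup>+x. u j x \<partial>lam) = ennreal (\<integral>x. (cmod (- \<i> * p j x + of_real q * v j x))\<^sup>2 \<partial>lam)"
        unfolding u_def by (rule nn_integral_eq_integral) simp
      also have "(\<integral>x. (cmod (- \<i> * p j x + of_real q * v j x))\<^sup>2 \<partial>lam) = 2 * pi * (\<Sum>k\<in>F (n j). (cmod ((of_int k + of_real q) * c k))\<^sup>2)"
        unfolding eq by (rule parseval_finite) (simp add: F_def)
      also have "\<dots> = 2 * pi * (\<Sum>k\<in>F (n j). (of_int k + q)\<^sup>2 * (cmod (c k))\<^sup>2)"
      proof -
        have "cmod (of_int k + of_real q) = \<bar>of_int k + q\<bar>" for k
          by (metis norm_of_real of_real_add of_real_of_int_eq)
        then show ?thesis by (simp add: norm_mult power_mult_distrib)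
      qed
      also have "\<dots> \<le> kin q c"
        unfolding kin_def by (intro mult_left_mono finite_sum_le_infsum kin_summable c) (auto simp: F_def)
      finally show ?thesis by (simp add: ennreal_leI)
    qed
    have "(\<integral>\<^sup>+x. ennreal ((cmod (- \<i> * g x + of_real q * fsum c x))\<^sup>2) \<partial>lam) = (\<integral>\<^sup>+x. liminf (\<lambda>j. u j x) \<partial>lam)"
    proof (rule nn_integral_cong_AE)
      show "AE x in lam. ennreal ((cmod (- \<i> * g x + of_real q * fsum c x))\<^sup>2) = liminf (\<lambda>j. u j x)"
        using plim
      proof eventually_elim
        case (elim x)
        have "(\<lambda>j. u j x) \<longlonglongrightarrow> ennreal ((cmod (- \<i> * g x + of_real q * fsum c x))\<^sup>2)"
          unfolding u_def by (intro tendsto_intros elim vlim)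
        then show ?case by (intro lim_imp_Liminf[symmetric]) auto
      qed
    qed
    also have "\<dots> \<le> liminf (\<lambda>j. \<integral>\<^sup>+x. u j x \<partial>lam)" using um by (rule nn_integral_liminf)
    also have "\<dots> \<le> ennreal (kin q c)"
      using Liminf_mono[of "\<lambda>j. \<integral>\<^sup>+x. u j x \<partial>lam" "\<lambda>_. ennreal (kin q c)" sequentially] ui
      by (simp add: Liminf_const)
    finally show ?thesis .
  qed
  have mq: "(\<lambda>x. (cmod (- \<i> * g x + of_real q * fsum c x))\<^sup>2) \<in> borel_measurable lam" for q
    unfolding measurable_lam using gm cper_measurable[OF H1seq_cper[OF c]] by measurable
  have int: "integrable lam (\<lambda>x. (cmod (- \<i> * g x + of_real q * fsum c x))\<^sup>2)" for q
    using le_less_trans[OF energy[of q] ennreal_less_top] mq by (intro integrableI_nonneg) auto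
  have "(\<integral>x. (cmod (- \<i> * g x + of_real q * fsum c x))\<^sup>2 \<partial>lam) \<le> kin q c" for q
    using energy[of q] nn_integral_eq_integral[OF int[of q]] kin_nonneg[of q c] by simp
  then show ?thesis using that gm gp weak int by blast
qed

text \<open>
  The derivative in the definition of \<open>momentum\<close> is an arbitrary choice among the weak derivatives.
  It agrees almost everywhere with the one constructed above, because both have the same Fourier
  coefficients. The upper bound for the integral comes from the construction, the lower bound from
  Bessel's inequality.
\<close>

lemma momentum_integral:
  assumes c: "H1seq c"
  shows "(LINT x:cell|lborel. cnj (momentum q (fsum c) x) * momentum q (fsum c) x) = of_real (kin q c)"
proof -
  let ?v = "fsum c"
  obtain g where g: "g \<in> borel_measurable borel" "periodic g" 
    "\<And>\<phi>. \<phi> \<in> test_funs \<Longrightarrow> (\<integral>x. g x * \<phi> x \<partial>lam) = - (\<integral>x. ?v x * Defs.D \<phi> x \<partial>lam)"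
    "\<And>q. integrable lam (\<lambda>x. (cmod (- \<i> * g x + of_real q * ?v x))\<^sup>2)"
    "\<And>q. (\<integral>x. (cmod (- \<i> * g x + of_real q * ?v x))\<^sup>2 \<partial>lam) \<le> kin q c"
    using weak_derivative_exists[OF c] by blast
  have vm: "?v \<in> borel_measurable borel" by (intro cper_measurable H1seq_cper c)
  have dd: "distr_deriv (distr_of_fun ?v) \<phi> = - (\<integral>x. ?v x * Defs.D \<phi> x \<partial>lam)" if "\<phi> \<in> test_funs" for \<phi>
    using that by (simp add: distr_deriv_def distr_of_fun_apply[OF vm] test_fun_D)
  have sq: "integrable lam (\<lambda>x. (cmod (g x))\<^sup>2)" using g(4)[of 0] by (simp add: norm_mult)
  have "g \<in> L2_funs"
  proof -
    have "(\<lambda>x. (cmod (g x))\<^sup>2) \<in> borel_measurable borel" using g(1) by measurable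
    then have "set_integrable lborel cell (\<lambda>x. (cmod (g x))\<^sup>2)"
      using sq by (rule iffD2[OF set_integrable_cell_measure[OF sets_lborel]])
    then show ?thesis using g(1,2) by (simp only: L2_funs_def mem_Collect_eq simp_thms)
  qed
  moreover have "distr_of_fun g = distr_deriv (distr_of_fun ?v)"
  proof
    fix \<phi> show "distr_of_fun g \<phi> = distr_deriv (distr_of_fun ?v) \<phi>"
      using g(3) dd distr_of_fun_apply[OF g(1)] 
      by (cases "\<phi> \<in> test_funs") (auto simp: distr_of_fun_def distr_deriv_def)
  qed
  ultimately have ex: "\<exists>g. g \<in> L2_funs \<and> distr_of_fun g = distr_deriv (distr_of_fun ?v)" by blast
  from someI_ex[OF ex]
  have w: "weak_deriv ?v \<in> L2_funs" "distr_of_fun (weak_deriv ?v) = distr_deriv (distr_of_fun ?v)"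
    unfolding weak_deriv_def by blast+
  define w where "w = weak_deriv ?v"
  have wm: "w \<in> borel_measurable borel" and ws: "set_integrable lborel cell (\<lambda>x. (cmod (w x))\<^sup>2)"
    using w(1) by (simp_all only: L2_funs_def w_def mem_Collect_eq)
  have "(\<lambda>x. (cmod (w x))\<^sup>2) \<in> borel_measurable borel" using wm by measurable
  then have wsq: "integrable lam (\<lambda>x. (cmod (w x))\<^sup>2)"
    using ws by (rule iffD1[OF set_integrable_cell_measure[OF sets_lborel]])
  have wi: "integrable lam w" by (rule lam_integrable_of_square[OF wm wsq])
  have gi: "integrable lam g" by (rule lam_integrable_of_square[OF g(1) sq])
  have "AE x in lam. w x - g x = 0"
  proof (rule zero_coefficients_AE_zero)
    show "(\<lambda>x. w x - g x) \<in> borel_measurable borel" using wm g(1) by measurable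
    show "integrable lam (\<lambda>x. w x - g x)" using wi gi by simp
    fix k
    have t: "(\<lambda>x. 1 * cis (of_int k * x)) \<in> test_funs" by (rule test_fun_cis)
    have "(\<integral>x. w x * (1 * cis (of_int k * x)) \<partial>lam) = (\<integral>x. g x * (1 * cis (of_int k * x)) \<partial>lam)"
      using g(3)[OF t] dd[OF t] distr_of_fun_apply[OF wm t] w(2) by (simp add: w_def)
    then show "(\<integral>x. (w x - g x) * cis (of_int k * x) \<partial>lam) = 0"
      using lam_integrable_mult_cis[OF wm wi] lam_integrable_mult_cis[OF g(1) gi] by (simp add: left_diff_distrib)
  qed
  then have wg: "AE x in lam. w x = g x" by eventually_elim simp
  let ?m = "\<lambda>x. - \<i> * w x + of_real q * ?v x"
  have mm: "?m \<in> borel_measurable borel" using wm vm by measurable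
  have mg: "(\<lambda>x. - \<i> * g x + of_real q * ?v x) \<in> borel_measurable borel" using g(1) vm by measurable
  have eqI: "(\<integral>x. (cmod (?m x))\<^sup>2 \<partial>lam) = (\<integral>x. (cmod (- \<i> * g x + of_real q * ?v x))\<^sup>2 \<partial>lam)"
    using wg mm mg by (intro integral_cong_AE) (auto elim!: eventually_mono)
  have "integrable lam (\<lambda>x. (cmod (?m x))\<^sup>2) = integrable lam (\<lambda>x. (cmod (- \<i> * g x + of_real q * ?v x))\<^sup>2)"
    using wg mm mg by (intro integrable_cong_AE) (auto elim!: eventually_mono)
  then have mi: "integrable lam (\<lambda>x. (cmod (?m x))\<^sup>2)" using g(4) by simp
  have fcm: "fc ?m k = (of_int k + of_real q) * c k" for k
  proof -
    have t: "(\<lambda>x. 1 * cis (of_int (-k) * x)) \<in> test_funs" by (rule test_fun_cis)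
    have "(\<integral>x. w x * (1 * cis (of_int (-k) * x)) \<partial>lam) = - (\<integral>x. ?v x * ((\<i> * of_int (-k) * 1) * cis (of_int (-k) * x)) \<partial>lam)"
      using dd[OF t] distr_of_fun_apply[OF wm t] w(2) unfolding w_def D_cis by simp
    also have "\<dots> = - (\<integral>x. (- \<i> * of_int k) * (?v x * cis (- (of_int k * x))) \<partial>lam)"
      by (simp add: mult_ac)
    also have "\<dots> = \<i> * of_int k * (\<integral>x. ?v x * cis (- (of_int k * x)) \<partial>lam)"
      by (simp only: integral_mult_right_zero) simp
    finally have "(\<integral>x. w x * cis (- (of_int k * x)) \<partial>lam) = \<i> * of_int k * (\<integral>x. ?v x * cis (- (of_int k * x)) \<partial>lam)"
      by simp
    then have "fc w k = \<i> * of_int k * fc ?v k" by (simp add: fc_def)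
    moreover have "fc ?m k = - \<i> * fc w k + of_real q * fc ?v k"
    proof -
      have i: "integrable lam (\<lambda>x. w x * cis (- (of_int k * x)))" "integrable lam (\<lambda>x. ?v x * cis (- (of_int k * x)))"
        using lam_integrable_mult_cis[OF wm wi, of "-k"] lam_integrable_mult_cis[OF vm cper_integrable[OF finite_measure_lam lam_sets_borel H1seq_cper[OF c]], of "-k"] by auto
      have eq: "?m x * cis (- (of_int k * x)) = - \<i> * (w x * cis (- (of_int k * x))) + of_real q * (?v x * cis (- (of_int k * x)))" for x
        by (simp only: distrib_right mult.assoc)
      have "(\<integral>x. ?m x * cis (- (of_int k * x)) \<partial>lam) = - \<i> * (\<integral>x. w x * cis (- (of_int k * x)) \<partial>lam) + of_real q * (\<integral>x. ?v x * cis (- (of_int k * x)) \<partial>lam)"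
        unfolding eq Bochner_Integration.integral_add[OF integrable_mult_right[OF i(1)] integrable_mult_right[OF i(2)]] integral_mult_right_zero ..
      then show ?thesis by (simp only: fc_def add_divide_distrib times_divide_eq_right)
    qed
    moreover have "fc ?v k = c k" by (simp add: H1seq_fc_fsum[OF c])
    ultimately show ?thesis by (simp add: algebra_simps)
  qed
  have absk: "cmod (of_int k + of_real q) = \<bar>of_int k + q\<bar>" for k
    by (metis norm_of_real of_real_add of_real_of_int_eq)
  have "kin q c \<le> (\<integral>x. (cmod (?m x))\<^sup>2 \<partial>lam)"
  proof -
    have "(\<Sum>\<^sub>\<infinity>k. (of_int k + q)\<^sup>2 * (cmod (c k))\<^sup>2) \<le> (\<integral>x. (cmod (?m x))\<^sup>2 \<partial>lam) / (2 * pi)"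
    proof (rule infsum_le_finite_sums[OF kin_summable[OF c]])
      fix F :: "int set" assume F: "finite F"
      have "2 * pi * (\<Sum>k\<in>F. (cmod (fc ?m k))\<^sup>2) \<le> (\<integral>x. (cmod (?m x))\<^sup>2 \<partial>lam)"
        by (rule bessel_inequality[OF mm mi F])
      then show "(\<Sum>k\<in>F. (of_int k + q)\<^sup>2 * (cmod (c k))\<^sup>2) \<le> (\<integral>x. (cmod (?m x))\<^sup>2 \<partial>lam) / (2 * pi)"
        unfolding fcm norm_mult absk power_mult_distrib power2_abs by (simp add: le_divide_eq mult.commute)
    qed
    then show ?thesis by (simp add: kin_def le_divide_eq mult.commute)
  qed
  with g(5)[of q] eqI have I: "(\<integral>x. (cmod (?m x))\<^sup>2 \<partial>lam) = kin q c" by simp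
  have sqm: "cnj (momentum q ?v x) * momentum q ?v x = complex_of_real ((cmod (?m x))\<^sup>2)" for x
    by (simp only: complex_norm_square momentum_def w_def mult.commute)
  have "(\<lambda>x. complex_of_real ((cmod (?m x))\<^sup>2)) \<in> borel_measurable borel" using mm by measurable
  then have "(LINT x:cell|lborel. cnj (momentum q ?v x) * momentum q ?v x) = (\<integral>x. complex_of_real ((cmod (?m x))\<^sup>2) \<partial>lam)"
    unfolding sqm by (rule set_integral_cell_measure[OF sets_lborel])
  also have "\<dots> = of_real (kin q c)" unfolding integral_complex_of_real I ..
  finally show ?thesis .
qed

section \<open>The first band as a ground energy\<close>

text \<open>
  The quadratic form of the potential \<open>V_\<mu>\<close>, without the constant \<open>- B\<close>, which only shifts it by
  \<open>B * nsq c\<close>.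
\<close>

definition energy :: "real measure \<Rightarrow> real \<Rightarrow> (int \<Rightarrow> complex) \<Rightarrow> real"
  where "energy \<mu> q c = kin q c + (\<integral>x. (cmod (fsum c x))\<^sup>2 \<partial>\<mu>)"

text \<open>
  The infimum is attained, see \<open>ground_energy_attained\<close>.
\<close>

definition ground_energy :: "real measure \<Rightarrow> real \<Rightarrow> real"
  where "ground_energy \<mu> q = Inf {energy \<mu> q c | c. H1seq c \<and> nsq c = 1}"

lemma fourier_coeff_const:
  "fourier_coeff (distr_of_fun (\<lambda>x. of_real B)) k = (if k = 0 then of_real (sqrt (2 * pi) * B) else 0)"
proof -
  have I: "(\<integral>x. cis (- (of_int k * x)) \<partial>lam) = (if k = 0 then 2 * of_real pi else 0)"
    using integral_cis[of "-k"] by simp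
  have m: "(\<lambda>x. complex_of_real B) \<in> borel_measurable borel" by simp
  show ?thesis
    unfolding fourier_coeff_distr_of_fun[OF m] fc_def integral_mult_right_zero I by simp
qed

lemma fourier_coeff_distr_diff: "fourier_coeff (distr_diff S T) k = fourier_coeff S k - fourier_coeff T k"
  unfolding fourier_coeff_def distr_diff_def using fourier_basis_test_fun by simp

lemma H1seq_reflect: "H1seq c \<Longrightarrow> H1seq (\<lambda>k. c (- k))"
  unfolding H1seq_def
  by (subst summable_on_reindex_bij_witness[where i = uminus and j = uminus and T = UNIV and h = "\<lambda>k. (1 + (real_of_int k)\<^sup>2) * (cmod (c k))\<^sup>2"]) auto

lemma pairing_fsum:
  assumes "H1seq c"
  shows "pairing V (fsum c) = (\<Sum>\<^sub>\<infinity>k. fourier_coeff V k * (of_real (sqrt (2 * pi)) * c (- k)))"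
  using cper_measurable[OF H1seq_cper[OF assms]]
  by (simp add: pairing_def fourier_coeff_distr_of_fun H1seq_fc_fsum[OF assms])

text \<open>
  Only the coefficient of index \<open>0\<close> feels a constant; the series of \<open>W\<close> has to be shown summable, by
  Young's inequality with the weights of orders \<open>-1\<close> and \<open>1\<close>, before it may be split off.
\<close>

lemma pairing_shift_constant:
  assumes W: "W \<in> sobolev_per (-1)" and c: "H1seq c"
  shows "pairing (distr_diff W (distr_of_fun (\<lambda>x. of_real B))) (fsum c) = pairing W (fsum c) - of_real B * (2 * of_real pi * c 0)"
proof -
  let ?r = "complex_of_real (sqrt (2 * pi))"
  have "(\<lambda>k. fourier_coeff W k * (?r * c (- k))) summable_on UNIV"
  proof (rule abs_summable_summable, rule summable_on_comparison_test)
    have "(\<lambda>k. (1 + \<bar>real_of_int k\<bar>\<^sup>2) powr - 1 * (cmod (fourier_coeff W k))\<^sup>2) summable_on UNIV"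
      using W by (simp add: sobolev_per_def)
    moreover have "(\<lambda>k. (2 * pi) * ((1 + (real_of_int k)\<^sup>2) * (cmod (c (- k)))\<^sup>2)) summable_on UNIV"
      using H1seq_reflect[OF c] unfolding H1seq_def by (rule summable_on_cmult_right)
    ultimately show "(\<lambda>k. (1 + \<bar>real_of_int k\<bar>\<^sup>2) powr - 1 * (cmod (fourier_coeff W k))\<^sup>2 + (2 * pi) * ((1 + (real_of_int k)\<^sup>2) * (cmod (c (- k)))\<^sup>2)) summable_on UNIV"
      by (rule summable_on_add)
    fix k
    define w where "w = 1 + (real_of_int k)\<^sup>2"
    have w: "w > 0" by (simp add: w_def add_pos_nonneg)
    define a where "a = cmod (fourier_coeff W k)"
    define b where "b = cmod (?r * c (- k))"
    have ab: "a \<ge> 0" "b \<ge> 0" by (simp_all add: a_def b_def)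
    have "a * b = (a / sqrt w) * (sqrt w * b)" using w by simp
    also have "\<dots> \<le> (a / sqrt w)\<^sup>2 + (sqrt w * b)\<^sup>2"
    proof -
      have "2 * ((a / sqrt w) * (sqrt w * b)) \<le> (a / sqrt w)\<^sup>2 + (sqrt w * b)\<^sup>2"
        using sum_squares_bound[of "a / sqrt w" "sqrt w * b"] by (simp only: mult.assoc)
      moreover have "0 \<le> (a / sqrt w) * (sqrt w * b)" using ab w by simp
      moreover have "t \<le> s" if "2 * t \<le> s" "0 \<le> t" for s t :: real using that by linarith
      ultimately show ?thesis by blast
    qed
    also have "\<dots> = w powr - 1 * a\<^sup>2 + w * b\<^sup>2"
      using w by (simp add: power_divide power_mult_distrib powr_minus divide_inverse mult.commute power_inverse)
    also have "b\<^sup>2 = (2 * pi) * (cmod (c (- k)))\<^sup>2" by (simp add: b_def norm_mult power_mult_distrib)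
    finally show "norm (fourier_coeff W k * (?r * c (- k))) \<le> (1 + \<bar>real_of_int k\<bar>\<^sup>2) powr - 1 * (cmod (fourier_coeff W k))\<^sup>2 + (2 * pi) * ((1 + (real_of_int k)\<^sup>2) * (cmod (c (- k)))\<^sup>2)"
      unfolding norm_mult[of "fourier_coeff W k"] a_def b_def w_def by (simp add: mult_ac)
  qed auto
  then have 1: "((\<lambda>k. fourier_coeff W k * (?r * c (- k))) has_sum pairing W (fsum c)) UNIV"
    unfolding pairing_fsum[OF c] by (rule has_sum_infsum)
  have rr: "?r * ?r = 2 * of_real pi" by (simp only: of_real_mult[symmetric] real_sqrt_mult_self) simp
  have 2: "((\<lambda>k. fourier_coeff (distr_of_fun (\<lambda>x. of_real B)) k * (?r * c (- k))) has_sum of_real B * (2 * of_real pi * c 0)) UNIV"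
  proof (rule has_sum_finite_neutralI[where B = "{0}"])
    show "of_real B * (2 * of_real pi * c 0) = (\<Sum>k\<in>{0}. fourier_coeff (distr_of_fun (\<lambda>x. of_real B)) k * (?r * c (- k)))"
      unfolding rr[symmetric] by (simp add: fourier_coeff_const mult_ac)
  qed (auto simp: fourier_coeff_const)
  show ?thesis
    unfolding pairing_fsum[OF c] fourier_coeff_distr_diff left_diff_distrib
    using infsumI[OF has_sum_minus[OF 1 2]] by (simp add: pairing_fsum[OF c])
qed

lemma bloch_form_energy:
  assumes \<nu>: "sets \<nu> = sets borel" and W: "is_potential_of \<nu> W" and c: "H1seq c"
  shows "Re (bloch_form (distr_diff W (distr_of_fun (\<lambda>x. of_real B))) q (fsum c) (fsum c))
       = energy (cell_measure \<nu>) q c - B * nsq c"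
proof -
  let ?v = "fsum c" let ?p = "\<lambda>x. cnj (fsum c x) * fsum c x"
  have W': "W \<in> sobolev_per (-1)" "\<And>\<phi>. \<phi> \<in> H1_per \<Longrightarrow> pairing W \<phi> = (LINT x:cell|\<nu>. \<phi> x)"
    using W by (auto simp: is_potential_of_def sobolev_per_real_def)
  have cp: "cper ?p" using H1seq_cper[OF c] by (intro cper_intros)
  have H: "H1seq (fc ?p)" by (rule H1seq_norm_square[OF c])
  have pe: "?p = fsum (fc ?p)" by (rule H1seq_expansion[OF cp H])
  have p_eq: "?p x = complex_of_real ((cmod (?v x))\<^sup>2)" for x by (simp only: complex_norm_square mult.commute)
  have "2 * of_real pi * fc ?p 0 = (\<integral>x. ?p x \<partial>lam)" by (simp add: fc_def)
  also have "\<dots> = of_real (nsq c)" unfolding p_eq integral_complex_of_real nsq_integral[OF c] ..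
  finally have n: "2 * of_real pi * fc ?p 0 = of_real (nsq c)" .
  have "pairing (distr_diff W (distr_of_fun (\<lambda>x. of_real B))) ?p = pairing W ?p - of_real B * (2 * of_real pi * fc ?p 0)"
    using pairing_shift_constant[OF W'(1) H, of B] unfolding pe[symmetric] .
  also have "pairing W ?p = (LINT x:cell|\<nu>. ?p x)"
    using H cp by (intro W'(2)) (simp add: H1_per_iff)
  also have "\<dots> = (\<integral>x. ?p x \<partial>cell_measure \<nu>)"
    by (rule set_integral_cell_measure[OF \<nu> cper_measurable[OF cp]])
  also have "\<dots> = of_real (\<integral>x. (cmod (?v x))\<^sup>2 \<partial>cell_measure \<nu>)"
    unfolding p_eq integral_complex_of_real ..
  finally show ?thesis
    unfolding bloch_form_def momentum_integral[OF c] n by (simp add: energy_def)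
qed

lemma L2_norm_fsum:
  assumes "H1seq c"
  shows "L2_norm_per (fsum c) = 1 \<longleftrightarrow> nsq c = 1"
proof -
  have "(LINT x:cell|lborel. (cmod (fsum c x))\<^sup>2) = nsq c"
    unfolding nsq_integral[OF assms]
    by (rule set_integral_cell_measure) (auto intro!: cper_measurable cper_intros H1seq_cper assms)
  then show ?thesis by (simp add: L2_norm_per_def)
qed

text \<open>
  The first band is defined by \<open>LEAST\<close>, which means nothing unless a minimiser is known; hence the
  minimiser \<open>c\<close> among the hypotheses.
\<close>

lemma first_band_eq_ground_energy:
  assumes \<nu>: "sets \<nu> = sets borel" and W: "is_potential_of \<nu> W"
    and c: "H1seq c" "nsq c = 1" and min: "\<And>d. H1seq d \<Longrightarrow> nsq d = 1 \<Longrightarrow> energy (cell_measure \<nu>) q c \<le> energy (cell_measure \<nu>) q d"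
  shows "first_band (distr_diff W (distr_of_fun (\<lambda>x. of_real B))) q = ground_energy (cell_measure \<nu>) q - B"
proof -
  have "ground_energy (cell_measure \<nu>) q = energy (cell_measure \<nu>) q c"
    unfolding ground_energy_def using c min by (intro cInf_eq_minimum) auto
  moreover have "first_band (distr_diff W (distr_of_fun (\<lambda>x. of_real B))) q = energy (cell_measure \<nu>) q c - B"
    unfolding first_band_def
  proof (rule Least_equality)
    show "energy (cell_measure \<nu>) q c - B \<in> {Re (bloch_form (distr_diff W (distr_of_fun (\<lambda>x. of_real B))) q v v) | v. v \<in> H1_per \<and> L2_norm_per v = 1}"
      using bloch_form_energy[OF \<nu> W c(1), of B q] c H1_per_fsum[OF c(1)] L2_norm_fsum[OF c(1)] by force
  next
    fix e assume "e \<in> {Re (bloch_form (distr_diff W (distr_of_fun (\<lambda>x. of_real B))) q v v) | v. v \<in> H1_per \<and> L2_norm_per v = 1}"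
    then obtain v where v: "v \<in> H1_per" "L2_norm_per v = 1" and e: "e = Re (bloch_form (distr_diff W (distr_of_fun (\<lambda>x. of_real B))) q v v)" by blast
    obtain d where d: "H1seq d" "v = fsum d" using H1_perE[OF v(1)] by blast
    then have "nsq d = 1" using v(2) L2_norm_fsum by simp
    then show "energy (cell_measure \<nu>) q c - B \<le> e"
      using min[OF d(1)] bloch_form_energy[OF \<nu> W d(1), of B q] e d(2) by simp
  qed
  ultimately show ?thesis by simp
qed

lemma distributions_diff:
  assumes S: "S \<in> distributions" and T: "T \<in> distributions"
  shows "distr_diff S T \<in> distributions"
proof -
  have tf: "(Defs.D ^^ n) \<phi> \<in> test_funs" if "\<phi> \<in> test_funs" for \<phi> n
    using that by (induction n) (auto intro: test_fun_D)
  have pos: "0 \<le> (SUP x. cmod ((Defs.D ^^ n) \<phi> x))" if t: "\<phi> \<in> test_funs" for \<phi> n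
  proof -
    obtain B where "\<And>x. cmod ((Defs.D ^^ n) \<phi> x) \<le> B" using cper_bounded[OF test_fun_cper[OF tf[OF t]]] by blast
    then have "cmod ((Defs.D ^^ n) \<phi> 0) \<le> (SUP x. cmod ((Defs.D ^^ n) \<phi> x))"
      by (intro cSUP_upper bdd_aboveI2) auto
    then show ?thesis using norm_ge_zero order_trans by blast
  qed
  obtain C N where C: "\<And>\<phi>. \<phi> \<in> test_funs \<Longrightarrow> cmod (S \<phi>) \<le> C * (\<Sum>n\<le>N. SUP x. cmod ((Defs.D ^^ n) \<phi> x))"
    using S unfolding distributions_def by blast
  obtain C' N' where C': "\<And>\<phi>. \<phi> \<in> test_funs \<Longrightarrow> cmod (T \<phi>) \<le> C' * (\<Sum>n\<le>N'. SUP x. cmod ((Defs.D ^^ n) \<phi> x))"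
    using T unfolding distributions_def by blast
  have "cmod (distr_diff S T \<phi>) \<le> (\<bar>C\<bar> + \<bar>C'\<bar>) * (\<Sum>n\<le>max N N'. SUP x. cmod ((Defs.D ^^ n) \<phi> x))" if t: "\<phi> \<in> test_funs" for \<phi>
  proof -
    have mono: "(\<Sum>n\<le>M. SUP x. cmod ((Defs.D ^^ n) \<phi> x)) \<le> (\<Sum>n\<le>max N N'. SUP x. cmod ((Defs.D ^^ n) \<phi> x))" if "M \<le> max N N'" for M
      using that by (intro sum_mono2) (auto simp: pos[OF t])
    have bd: "K * (\<Sum>n\<le>M. SUP x. cmod ((Defs.D ^^ n) \<phi> x)) \<le> \<bar>K\<bar> * (\<Sum>n\<le>max N N'. SUP x. cmod ((Defs.D ^^ n) \<phi> x))" if "M \<le> max N N'" for K M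
      by (rule mult_mono[OF abs_ge_self mono[OF that]]) (auto intro!: sum_nonneg pos[OF t])
    have "cmod (S \<phi> - T \<phi>) \<le> cmod (S \<phi>) + cmod (T \<phi>)" by (rule norm_triangle_ineq4)
    also have "\<dots> \<le> \<bar>C\<bar> * (\<Sum>n\<le>max N N'. SUP x. cmod ((Defs.D ^^ n) \<phi> x)) + \<bar>C'\<bar> * (\<Sum>n\<le>max N N'. SUP x. cmod ((Defs.D ^^ n) \<phi> x))"
      using C[OF t] C'[OF t] bd[of N C] bd[of N' C'] by fastforce
    finally show ?thesis using t by (simp add: distr_diff_def distrib_right)
  qed
  moreover have add: "(\<lambda>x. \<phi> x + \<psi> x) \<in> test_funs" if "\<phi> \<in> test_funs" "\<psi> \<in> test_funs" for \<phi> \<psi>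
    by (rule test_fun_add[OF that])
  moreover have cm: "(\<lambda>x. a * \<phi> x) \<in> test_funs" if "\<phi> \<in> test_funs" for \<phi> a
    by (rule test_fun_cmult[OF that])
  moreover have "distr_diff S T (\<lambda>x. \<phi> x + \<psi> x) = distr_diff S T \<phi> + distr_diff S T \<psi>" if "\<phi> \<in> test_funs" "\<psi> \<in> test_funs" for \<phi> \<psi>
    using S T that add[OF that] by (simp add: distributions_def distr_diff_def)
  moreover have "distr_diff S T (\<lambda>x. a * \<phi> x) = a * distr_diff S T \<phi>" if "\<phi> \<in> test_funs" for \<phi> a
    using S T that cm[OF that, of a] by (simp add: distributions_def distr_diff_def right_diff_distrib)
  moreover have "distr_diff S T \<in> extensional test_funs" by (simp add: distr_diff_def)
  ultimately show ?thesis unfolding distributions_def by blast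
qed

text \<open>
  A measure has bounded Fourier coefficients, and \<open>1 / (1 + k\<^sup>2)\<close> is summable.
\<close>

lemma sobolev_negative_of_bounded:
  assumes T: "T \<in> distributions" and K: "\<And>k. cmod (fourier_coeff T k) \<le> K"
  shows "T \<in> sobolev_per (-1)"
  unfolding sobolev_per_def
proof (intro CollectI conjI T, rule summable_on_comparison_test)
  show "(\<lambda>k. K\<^sup>2 * (1 / (1 + (real_of_int k)\<^sup>2))) summable_on UNIV"
    by (intro summable_on_cmult_right inverse_weight_summable)
  fix k :: int
  have "(1 + \<bar>real_of_int k\<bar>\<^sup>2) powr - 1 = 1 / (1 + (real_of_int k)\<^sup>2)"
    by (simp add: powr_minus add_pos_nonneg divide_inverse)
  moreover have "(cmod (fourier_coeff T k))\<^sup>2 \<le> K\<^sup>2" by (intro power_mono K) simp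
  ultimately show "(1 + \<bar>real_of_int k\<bar>\<^sup>2) powr - 1 * (cmod (fourier_coeff T k))\<^sup>2 \<le> K\<^sup>2 * (1 / (1 + (real_of_int k)\<^sup>2))"
    by (simp add: divide_right_mono)
qed auto

text \<open>
  The distribution \<open>\<phi> \<mapsto> \<integral> \<phi> d\<nu>\<close> over the cell has the coefficients of a measure. The pairing
  formula extends from exponentials to \<open>H\<^sup>1\<close> because the Fourier series converges absolutely.
\<close>

lemma potential_of_measure:
  assumes \<nu>: "\<nu> \<in> periodic_measures"
  obtains W where "is_potential_of \<nu> W" "\<And>B. distr_diff W (distr_of_fun (\<lambda>x. of_real B)) \<in> potentials B"
proof -
  define \<mu> where "\<mu> = cell_measure \<nu>"
  have s: "sets \<nu> = sets borel" and fin: "emeasure \<nu> cell < \<infinity>" using \<nu> by (auto simp: periodic_measures_def)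
  have s\<mu>: "sets \<mu> = sets borel" using s by (simp add: \<mu>_def)
  have sp: "space \<mu> = UNIV" using s\<mu> by (metis sets_eq_imp_space_eq space_borel)
  have fm: "finite_measure \<mu>"
    using fin emeasure_cell_measure[OF s, of UNIV] sp by (intro finite_measureI) (simp add: \<mu>_def)
  interpret finite_measure \<mu> by fact
  define W :: distr where "W = (\<lambda>\<phi>\<in>test_funs. \<integral>x. 1 * \<phi> x \<partial>\<mu>)"
  have WD: "W \<in> distributions" unfolding W_def using fm s\<mu> by (intro distribution_of_integral) auto
  let ?r = "complex_of_real (sqrt (2 * pi))"
  have Wk: "fourier_coeff W k = (1 / ?r) * (\<integral>x. cis (of_int (- k) * x) \<partial>\<mu>)" for k
    unfolding fourier_coeff_def fourier_basis_eq W_def using test_fun_cis[of "1 / ?r" "- k"]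
    by (simp del: of_int_minus)
  have cb: "cmod (\<integral>x. cis (of_int k * x) \<partial>\<mu>) \<le> measure \<mu> UNIV" for k
  proof -
    have "cmod (\<integral>x. cis (of_int k * x) \<partial>\<mu>) \<le> (\<integral>x. cmod (cis (of_int k * x)) \<partial>\<mu>)" by (rule integral_norm_bound)
    then show ?thesis using sp by simp
  qed
  have WK: "cmod (fourier_coeff W k) \<le> measure \<mu> UNIV / sqrt (2 * pi)" for k
    unfolding Wk using cb[of "- k"] by (simp add: norm_mult norm_divide divide_right_mono)
  have Wr: "fourier_coeff W (- k) = cnj (fourier_coeff W k)" for k
  proof -
    have "cnj (\<integral>x. cis (of_int (- k) * x) \<partial>\<mu>) = (\<integral>x. cnj (cis (of_int (- k) * x)) \<partial>\<mu>)"
      by (rule Bochner_Integration.integral_cnj[symmetric])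
    then show ?thesis unfolding Wk by (simp add: cis_cnj)
  qed
  have Wreal: "W \<in> sobolev_per_real (-1)"
    unfolding sobolev_per_real_def using sobolev_negative_of_bounded[OF WD WK] Wr by blast
  have pot: "is_potential_of \<nu> W"
    unfolding is_potential_of_def
  proof (intro conjI Wreal ballI)
    fix \<phi> assume "\<phi> \<in> H1_per"
    then obtain c where c: "H1seq c" "\<phi> = fsum c" by (rule H1_perE)
    have "((\<lambda>k. c k * (\<integral>x. 1 * cis (of_int k * x) \<partial>\<mu>)) has_sum (\<integral>x. 1 * fsum c x \<partial>\<mu>)) UNIV"
      by (rule fsum_integral[OF H1seq_summable[OF c(1)] fm s\<mu>, where B = 1]) auto
    then have hs: "((\<lambda>k. c (- k) * (\<integral>x. cis (of_int (- k) * x) \<partial>\<mu>)) has_sum (\<integral>x. fsum c x \<partial>\<mu>)) UNIV"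
      by (subst has_sum_reindex_bij_witness[where i = uminus and j = uminus and T = UNIV and h = "\<lambda>k. c k * (\<integral>x. cis (of_int k * x) \<partial>\<mu>)"]) auto
    have eq: "fourier_coeff W k * (?r * c (- k)) = c (- k) * (\<integral>x. cis (of_int (- k) * x) \<partial>\<mu>)" for k
      unfolding Wk by simp
    have "pairing W (fsum c) = (\<integral>x. fsum c x \<partial>\<mu>)"
      unfolding pairing_fsum[OF c(1)] eq by (rule infsumI[OF hs])
    also have "\<dots> = (LINT x:cell|\<nu>. fsum c x)"
      unfolding \<mu>_def by (rule set_integral_cell_measure[OF s cper_measurable[OF H1seq_cper[OF c(1)]], symmetric])
    finally show "pairing W \<phi> = (LINT x:cell|\<nu>. \<phi> x)" using c(2) by simp
  qed
  have "distr_diff W (distr_of_fun (\<lambda>x. of_real B)) \<in> potentials B" for B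
  proof -
    let ?V = "distr_diff W (distr_of_fun (\<lambda>x. of_real B))"
    have "distr_of_fun (\<lambda>x. complex_of_real B) \<in> distributions"
      by (subst distr_of_fun_eq, simp, rule distribution_of_integral) (auto intro: cper_integrable finite_measure_lam)
    then have VD: "?V \<in> distributions" by (rule distributions_diff[OF WD])
    have "cmod (fourier_coeff ?V k) \<le> measure \<mu> UNIV / sqrt (2 * pi) + sqrt (2 * pi) * \<bar>B\<bar>" for k
    proof -
      have "cmod (fourier_coeff ?V k) \<le> cmod (fourier_coeff W k) + cmod (fourier_coeff (distr_of_fun (\<lambda>x. of_real B)) k)"
        unfolding fourier_coeff_distr_diff by (rule norm_triangle_ineq4)
      also have "cmod (fourier_coeff (distr_of_fun (\<lambda>x. of_real B)) k) \<le> sqrt (2 * pi) * \<bar>B\<bar>"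
        by (simp add: fourier_coeff_const norm_mult)
      finally show ?thesis using WK[of k] by linarith
    qed
    from sobolev_negative_of_bounded[OF VD this] have "?V \<in> sobolev_per (-1)" .
    moreover have "fourier_coeff ?V (- k) = cnj (fourier_coeff ?V k)" for k
      unfolding fourier_coeff_distr_diff Wr by (simp add: fourier_coeff_const)
    ultimately have "?V \<in> sobolev_per_real (-1)" by (simp add: sobolev_per_real_def)
    then show ?thesis using \<nu> pot unfolding potentials_def by blast
  qed
  then show ?thesis using that pot by blast
qed

section \<open>Periodic measures from finite measures\<close>

lemma emeasure_exhaust:
  assumes s: "sets \<nu> = sets borel" and S: "S \<in> sets borel"
  shows "emeasure \<nu> S = (SUP n. emeasure \<nu> (S \<inter> {- real n<..<real n}))"
proof -
  have "(SUP n. emeasure \<nu> (S \<inter> {- real n<..<real n})) = emeasure \<nu> (\<Union>n. S \<inter> {- real n<..<real n})"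
  proof (rule SUP_emeasure_incseq)
    show "range (\<lambda>n. S \<inter> {- real n<..<real n}) \<subseteq> sets \<nu>" unfolding s using S by (auto intro!: sets.Int)
    show "incseq (\<lambda>n. S \<inter> {- real n<..<real n})" by (rule incseq_SucI) auto
  qed
  also have "(\<Union>n. S \<inter> {- real n<..<real n}) = S"
  proof -
    have "\<exists>n. - real n < x \<and> x < real n" for x
    proof -
      obtain n where "\<bar>x\<bar> < real n" using reals_Archimedean2 by blast
      then show ?thesis by (intro exI[of _ n]) auto
    qed
    then show ?thesis by auto
  qed
  finally show ?thesis ..
qed

text \<open>
  Finite measures are regular; this applies to \<open>\<nu>\<close> restricted to each \<open>{- n<..<n}\<close>. Compact sets exhaust
  from inside directly; for the outer part, the open sets found for the pieces are united, with errors
  \<open>e / 2 ^ (n + 1)\<close>.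
\<close>

lemma locally_finite_imp_regular:
  assumes s: "sets \<nu> = sets borel" and fin: "\<And>n. emeasure \<nu> {- real n<..<real n} < \<infinity>"
  shows "regular_measure \<nu>"
  unfolding regular_measure_def
proof (intro ballI conjI)
  fix S :: "real set" assume S: "S \<in> sets borel"
  have [measurable_cong]: "sets \<nu> = sets borel" by fact
  have [measurable]: "S \<in> sets borel" by fact
  define I where "I n = {- real n<..<real n}" for n
  define N where "N n = density \<nu> (indicator (I n))" for n
  have [measurable]: "I n \<in> sets borel" for n by (simp add: I_def)
  have eN: "emeasure (N n) A = emeasure \<nu> (A \<inter> I n)" if [measurable]: "A \<in> sets borel" for n A
    unfolding N_def by (subst emeasure_density) (auto simp: indicator_inter_arith[symmetric] Int_commute s)
  have sN: "sets (N n) = sets borel" for n by (simp add: N_def s)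
  have spN: "space (N n) = UNIV" for n using sN[of n] by (metis sets_eq_imp_space_eq space_borel)
  have fN: "emeasure (N n) (space (N n)) \<noteq> \<infinity>" for n
    using fin[of n] eN[of UNIV n] by (simp add: spN I_def less_top)
  show "emeasure \<nu> S = (SUP K\<in>{K. K \<subseteq> S \<and> compact K}. emeasure \<nu> K)"
  proof (rule antisym)
    have "emeasure \<nu> (S \<inter> I n) \<le> (SUP K\<in>{K. K \<subseteq> S \<and> compact K}. emeasure \<nu> K)" for n
    proof -
      have "emeasure \<nu> (S \<inter> I n) = (SUP K\<in>{K. K \<subseteq> S \<and> compact K}. emeasure (N n) K)"
        using inner_regular[OF sN fN S] eN[OF S] by simp
      also have "\<dots> \<le> (SUP K\<in>{K. K \<subseteq> S \<and> compact K}. emeasure \<nu> K)"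
      proof (rule SUP_mono')
        fix K :: "real set" show "emeasure (N n) K \<le> emeasure \<nu> K"
        proof (cases "K \<in> sets borel")
          case True
          then show ?thesis using eN[OF True, of n] s by (auto intro!: emeasure_mono)
        next
          case False
          then show ?thesis using sN[of n] by (simp add: emeasure_notin_sets)
        qed
      qed
      finally show ?thesis .
    qed
    then show "emeasure \<nu> S \<le> (SUP K\<in>{K. K \<subseteq> S \<and> compact K}. emeasure \<nu> K)"
      unfolding emeasure_exhaust[OF s S] I_def by (intro SUP_least)
    show "(SUP K\<in>{K. K \<subseteq> S \<and> compact K}. emeasure \<nu> K) \<le> emeasure \<nu> S"
      using S s by (intro SUP_least emeasure_mono) auto
  qed
  show "emeasure \<nu> S = (INF U\<in>{U. S \<subseteq> U \<and> open U}. emeasure \<nu> U)"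
  proof (rule antisym)
    show "emeasure \<nu> S \<le> (INF U\<in>{U. S \<subseteq> U \<and> open U}. emeasure \<nu> U)"
      using s by (intro INF_greatest emeasure_mono) auto
    show "(INF U\<in>{U. S \<subseteq> U \<and> open U}. emeasure \<nu> U) \<le> emeasure \<nu> S"
    proof (rule ennreal_le_epsilon)
      fix e :: real assume e: "0 < e"
      have "\<exists>U. open U \<and> S \<inter> I n \<subseteq> U \<and> emeasure \<nu> ((U \<inter> I n) - S) \<le> ennreal (e * (1/2) ^ Suc n)" for n
      proof -
        let ?T = "S \<inter> I n"
        let ?d = "ennreal (e * (1/2) ^ Suc n)"
        have T: "?T \<in> sets borel" by simp
        have finT: "emeasure (N n) ?T \<noteq> \<infinity>"
          using fN[of n] emeasure_mono[of ?T "space (N n)" "N n"] by (auto simp: spN sN top_unique)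
        have "emeasure (N n) ?T < emeasure (N n) ?T + ?d"
          using finT e by (simp add: ennreal_add_left_cancel_less[of _ 0, simplified] less_top)
        then have "(INF U\<in>{U. ?T \<subseteq> U \<and> open U}. emeasure (N n) U) < emeasure (N n) ?T + ?d"
          using outer_regular[OF sN fN T] by simp
        then obtain U where U: "?T \<subseteq> U" "open U" "emeasure (N n) U < emeasure (N n) ?T + ?d"
          by (auto simp: INF_less_iff)
        have "emeasure \<nu> ((U \<inter> I n) - S) = emeasure (N n) (U - ?T)"
          using U(2) by (subst eN) (auto intro!: arg_cong[where f = "emeasure \<nu>"])
        also have "\<dots> = emeasure (N n) U - emeasure (N n) ?T"
          using U finT by (intro emeasure_Diff) (auto simp: sN)
        also have "\<dots> \<le> ?d"
          using U(3) finT by (simp add: ennreal_minus_le_iff less_imp_le)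
        finally show ?thesis using U by blast
      qed
      then obtain U where U: "\<And>n. open (U n)" "\<And>n. S \<inter> I n \<subseteq> U n" "\<And>n. emeasure \<nu> ((U n \<inter> I n) - S) \<le> ennreal (e * (1/2) ^ Suc n)"
        by metis
      define V where "V = (\<Union>n. U n \<inter> I n)"
      have Vo: "open V" unfolding V_def I_def by (intro open_UN ballI open_Int open_greaterThanLessThan U(1))
      have SV: "S \<subseteq> V"
      proof
        fix x assume x: "x \<in> S"
        obtain n where "\<bar>x\<bar> < real n" using reals_Archimedean2 by blast
        then have "x \<in> I n" by (auto simp: I_def)
        then show "x \<in> V" using x U(2) by (auto simp: V_def)
      qed
      have [measurable]: "U n \<in> sets borel" for n using U(1) by simp
      have "emeasure \<nu> V \<le> emeasure \<nu> (S \<union> (\<Union>n. (U n \<inter> I n) - S))"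
        by (intro emeasure_mono) (auto simp: V_def s)
      also have "\<dots> \<le> emeasure \<nu> S + emeasure \<nu> (\<Union>n. (U n \<inter> I n) - S)"
        by (intro emeasure_subadditive) (auto simp: s)
      also have "emeasure \<nu> (\<Union>n. (U n \<inter> I n) - S) \<le> (\<Sum>n. emeasure \<nu> ((U n \<inter> I n) - S))"
        by (intro emeasure_subadditive_countably) (auto simp: s)
      also have "\<dots> \<le> (\<Sum>n. ennreal (e * (1/2) ^ Suc n))"
        by (intro suminf_le U(3)) auto
      also have "\<dots> = ennreal (\<Sum>n. e * (1/2) ^ Suc n)"
        using e by (intro suminf_ennreal2 summable_mult) (auto intro: summable_Suc_iff[THEN iffD2] summable_geometric)
      also have "(\<Sum>n. e * (1/2) ^ Suc n) = e"
        using sums_mult[OF power_half_series, of e] by (simp add: sums_iff)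
      finally have "emeasure \<nu> V \<le> emeasure \<nu> S + ennreal e" by (simp add: add_left_mono)
      moreover have "(INF U\<in>{U. S \<subseteq> U \<and> open U}. emeasure \<nu> U) \<le> emeasure \<nu> V"
        using Vo SV by (intro INF_lower) auto
      ultimately show "(INF U\<in>{U. S \<subseteq> U \<and> open U}. emeasure \<nu> U) \<le> emeasure \<nu> S + ennreal e"
        by (rule order_trans[rotated])
    qed
  qed
qed

text \<open>
  The sum of all translates of \<open>\<mu>\<close> by periods, written as an image of a product with counting
  measure.
\<close>

definition periodize :: "real measure \<Rightarrow> real measure"
  where "periodize \<mu> = distr (count_space (UNIV :: int set) \<Otimes>\<^sub>M \<mu>) borel (\<lambda>(k, x). x + 2 * pi * of_int k)"

lemma sets_periodize [simp]: "sets (periodize \<mu>) = sets borel"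
  by (simp add: periodize_def)

lemma emeasure_periodize:
  assumes f: "finite_measure \<mu>" and s: "sets \<mu> = sets borel" and S: "S \<in> sets borel"
  shows "emeasure (periodize \<mu>) S = (\<integral>\<^sup>+k. emeasure \<mu> {x. x + 2 * pi * of_int k \<in> S} \<partial>count_space UNIV)"
proof -
  interpret finite_measure \<mu> by fact
  have [measurable_cong]: "sets \<mu> = sets borel" by fact
  have sp: "space \<mu> = UNIV" using s by (metis sets_eq_imp_space_eq space_borel)
  have m: "(\<lambda>(k, x). x + 2 * pi * of_int k) \<in> count_space (UNIV :: int set) \<Otimes>\<^sub>M \<mu> \<rightarrow>\<^sub>M borel"
    by (rule measurable_pair_measure_countable1) auto
  have "emeasure (periodize \<mu>) S = emeasure (count_space (UNIV :: int set) \<Otimes>\<^sub>M \<mu>) ((\<lambda>(k, x). x + 2 * pi * of_int k) -` S \<inter> space (count_space (UNIV :: int set) \<Otimes>\<^sub>M \<mu>))"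
    unfolding periodize_def by (rule emeasure_distr[OF m S])
  also have "\<dots> = (\<integral>\<^sup>+k. emeasure \<mu> (Pair k -` ((\<lambda>(k, x). x + 2 * pi * of_int k) -` S \<inter> space (count_space (UNIV :: int set) \<Otimes>\<^sub>M \<mu>))) \<partial>count_space UNIV)"
    by (rule emeasure_pair_measure_alt[OF measurable_sets[OF m S]])
  finally show ?thesis by (simp add: vimage_def space_pair_measure sp)
qed

text \<open>
  The representative of \<open>x\<close> in the cell. In particular it moves mass at the endpoint \<open>\<pi>\<close>, which a
  weak limit of measures on the cell may have, to \<open>- \<pi>\<close>.
\<close>

definition fold_cell :: "real \<Rightarrow> real"
  where "fold_cell x = x - 2 * pi * of_int \<lfloor>(x + pi) / (2 * pi)\<rfloor>"

lemma fold_cell_measurable [measurable]: "fold_cell \<in> borel_measurable borel"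
  unfolding fold_cell_def by measurable

lemma shift_in_cell_iff: "x + 2 * pi * of_int k \<in> cell \<longleftrightarrow> k = - \<lfloor>(x + pi) / (2 * pi)\<rfloor>"
proof -
  have "x + 2 * pi * of_int k \<in> cell \<longleftrightarrow> of_int (- k) * (2 * pi) \<le> x + pi \<and> x + pi < (of_int (- k) + 1) * (2 * pi)"
    by (auto simp: cell_def algebra_simps)
  also have "\<dots> \<longleftrightarrow> of_int (- k) \<le> (x + pi) / (2 * pi) \<and> (x + pi) / (2 * pi) < of_int (- k) + 1"
    by (simp only: pos_le_divide_eq pos_divide_less_eq pi_gt_zero mult_pos_pos zero_less_numeral)
  also have "\<dots> \<longleftrightarrow> \<lfloor>(x + pi) / (2 * pi)\<rfloor> = - k"
    by (simp add: floor_eq_iff)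
  finally show ?thesis by auto
qed

text \<open>
  For each \<open>x\<close> exactly one translate lies in the cell.
\<close>

lemma cell_measure_periodize:
  assumes f: "finite_measure \<mu>" and s: "sets \<mu> = sets borel"
  shows "cell_measure (periodize \<mu>) = distr \<mu> borel fold_cell"
proof (rule measure_eqI)
  have [measurable_cong]: "sets \<mu> = sets borel" by fact
  have sp: "space \<mu> = UNIV" using s by (metis sets_eq_imp_space_eq space_borel)
  fix S assume "S \<in> sets (cell_measure (periodize \<mu>))"
  then have [measurable]: "S \<in> sets borel" by simp
  have "emeasure (cell_measure (periodize \<mu>)) S = emeasure (periodize \<mu>) (cell \<inter> S)"
    by (intro emeasure_cell_measure) auto
  also have "\<dots> = (\<integral>\<^sup>+k. emeasure \<mu> {x. x + 2 * pi * of_int k \<in> cell \<inter> S} \<partial>count_space UNIV)"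
    by (rule emeasure_periodize[OF f s]) simp
  also have "\<dots> = emeasure \<mu> (\<Union>k. {x. x + 2 * pi * of_int k \<in> cell \<inter> S})"
  proof (rule emeasure_UN_countable[symmetric])
    show "{x. x + 2 * pi * of_int k \<in> cell \<inter> S} \<in> sets \<mu>" for k :: int
    proof -
      have "{x. x + 2 * pi * of_int k \<in> cell \<inter> S} \<in> sets borel" by measurable
      then show ?thesis by (simp add: s)
    qed
    show "disjoint_family (\<lambda>k::int. {x. x + 2 * pi * of_int k \<in> cell \<inter> S})"
      by (auto simp: disjoint_family_on_def shift_in_cell_iff)
  qed auto
  also have "(\<Union>k::int. {x. x + 2 * pi * of_int k \<in> cell \<inter> S}) = fold_cell -` S"
    by (auto simp: shift_in_cell_iff fold_cell_def)
  also have "emeasure \<mu> (fold_cell -` S) = emeasure (distr \<mu> borel fold_cell) S"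
    by (subst emeasure_distr) (auto simp: sp)
  finally show "emeasure (cell_measure (periodize \<mu>)) S = emeasure (distr \<mu> borel fold_cell) S" .
qed simp

lemma emeasure_periodize_shift:
  assumes f: "finite_measure \<mu>" and s: "sets \<mu> = sets borel" and S: "S \<in> sets borel"
  shows "emeasure (periodize \<mu>) ((\<lambda>x. x + 2 * pi) ` S) = emeasure (periodize \<mu>) S"
proof -
  have im: "(\<lambda>x. x + 2 * pi) ` S = {x. x - 2 * pi \<in> S}"
    by (auto simp: image_iff) (metis diff_add_cancel)
  have m: "{x. x - 2 * pi \<in> S} \<in> sets borel"
  proof -
    have [measurable]: "S \<in> sets borel" by fact
    show ?thesis by measurable
  qed
  have "emeasure (periodize \<mu>) ((\<lambda>x. x + 2 * pi) ` S) = (\<integral>\<^sup>+k. emeasure \<mu> {x. x + 2 * pi * of_int k - 2 * pi \<in> S} \<partial>count_space (UNIV :: int set))"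
    unfolding im by (subst emeasure_periodize[OF f s m]) simp
  also have "\<dots> = (\<integral>\<^sup>+k. emeasure \<mu> {x. x + 2 * pi * of_int (k - 1) \<in> S} \<partial>count_space (UNIV :: int set))"
    by (simp add: algebra_simps)
  also have "\<dots> = (\<integral>\<^sup>+k. emeasure \<mu> {x. x + 2 * pi * of_int k \<in> S} \<partial>count_space (UNIV :: int set))"
    by (rule nn_integral_bij_count_space[where g = "\<lambda>k. k - 1" and f = "\<lambda>k. emeasure \<mu> {x. x + 2 * pi * of_int k \<in> S}"])
       (rule bij_betwI[of _ _ _ "\<lambda>k. k + 1"], auto)
  also have "\<dots> = emeasure (periodize \<mu>) S" by (rule emeasure_periodize[OF f s S, symmetric])
  finally show ?thesis .
qed

text \<open>
  Each bounded interval is covered by finitely many translates of the cell, each of which carries the mass of \<open>\<mu>\<close>;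
  so the periodised measure is locally finite, hence regular.
\<close>

lemma periodize_periodic_measure:
  assumes f: "finite_measure \<mu>" and s: "sets \<mu> = sets borel"
  shows "periodize \<mu> \<in> periodic_measures"
proof -
  let ?\<nu> = "periodize \<mu>"
  interpret finite_measure \<mu> by fact
  have [measurable_cong]: "sets \<mu> = sets borel" by fact
  have "emeasure ?\<nu> cell = emeasure (cell_measure ?\<nu>) UNIV"
    by (subst emeasure_cell_measure) auto
  also have "\<dots> = emeasure \<mu> (space \<mu>)"
    unfolding cell_measure_periodize[OF f s] by (subst emeasure_distr) auto
  finally have fin: "emeasure ?\<nu> cell < \<infinity>" using emeasure_finite[of "space \<mu>"] by (simp add: less_top[symmetric])
  have cm: "(\<lambda>x. x + c) ` cell \<in> sets borel" for c
    unfolding cell_def by (simp add: add.commute[of _ c])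
  have up: "emeasure ?\<nu> ((\<lambda>x. x + 2 * pi * real n) ` cell) = emeasure ?\<nu> cell \<and> (\<lambda>x. x + 2 * pi * real n) ` cell \<in> sets borel" for n
  proof (induction n)
    case (Suc n)
    have "(\<lambda>x. x + 2 * pi * real (Suc n)) ` cell = (\<lambda>x. x + 2 * pi) ` (\<lambda>x. x + 2 * pi * real n) ` cell"
      by (simp add: image_image algebra_simps)
    moreover have "(\<lambda>x. x + 2 * pi * real (Suc n)) ` cell \<in> sets borel"
      by (rule cm)
    moreover have "emeasure ?\<nu> ((\<lambda>x. x + 2 * pi) ` (\<lambda>x. x + 2 * pi * real n) ` cell) = emeasure ?\<nu> cell"
      using emeasure_periodize_shift[OF f s, of "(\<lambda>x. x + 2 * pi * real n) ` cell"] Suc by simp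
    ultimately show ?case by presburger
  qed simp
  have down: "emeasure ?\<nu> ((\<lambda>x. x - 2 * pi * real n) ` cell) = emeasure ?\<nu> cell \<and> (\<lambda>x. x - 2 * pi * real n) ` cell \<in> sets borel" for n
  proof (induction n)
    case (Suc n)
    have "(\<lambda>x. x - 2 * pi * real n) ` cell = (\<lambda>x. x + 2 * pi) ` (\<lambda>x. x - 2 * pi * real (Suc n)) ` cell"
      by (simp add: image_image algebra_simps)
    moreover have "(\<lambda>x. x - 2 * pi * real (Suc n)) ` cell \<in> sets borel"
      using cm[of "- (2 * pi * real (Suc n))"] by simp
    moreover have "emeasure ?\<nu> ((\<lambda>x. x + 2 * pi) ` (\<lambda>x. x - 2 * pi * real (Suc n)) ` cell) = emeasure ?\<nu> ((\<lambda>x. x - 2 * pi * real (Suc n)) ` cell)"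
      using emeasure_periodize_shift[OF f s, of "(\<lambda>x. x - 2 * pi * real (Suc n)) ` cell"] calculation(2) by simp
    ultimately show ?case using Suc by presburger
  qed simp
  have "emeasure ?\<nu> {- real n<..<real n} < \<infinity>" for n
  proof -
    let ?C = "\<lambda>m. (\<lambda>x. x + 2 * pi * real m) ` cell \<union> (\<lambda>x. x - 2 * pi * real m) ` cell"
    have Cs: "?C m \<in> sets ?\<nu>" for m unfolding sets_periodize using up[of m] down[of m] by (intro sets.Un) blast+
    \<comment> \<open>An interval of half-length \<open>n\<close> needs at most the translates by \<open>-n\<close> to \<open>n\<close> periods, since a period
      is longer than \<open>1\<close>.\<close>
    have "{- real n<..<real n} \<subseteq> (\<Union>m\<in>{..n}. ?C m)"
    proof
      fix x assume x: "x \<in> {- real n<..<real n}"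
      define k where "k = - \<lfloor>(x + pi) / (2 * pi)\<rfloor>"
      have y: "x + 2 * pi * of_int k \<in> cell" using shift_in_cell_iff k_def by blast
      have "\<bar>2 * pi * of_int k\<bar> < real n + pi" using x y by (auto simp: cell_def)
      then have "2 * pi * \<bar>of_int k\<bar> < real n + pi" by (simp add: abs_mult)
      moreover have "2 * \<bar>real_of_int k\<bar> \<le> 2 * pi * \<bar>of_int k\<bar>" using pi_ge_two by (simp add: mult_le_cancel_right1)
      moreover have "pi < 4" by (rule pi_less_4)
      ultimately have "nat \<bar>k\<bar> \<le> n" 
      proof -
        assume a: "2 * pi * \<bar>real_of_int k\<bar> < real n + pi"
        show ?thesis
        proof (cases "k = 0")
          case False
          then have "1 \<le> \<bar>real_of_int k\<bar>" by linarith
          then have "pi * 1 \<le> pi * \<bar>real_of_int k\<bar>" by (intro mult_left_mono) auto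
          then have "pi * \<bar>real_of_int k\<bar> < real n" using a by linarith
          moreover have "1 * \<bar>real_of_int k\<bar> \<le> pi * \<bar>real_of_int k\<bar>" using pi_ge_two by (intro mult_right_mono) auto
          ultimately have "\<bar>real_of_int k\<bar> < real n" by linarith
          then show ?thesis by linarith
        qed simp
      qed
      moreover have "x \<in> ?C (nat \<bar>k\<bar>)"
      proof (cases "k \<ge> 0")
        case True
        then have "x = (x + 2 * pi * of_int k) - 2 * pi * real (nat \<bar>k\<bar>)" by simp
        then show ?thesis using y by blast
      next
        case False
        then have "x = (x + 2 * pi * of_int k) + 2 * pi * real (nat \<bar>k\<bar>)" by simp
        then show ?thesis using y by blast
      qed
      ultimately show "x \<in> (\<Union>m\<in>{..n}. ?C m)" by blast
    qed
    then have "emeasure ?\<nu> {- real n<..<real n} \<le> emeasure ?\<nu> (\<Union>m\<in>{..n}. ?C m)"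
      using Cs by (intro emeasure_mono sets.finite_UN) auto
    also have "\<dots> \<le> (\<Sum>m\<in>{..n}. emeasure ?\<nu> (?C m))"
      using Cs by (intro emeasure_subadditive_finite) auto
    also have "\<dots> \<le> (\<Sum>m\<in>{..n}. emeasure ?\<nu> cell + emeasure ?\<nu> cell)"
    proof (rule sum_mono)
      fix m
      have "emeasure ?\<nu> (?C m) \<le> emeasure ?\<nu> ((\<lambda>x. x + 2 * pi * real m) ` cell) + emeasure ?\<nu> ((\<lambda>x. x - 2 * pi * real m) ` cell)"
        using up[of m] down[of m] by (intro emeasure_subadditive) auto
      then show "emeasure ?\<nu> (?C m) \<le> emeasure ?\<nu> cell + emeasure ?\<nu> cell" using up[of m] down[of m] by simp
    qed
    also have "\<dots> < \<infinity>" using fin by (simp add: ennreal_mult_less_top of_nat_less_top)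
    finally show ?thesis .
  qed
  then have "regular_measure ?\<nu>" by (intro locally_finite_imp_regular) auto
  then show ?thesis
    unfolding periodic_measures_def using fin emeasure_periodize_shift[OF f s] by simp
qed

lemma integral_periodize:
  fixes \<phi> :: "real \<Rightarrow> 'a::{banach, second_countable_topology}"
  assumes f: "finite_measure \<mu>" and s: "sets \<mu> = sets borel" and \<phi>: "cper \<phi>"
  shows "(\<integral>x. \<phi> x \<partial>cell_measure (periodize \<mu>)) = (\<integral>x. \<phi> x \<partial>\<mu>)"
proof -
  have [measurable_cong]: "sets \<mu> = sets borel" by fact
  have "(\<integral>x. \<phi> x \<partial>cell_measure (periodize \<mu>)) = (\<integral>x. \<phi> (fold_cell x) \<partial>\<mu>)"
    unfolding cell_measure_periodize[OF f s] using cper_measurable[OF \<phi>]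
    by (intro integral_distr) auto
  moreover have "\<phi> (fold_cell x) = \<phi> x" for x
  proof -
    have "fold_cell x = x + 2 * pi * of_int (- \<lfloor>(x + pi) / (2 * pi)\<rfloor>)" by (simp add: fold_cell_def)
    then show ?thesis using \<phi> periodic_int[of \<phi> x "- \<lfloor>(x + pi) / (2 * pi)\<rfloor>"] unfolding cper_def by simp
  qed
  ultimately show ?thesis by simp
qed

section \<open>Weak limits and ground states\<close>

definition finite_borel :: "real measure \<Rightarrow> bool"
  where "finite_borel \<mu> \<longleftrightarrow> finite_measure \<mu> \<and> sets \<mu> = sets borel"

lemma finite_borel_space: "finite_borel \<mu> \<Longrightarrow> space \<mu> = UNIV"
  unfolding finite_borel_def by (metis sets_eq_imp_space_eq space_borel)

lemma finite_borel_lam: "finite_borel lam"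
  by (simp add: finite_borel_def finite_measure_lam)

lemma finite_borel_integrable: "finite_borel \<mu> \<Longrightarrow> cper f \<Longrightarrow> integrable \<mu> f"
  for f :: "real \<Rightarrow> 'a::{banach, second_countable_topology}"
  unfolding finite_borel_def by (intro cper_integrable) auto

lemma finite_borel_integral_bound:
  fixes f :: "real \<Rightarrow> real"
  assumes \<mu>: "finite_borel \<mu>" and f: "cper f" and b: "\<And>x. \<bar>f x\<bar> \<le> B"
  shows "\<bar>\<integral>x. f x \<partial>\<mu>\<bar> \<le> measure \<mu> UNIV * B"
proof -
  interpret finite_measure \<mu> using \<mu> by (simp add: finite_borel_def)
  have "\<bar>\<integral>x. f x \<partial>\<mu>\<bar> \<le> (\<integral>x. \<bar>f x\<bar> \<partial>\<mu>)" by (rule integral_abs_bound)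
  also have "\<dots> \<le> (\<integral>x. B \<partial>\<mu>)"
    by (intro integral_mono integrable_abs finite_borel_integrable[OF \<mu> f] b) simp
  finally show ?thesis by (simp add: finite_borel_space[OF \<mu>])
qed

text \<open>
  Only periodic test functions are used, so that the endpoints of the cell count as the same
  point.
\<close>

definition weak_limit :: "(nat \<Rightarrow> real measure) \<Rightarrow> real measure \<Rightarrow> bool"
  where "weak_limit \<mu> \<mu>' \<longleftrightarrow> (\<forall>\<phi>::real \<Rightarrow> real. cper \<phi> \<longrightarrow> (\<lambda>n. \<integral>x. \<phi> x \<partial>\<mu> n) \<longlonglongrightarrow> (\<integral>x. \<phi> x \<partial>\<mu>'))"

lemma weak_limit_subseq: "weak_limit \<mu> \<mu>' \<Longrightarrow> strict_mono r \<Longrightarrow> weak_limit (\<mu> \<circ> r) \<mu>'"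
  unfolding weak_limit_def using LIMSEQ_subseq_LIMSEQ by (fastforce simp: o_def)

lemma weak_limit_const: "weak_limit (\<lambda>_. \<mu>) \<mu>"
  by (simp add: weak_limit_def)

text \<open>
  Rellich's theorem in Fourier space, with convergence in the norm of absolutely convergent Fourier
  series, which dominates the supremum norm. A diagonal subsequence converges in each coefficient. Outside a
  large finite set \<open>F\<close>, the \<open>\<eta>\<close>-inequality \<open>young_weight\<close> bounds the sum of the moduli by \<open>\<eta>\<close>
  times the bounded energy plus \<open>1/\<eta>\<close> times the tail of the sum of \<open>1 / (1 + k\<^sup>2)\<close>.
\<close>

lemma H1_compactness:
  assumes H: "\<And>n. H1seq (c n)" and R: "\<And>n. (\<Sum>\<^sub>\<infinity>k. (1 + (real_of_int k)\<^sup>2) * (cmod (c n k))\<^sup>2) \<le> R"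
  shows "\<exists>r c'. strict_mono (r :: nat \<Rightarrow> nat) \<and> H1seq c' \<and> (\<forall>k. (\<lambda>n. c (r n) k) \<longlonglongrightarrow> c' k) \<and>
    (\<lambda>n. \<Sum>\<^sub>\<infinity>k. cmod (c (r n) k - c' k)) \<longlonglongrightarrow> 0"
proof -
  define w where "w k = 1 + (real_of_int k)\<^sup>2" for k
  have w1: "w k \<ge> 1" for k by (simp add: w_def)
  have w0: "w k > 0" for k using w1[of k] by linarith
  have wR: "(\<Sum>k\<in>F. w k * (cmod (c n k))\<^sup>2) \<le> R" if "finite F" for F n
    using finite_sum_le_infsum[OF H[unfolded H1seq_def, of n] that] R[of n] by (simp add: w_def)
  have R0: "R \<ge> 0" using wR[of "{}"] by simp
  have cR: "cmod (c n k) \<le> sqrt R" for n k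
  proof (rule real_le_rsqrt)
    have "1 * (cmod (c n k))\<^sup>2 \<le> w k * (cmod (c n k))\<^sup>2" by (intro mult_right_mono w1) simp
    also have "\<dots> \<le> R" using wR[of "{k}" n] by simp
    finally show "(cmod (c n k))\<^sup>2 \<le> R" by simp
  qed
  interpret subseqs "\<lambda>k s. convergent (\<lambda>n. c (s n) (int_decode k))"
  proof
    fix k and s :: "nat \<Rightarrow> nat" assume "strict_mono s"
    define f where "f n = c (s n) (int_decode k)" for n
    have "\<forall>n. f n \<in> cball 0 (sqrt R)" using cR by (simp add: f_def)
    then obtain l r where "strict_mono (r :: nat \<Rightarrow> nat)" "(f \<circ> r) \<longlonglongrightarrow> l"
      using compact_cball[of "0::complex" "sqrt R"] unfolding compact_def by blast
    then show "\<exists>r. strict_mono r \<and> convergent (\<lambda>n. c ((s \<circ> r) n) (int_decode k))"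
      by (auto simp: convergent_def o_def f_def)
  qed
  define r where "r = diagseq"
  have r: "strict_mono r" unfolding r_def by (rule subseq_diagseq)
  have conv: "convergent (\<lambda>n. c (r n) k)" for k
  proof -
    define j where "j = int_encode k"
    have "convergent (\<lambda>n. c ((diagseq \<circ> (+) (Suc j)) n) (int_decode j))"
    proof (rule diagseq_holds)
      fix r s :: "nat \<Rightarrow> nat" and n assume "strict_mono r" "convergent (\<lambda>m. c (s m) (int_decode n))"
      then show "convergent (\<lambda>m. c ((s \<circ> r) m) (int_decode n))"
        using convergent_subseq_convergent by (fastforce simp: o_def)
    qed
    then have "convergent (\<lambda>n. c (r (n + Suc j)) k)" by (simp add: r_def j_def o_def add.commute)
    then show ?thesis by (subst (asm) convergent_ignore_initial_segment[of "\<lambda>n. c (r n) k" "Suc j"])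
  qed
  define c' where "c' k = lim (\<lambda>n. c (r n) k)" for k
  have lim: "(\<lambda>n. c (r n) k) \<longlonglongrightarrow> c' k" for k
    using conv by (simp add: c'_def convergent_LIMSEQ_iff)
  have wR': "(\<Sum>k\<in>F. w k * (cmod (c' k))\<^sup>2) \<le> R" if "finite F" for F
  proof (rule LIMSEQ_le_const2)
    show "(\<lambda>n. \<Sum>k\<in>F. w k * (cmod (c (r n) k))\<^sup>2) \<longlonglongrightarrow> (\<Sum>k\<in>F. w k * (cmod (c' k))\<^sup>2)"
      by (intro tendsto_intros lim)
  qed (use wR[OF that] in auto)
  have H': "H1seq c'"
    unfolding H1seq_def using wR' 
    by (intro nonneg_bdd_above_summable_on bdd_aboveI2[where M = R]) (auto simp: w_def)
  have "(\<lambda>n. \<Sum>\<^sub>\<infinity>k. cmod (c (r n) k - c' k)) \<longlonglongrightarrow> 0"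
  proof (rule LIMSEQ_I)
    fix e :: real assume e: "0 < e"
    \<comment> \<open>The differences have energy at most \<open>4 R\<close>, and \<open>\<eta> (4 R) \<le> e / 4\<close>.\<close>
    define \<eta> where "\<eta> = e / 4 / (4 * R + 1)"
    have \<eta>: "\<eta> > 0" using e R0 by (simp add: \<eta>_def)
    have \<eta>R: "\<eta> * (4 * R) \<le> e / 4"
    proof -
      have "\<eta> * (4 * R + 1) = e / 4"
      proof -
        have "4 * R + 1 \<noteq> 0" using R0 by linarith
        moreover have "a / b * b = a" if "b \<noteq> 0" for a b :: real using that by simp
        ultimately show ?thesis unfolding \<eta>_def by blast
      qed
      then show ?thesis using \<eta> by (simp add: distrib_left)
    qed
    define W where "W = (\<Sum>\<^sub>\<infinity>k. 1 / w k)"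
    have hW: "((\<lambda>k. 1 / w k) has_sum W) UNIV"
      unfolding W_def w_def by (rule has_sum_infsum[OF inverse_weight_summable])
    have "\<eta> * e / 4 > 0" using \<eta> e by simp
    from has_sum_finite_approximation[OF hW this]
    obtain F where F: "finite F" "dist (\<Sum>k\<in>F. 1 / w k) W \<le> \<eta> * e / 4" by blast
    have "(\<lambda>n. \<Sum>k\<in>F. cmod (c (r n) k - c' k)) \<longlonglongrightarrow> (\<Sum>k\<in>F. cmod (c' k - c' k))"
      by (intro tendsto_intros lim)
    then have "eventually (\<lambda>n. (\<Sum>k\<in>F. cmod (c (r n) k - c' k)) < e / 4) sequentially"
      using e by (intro order_tendstoD(2)) auto
    then obtain n0 where n0: "\<And>n. n \<ge> n0 \<Longrightarrow> (\<Sum>k\<in>F. cmod (c (r n) k - c' k)) < e / 4"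
      by (auto simp: eventually_sequentially)
    have "(\<Sum>\<^sub>\<infinity>k. cmod (c (r n) k - c' k)) < e" if n: "n \<ge> n0" for n
    proof -
      let ?d = "\<lambda>k. c (r n) k - c' k"
      have "(\<Sum>k\<in>G. cmod (?d k)) \<le> e / 4 + e / 4 + e / 4" if G: "finite G" for G
      proof -
        have "(\<Sum>k\<in>G. cmod (?d k)) \<le> (\<Sum>k\<in>F \<union> (G - F). cmod (?d k))"
          using F(1) G by (intro sum_mono2) auto
        also have "\<dots> = (\<Sum>k\<in>F. cmod (?d k)) + (\<Sum>k\<in>G - F. cmod (?d k))"
          using F(1) G by (intro sum.union_disjoint) auto
        also have "(\<Sum>k\<in>G - F. cmod (?d k)) \<le> (\<Sum>k\<in>G - F. \<eta> * (2 * (w k * (cmod (c (r n) k))\<^sup>2) + 2 * (w k * (cmod (c' k))\<^sup>2)) + (1 / \<eta>) * (1 / w k))"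
        proof (rule sum_mono)
          fix k
          have "(cmod (?d k))\<^sup>2 \<le> (cmod (c (r n) k) + cmod (c' k))\<^sup>2"
            by (intro power_mono norm_triangle_ineq4) simp
          also have "\<dots> \<le> 2 * (cmod (c (r n) k))\<^sup>2 + 2 * (cmod (c' k))\<^sup>2"
            using sum_squares_bound[of "cmod (c (r n) k)" "cmod (c' k)"] by (simp add: power2_sum)
          finally have "w k * (cmod (?d k))\<^sup>2 \<le> w k * (2 * (cmod (c (r n) k))\<^sup>2 + 2 * (cmod (c' k))\<^sup>2)"
            using w0[of k] by (intro mult_left_mono) auto
          then have "\<eta> * (w k * (cmod (?d k))\<^sup>2) \<le> \<eta> * (2 * (w k * (cmod (c (r n) k))\<^sup>2) + 2 * (w k * (cmod (c' k))\<^sup>2))"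
            using \<eta> by (intro mult_left_mono) (auto simp: algebra_simps)
          moreover have "cmod (?d k) \<le> \<eta> * (w k * (cmod (?d k))\<^sup>2) + (1 / \<eta>) * (1 / w k)"
            unfolding w_def by (rule young_weight[OF \<eta>])
          ultimately show "cmod (?d k) \<le> \<eta> * (2 * (w k * (cmod (c (r n) k))\<^sup>2) + 2 * (w k * (cmod (c' k))\<^sup>2)) + (1 / \<eta>) * (1 / w k)"
            by linarith
        qed
        also have "\<dots> = \<eta> * (2 * (\<Sum>k\<in>G - F. w k * (cmod (c (r n) k))\<^sup>2) + 2 * (\<Sum>k\<in>G - F. w k * (cmod (c' k))\<^sup>2)) + (1 / \<eta>) * (\<Sum>k\<in>G - F. 1 / w k)"
          by (simp only: sum.distrib sum_distrib_left[symmetric])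
        also have "\<dots> \<le> \<eta> * (2 * R + 2 * R) + (1 / \<eta>) * (\<eta> * e / 4)"
        proof (intro add_mono mult_left_mono wR wR')
          have "(\<Sum>k\<in>F. 1 / w k) + (\<Sum>k\<in>G - F. 1 / w k) = (\<Sum>k\<in>F \<union> (G - F). 1 / w k)"
            using F(1) G by (intro sum.union_disjoint[symmetric]) auto
          also have "\<dots> \<le> W"
            using w0 by (intro finite_sum_le_has_sum[OF hW]) (use F(1) G in \<open>auto simp: less_imp_le\<close>)
          finally show "(\<Sum>k\<in>G - F. 1 / w k) \<le> \<eta> * e / 4" using F(2) unfolding dist_real_def by linarith
        qed (use \<eta> G in auto)
        also have "\<dots> \<le> e / 4 + e / 4" using \<eta>R \<eta> by simp
        finally show ?thesis using n0[OF n] by linarith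
      qed
      then have "(\<Sum>\<^sub>\<infinity>k. cmod (?d k)) \<le> e / 4 + e / 4 + e / 4"
        by (intro infsum_le_finite_sums nonneg_bdd_above_summable_on bdd_aboveI2[where M = "e / 4 + e / 4 + e / 4"]) auto
      then show ?thesis using e by simp
    qed
    then have "\<bar>\<Sum>\<^sub>\<infinity>k. cmod (c (r n) k - c' k)\<bar> < e" if "n \<ge> n0" for n
      using that infsum_nonneg[of UNIV "\<lambda>k. cmod (c (r n) k - c' k)"] by simp
    then show "\<exists>n0. \<forall>n\<ge>n0. norm ((\<Sum>\<^sub>\<infinity>k. cmod (c (r n) k - c' k)) - 0) < e" by auto
  qed
  then show ?thesis using r H' lim by blast
qed

lemma fsum_diff_bound:
  assumes "H1seq c" "H1seq d"
  shows "cmod (fsum c x - fsum d x) \<le> (\<Sum>\<^sub>\<infinity>k. cmod (c k - d k))"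
proof -
  have s: "(\<lambda>k. cmod (c k - d k)) summable_on UNIV"
    by (rule summable_on_comparison_test[OF summable_on_add[OF H1seq_summable[OF assms(1)] H1seq_summable[OF assms(2)]]])
       (auto intro: norm_triangle_ineq4)
  have "((\<lambda>k. c k * cis (of_int k * x) - d k * cis (of_int k * x)) has_sum (fsum c x - fsum d x)) UNIV"
    by (intro has_sum_minus fsum_has_sum H1seq_summable assms)
  then have "fsum c x - fsum d x = fsum (\<lambda>k. c k - d k) x"
    unfolding fsum_def[of "\<lambda>k. c k - d k"] left_diff_distrib by (simp add: infsumI)
  then show ?thesis using fsum_bound[OF s, of x] by simp
qed

text \<open>
  Replace \<open>v n\<close> by \<open>v'\<close> at a cost controlled by the uniform distance and the bounded mass, then use weak
  convergence for the fixed function \<open>|v'|\<^sup>2\<close>.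
\<close>

lemma square_integral_limit:
  assumes \<mu>: "\<And>n. finite_borel (\<mu> n)" "finite_borel \<mu>'" and M: "\<And>n. measure (\<mu> n) UNIV \<le> M" and w: "weak_limit \<mu> \<mu>'"
    and v: "\<And>n. cper (v n)" "cper (v' :: real \<Rightarrow> complex)" and s: "\<And>n x. cmod (v n x - v' x) \<le> s n" "s \<longlonglongrightarrow> 0"
  shows "(\<lambda>n. \<integral>x. (cmod (v n x))\<^sup>2 \<partial>\<mu> n) \<longlonglongrightarrow> (\<integral>x. (cmod (v' x))\<^sup>2 \<partial>\<mu>')"
proof -
  obtain B where B: "B > 0" "\<And>x. cmod (v' x) \<le> B" using cper_bounded[OF v(2)] by blast
  have s0: "s n \<ge> 0" for n using s(1)[of n 0] norm_ge_zero order_trans by blast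
  have bd: "\<bar>(cmod (v n x))\<^sup>2 - (cmod (v' x))\<^sup>2\<bar> \<le> s n * (s n + 2 * B)" for n x
  proof -
    have d: "\<bar>cmod (v n x) - cmod (v' x)\<bar> \<le> s n"
      using norm_triangle_ineq3[of "v n x" "v' x"] s(1)[of n x] by linarith
    then have "cmod (v n x) + cmod (v' x) \<le> s n + 2 * B" using B(2)[of x] by linarith
    moreover have "(cmod (v n x))\<^sup>2 - (cmod (v' x))\<^sup>2 = (cmod (v n x) - cmod (v' x)) * (cmod (v n x) + cmod (v' x))"
      by (simp add: power2_eq_square algebra_simps)
    ultimately show ?thesis using d by (auto simp: abs_mult intro!: mult_mono)
  qed
  have cv: "cper (\<lambda>x. (cmod (v n x))\<^sup>2)" "cper (\<lambda>x. (cmod (v' x))\<^sup>2)" for n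
    by (intro cper_intros v)+
  have "\<bar>(\<integral>x. (cmod (v n x))\<^sup>2 \<partial>\<mu> n) - (\<integral>x. (cmod (v' x))\<^sup>2 \<partial>\<mu> n)\<bar> \<le> M * (s n * (s n + 2 * B))" for n
  proof -
    have "(\<integral>x. (cmod (v n x))\<^sup>2 \<partial>\<mu> n) - (\<integral>x. (cmod (v' x))\<^sup>2 \<partial>\<mu> n) = (\<integral>x. (cmod (v n x))\<^sup>2 - (cmod (v' x))\<^sup>2 \<partial>\<mu> n)"
      by (intro Bochner_Integration.integral_diff[symmetric] finite_borel_integrable \<mu> cv)
    also have "\<bar>\<dots>\<bar> \<le> measure (\<mu> n) UNIV * (s n * (s n + 2 * B))"
      by (intro finite_borel_integral_bound \<mu> cper_diff cv bd)
    also have "\<dots> \<le> M * (s n * (s n + 2 * B))"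
      using s0[of n] B by (intro mult_right_mono M) auto
    finally show ?thesis .
  qed
  then have ev: "eventually (\<lambda>n. norm ((\<integral>x. (cmod (v n x))\<^sup>2 \<partial>\<mu> n) - (\<integral>x. (cmod (v' x))\<^sup>2 \<partial>\<mu> n)) \<le> M * (s n * (s n + 2 * B))) sequentially"
    unfolding real_norm_def by (rule always_eventually[OF allI])
  have "(\<lambda>n. M * (s n * (s n + 2 * B))) \<longlonglongrightarrow> M * (0 * (0 + 2 * B))"
    by (intro tendsto_intros s(2))
  then have "(\<lambda>n. M * (s n * (s n + 2 * B))) \<longlonglongrightarrow> 0" unfolding mult_zero_left mult_zero_right .
  with ev have d: "(\<lambda>n. (\<integral>x. (cmod (v n x))\<^sup>2 \<partial>\<mu> n) - (\<integral>x. (cmod (v' x))\<^sup>2 \<partial>\<mu> n)) \<longlonglongrightarrow> 0"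
    by (rule Lim_null_comparison)
  have "(\<lambda>n. \<integral>x. (cmod (v' x))\<^sup>2 \<partial>\<mu> n) \<longlonglongrightarrow> (\<integral>x. (cmod (v' x))\<^sup>2 \<partial>\<mu>')"
    using w cv(2) unfolding weak_limit_def by blast
  from tendsto_add[OF d this] show ?thesis by simp
qed

text \<open>
  Lower semicontinuity of the energy jointly in the measure and the state. Bounded
  energy bounds the \<open>H\<^sup>1\<close> norm, so a subsequence converges uniformly; the norm and the potential
  energy converge, and the kinetic energy can only drop in the limit, as each of its finite partial sums converges.
\<close>

lemma energy_limit:
  assumes \<mu>: "\<And>n. finite_borel (\<mu> n)" "finite_borel \<mu>'" and M: "\<And>n. measure (\<mu> n) UNIV \<le> M" and w: "weak_limit \<mu> \<mu>'"
    and c: "\<And>n. H1seq (c n)" "\<And>n. nsq (c n) = 1" and e: "\<And>n. energy (\<mu> n) q (c n) \<le> e n" "e \<longlonglongrightarrow> e'"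
  shows "\<exists>c'. H1seq c' \<and> nsq c' = 1 \<and> energy \<mu>' q c' \<le> e'"
proof -
  have pos: "0 \<le> (\<integral>x. (cmod (fsum (c n) x))\<^sup>2 \<partial>\<mu> n)" for n by simp
  obtain E where E: "\<And>n. e n \<le> E"
    using convergent_imp_Bseq[OF convergentI[OF e(2)]] unfolding Bseq_def by (auto simp: abs_le_iff)
  have kE: "kin q (c n) \<le> E" for n
    using e(1)[of n] E[of n] pos[of n] unfolding energy_def by linarith
  have bd: "(\<Sum>\<^sub>\<infinity>k. (1 + (real_of_int k)\<^sup>2) * (cmod (c n k))\<^sup>2) \<le> (1 + 2 * q\<^sup>2) * (1 / (2 * pi)) + 2 * (E / (2 * pi))" for n
  proof -
    have "(\<Sum>\<^sub>\<infinity>k. (1 + (real_of_int k)\<^sup>2) * (cmod (c n k))\<^sup>2) \<le> (1 + 2 * q\<^sup>2) * (\<Sum>\<^sub>\<infinity>k. (cmod (c n k))\<^sup>2) + 2 * (\<Sum>\<^sub>\<infinity>k. (of_int k + q)\<^sup>2 * (cmod (c n k))\<^sup>2)"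
    proof (rule has_sum_mono)
      show "((\<lambda>k. (1 + (real_of_int k)\<^sup>2) * (cmod (c n k))\<^sup>2) has_sum (\<Sum>\<^sub>\<infinity>k. (1 + (real_of_int k)\<^sup>2) * (cmod (c n k))\<^sup>2)) UNIV"
        using c(1)[of n] unfolding H1seq_def by (rule has_sum_infsum)
      show "((\<lambda>k. (1 + 2 * q\<^sup>2) * (cmod (c n k))\<^sup>2 + 2 * ((of_int k + q)\<^sup>2 * (cmod (c n k))\<^sup>2)) has_sum
         ((1 + 2 * q\<^sup>2) * (\<Sum>\<^sub>\<infinity>k. (cmod (c n k))\<^sup>2) + 2 * (\<Sum>\<^sub>\<infinity>k. (of_int k + q)\<^sup>2 * (cmod (c n k))\<^sup>2))) UNIV"
        by (intro has_sum_add has_sum_cmult_right has_sum_infsum nsq_summable kin_summable c)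
      fix k :: int
      have "1 + (real_of_int k)\<^sup>2 \<le> (1 + 2 * q\<^sup>2) + 2 * (of_int k + q)\<^sup>2"
        using zero_le_power2[of "of_int k + 2 * q"] by (simp add: power2_sum power_mult_distrib)
      then show "(1 + (real_of_int k)\<^sup>2) * (cmod (c n k))\<^sup>2 \<le> (1 + 2 * q\<^sup>2) * (cmod (c n k))\<^sup>2 + 2 * ((of_int k + q)\<^sup>2 * (cmod (c n k))\<^sup>2)"
        using mult_right_mono[of "1 + (real_of_int k)\<^sup>2" "(1 + 2 * q\<^sup>2) + 2 * (of_int k + q)\<^sup>2" "(cmod (c n k))\<^sup>2"]
        by (simp add: distrib_right mult.assoc)
    qed
    also have "\<dots> \<le> (1 + 2 * q\<^sup>2) * (1 / (2 * pi)) + 2 * (E / (2 * pi))"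
      using c(2)[of n] kE[of n] by (intro add_mono mult_left_mono) (simp_all add: nsq_def kin_def le_divide_eq mult.commute)
    finally show ?thesis .
  qed
  obtain r c' where r: "strict_mono (r :: nat \<Rightarrow> nat)" and c': "H1seq c'" and lim: "\<And>k. (\<lambda>n. c (r n) k) \<longlonglongrightarrow> c' k"
    and l1: "(\<lambda>n. \<Sum>\<^sub>\<infinity>k. cmod (c (r n) k - c' k)) \<longlonglongrightarrow> 0"
    using H1_compactness[of c, OF c(1) bd] by blast
  define s where "s n = (\<Sum>\<^sub>\<infinity>k. cmod (c (r n) k - c' k))" for n
  have s: "cmod (fsum (c (r n)) x - fsum c' x) \<le> s n" for n x
    unfolding s_def by (rule fsum_diff_bound[OF c(1) c'])
  have s0: "s \<longlonglongrightarrow> 0" using l1 by (simp add: s_def[abs_def])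
  have "(\<lambda>n. \<integral>x. (cmod (fsum (c (r n)) x))\<^sup>2 \<partial>lam) \<longlonglongrightarrow> (\<integral>x. (cmod (fsum c' x))\<^sup>2 \<partial>lam)"
    by (rule square_integral_limit[OF finite_borel_lam finite_borel_lam _ weak_limit_const H1seq_cper[OF c(1)] H1seq_cper[OF c'] s s0, where M = "2 * pi"])
       (simp add: measure_lam)
  then have "(\<lambda>n. nsq (c (r n))) \<longlonglongrightarrow> nsq c'" by (simp only: nsq_integral[OF c(1)] nsq_integral[OF c'])
  then have n1: "nsq c' = 1" by (simp add: c(2) LIMSEQ_const_iff)
  have pl: "(\<lambda>n. \<integral>x. (cmod (fsum (c (r n)) x))\<^sup>2 \<partial>(\<mu> \<circ> r) n) \<longlonglongrightarrow> (\<integral>x. (cmod (fsum c' x))\<^sup>2 \<partial>\<mu>')"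
    by (rule square_integral_limit[OF _ \<mu>(2) _ weak_limit_subseq[OF w r] H1seq_cper[OF c(1)] H1seq_cper[OF c'] s s0, where M = M])
       (simp_all add: \<mu> M)
  have er: "(\<lambda>n. e (r n)) \<longlonglongrightarrow> e'" using LIMSEQ_subseq_LIMSEQ[OF e(2) r] by (simp add: o_def)
  have fin: "2 * pi * (\<Sum>k\<in>F. (of_int k + q)\<^sup>2 * (cmod (c' k))\<^sup>2) \<le> e' - (\<integral>x. (cmod (fsum c' x))\<^sup>2 \<partial>\<mu>')" if F: "finite F" for F :: "int set"
  proof (rule LIMSEQ_le)
    show "(\<lambda>n. 2 * pi * (\<Sum>k\<in>F. (of_int k + q)\<^sup>2 * (cmod (c (r n) k))\<^sup>2)) \<longlonglongrightarrow> 2 * pi * (\<Sum>k\<in>F. (of_int k + q)\<^sup>2 * (cmod (c' k))\<^sup>2)"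
      by (intro tendsto_intros lim)
    show "(\<lambda>n. e (r n) - (\<integral>x. (cmod (fsum (c (r n)) x))\<^sup>2 \<partial>(\<mu> \<circ> r) n)) \<longlonglongrightarrow> e' - (\<integral>x. (cmod (fsum c' x))\<^sup>2 \<partial>\<mu>')"
      by (intro tendsto_diff er pl)
    have "2 * pi * (\<Sum>k\<in>F. (of_int k + q)\<^sup>2 * (cmod (c (r n) k))\<^sup>2) \<le> e (r n) - (\<integral>x. (cmod (fsum (c (r n)) x))\<^sup>2 \<partial>(\<mu> \<circ> r) n)" for n
    proof -
      have "2 * pi * (\<Sum>k\<in>F. (of_int k + q)\<^sup>2 * (cmod (c (r n) k))\<^sup>2) \<le> kin q (c (r n))"
        unfolding kin_def using F by (intro mult_left_mono finite_sum_le_infsum kin_summable c) auto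
      also have "\<dots> \<le> e (r n) - (\<integral>x. (cmod (fsum (c (r n)) x))\<^sup>2 \<partial>(\<mu> \<circ> r) n)"
        using e(1)[of "r n"] unfolding energy_def o_apply by linarith
      finally show ?thesis .
    qed
    then show "\<exists>N. \<forall>n\<ge>N. 2 * pi * (\<Sum>k\<in>F. (of_int k + q)\<^sup>2 * (cmod (c (r n) k))\<^sup>2) \<le> e (r n) - (\<integral>x. (cmod (fsum (c (r n)) x))\<^sup>2 \<partial>(\<mu> \<circ> r) n)"
      by blast
  qed
  have "(\<Sum>\<^sub>\<infinity>k. (of_int k + q)\<^sup>2 * (cmod (c' k))\<^sup>2) \<le> (e' - (\<integral>x. (cmod (fsum c' x))\<^sup>2 \<partial>\<mu>')) / (2 * pi)"
    using fin by (intro infsum_le_finite_sums kin_summable c') (simp add: le_divide_eq mult.commute)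
  then have "kin q c' \<le> e' - (\<integral>x. (cmod (fsum c' x))\<^sup>2 \<partial>\<mu>')" by (simp add: kin_def le_divide_eq mult.commute)
  then show ?thesis using c' n1 by (auto simp: energy_def)
qed

lemma energy_nonneg: "energy \<mu> q c \<ge> 0"
  unfolding energy_def using kin_nonneg by (simp add: add_nonneg_nonneg)

lemma ground_energy_le: "H1seq c \<Longrightarrow> nsq c = 1 \<Longrightarrow> ground_energy \<mu> q \<le> energy \<mu> q c"
  unfolding ground_energy_def by (intro cInf_lower bdd_belowI[where m = 0]) (auto simp: energy_nonneg)

text \<open>
  The normalised constant function.
\<close>

definition unit_mode :: "int \<Rightarrow> complex"
  where "unit_mode k = (if k = 0 then of_real (1 / sqrt (2 * pi)) else 0)"

lemma unit_mode: "H1seq unit_mode" "nsq unit_mode = 1" "energy \<mu> q unit_mode = q\<^sup>2 + (\<integral>x. 1 / (2 * pi) \<partial>\<mu>)"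
proof -
  have u: "(cmod (unit_mode k))\<^sup>2 = (if k = 0 then 1 / (2 * pi) else 0)" for k
    by (simp add: unit_mode_def power_divide norm_divide)
  have h: "((\<lambda>k. a k * (cmod (unit_mode k))\<^sup>2) has_sum (a 0 / (2 * pi))) UNIV" for a :: "int \<Rightarrow> real"
    by (rule has_sum_finite_neutralI[where B = "{0}"]) (auto simp: u)
  show "H1seq unit_mode" unfolding H1seq_def by (rule has_sum_imp_summable[OF h])
  show "nsq unit_mode = 1" using infsumI[OF h[of "\<lambda>_. 1"]] by (simp add: nsq_def)
  have "kin q unit_mode = q\<^sup>2" using infsumI[OF h[of "\<lambda>k. (of_int k + q)\<^sup>2"]] by (simp add: kin_def)
  moreover have "fsum unit_mode x = of_real (1 / sqrt (2 * pi))" for x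
    unfolding fsum_def by (rule infsumI, rule has_sum_finite_neutralI[where B = "{0}"]) (auto simp: unit_mode_def)
  ultimately show "energy \<mu> q unit_mode = q\<^sup>2 + (\<integral>x. 1 / (2 * pi) \<partial>\<mu>)"
    by (simp add: energy_def norm_divide power_divide)
qed

lemma ground_energy_greatest: "(\<And>c. H1seq c \<Longrightarrow> nsq c = 1 \<Longrightarrow> e \<le> energy \<mu> q c) \<Longrightarrow> e \<le> ground_energy \<mu> q"
  unfolding ground_energy_def using unit_mode(1,2) by (intro cInf_greatest) auto

lemma ground_energy_nonneg: "ground_energy \<mu> q \<ge> 0"
  by (rule ground_energy_greatest) (rule energy_nonneg)

lemma ground_energy_upper: "finite_borel \<mu> \<Longrightarrow> ground_energy \<mu> q \<le> q\<^sup>2 + measure \<mu> UNIV / (2 * pi)"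
  using ground_energy_le[OF unit_mode(1,2), of \<mu> q] by (simp add: unit_mode(3) finite_borel_space)

text \<open>
  Apply \<open>energy_limit\<close> to a constant sequence of measures and a minimising sequence of states.
\<close>

lemma ground_energy_attained:
  assumes "finite_borel \<mu>"
  obtains c where "H1seq c" "nsq c = 1" "energy \<mu> q c = ground_energy \<mu> q"
proof -
  have "\<exists>c. H1seq c \<and> nsq c = 1 \<and> energy \<mu> q c < ground_energy \<mu> q + 1 / real (Suc n)" for n
  proof (rule ccontr)
    assume "\<not> ?thesis"
    then have "ground_energy \<mu> q + 1 / real (Suc n) \<le> ground_energy \<mu> q" by (intro ground_energy_greatest) (auto simp: not_less)
    then show False by simp
  qed
  then obtain c where c: "\<And>n. H1seq (c n)" "\<And>n. nsq (c n) = 1" "\<And>n. energy \<mu> q (c n) < ground_energy \<mu> q + 1 / real (Suc n)"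
    by metis
  have "(\<lambda>n. ground_energy \<mu> q + 1 / real (Suc n)) \<longlonglongrightarrow> ground_energy \<mu> q + 0"
    by (intro tendsto_intros LIMSEQ_Suc[OF lim_1_over_n])
  then have "\<exists>c'. H1seq c' \<and> nsq c' = 1 \<and> energy \<mu> q c' \<le> ground_energy \<mu> q + 0"
    by (rule energy_limit[where \<mu> = "\<lambda>_. \<mu>", OF assms assms order_refl weak_limit_const c(1,2) less_imp_le[OF c(3)]])
  then obtain c' where c': "H1seq c'" "nsq c' = 1" "energy \<mu> q c' \<le> ground_energy \<mu> q" by auto
  then have "energy \<mu> q c' = ground_energy \<mu> q" using ground_energy_le[of c' \<mu> q] by simp
  then show ?thesis using that c' by blast
qed

lemma ground_energy_scaled:
  assumes c: "H1seq c"
  shows "ground_energy \<mu> q * nsq c \<le> energy \<mu> q c"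
proof (cases "nsq c = 0")
  case True
  then show ?thesis using energy_nonneg by simp
next
  case False
  have n: "nsq c > 0" using False unfolding nsq_def by (simp add: infsum_nonneg order_less_le)
  define t where "t = 1 / sqrt (nsq c)"
  have t2: "t\<^sup>2 = 1 / nsq c" using n by (simp add: t_def power_divide)
  define d where "d k = of_real t * c k" for k
  have d2: "(cmod (d k))\<^sup>2 = t\<^sup>2 * (cmod (c k))\<^sup>2" for k by (simp add: d_def norm_mult power_mult_distrib)
  have pull: "(\<Sum>\<^sub>\<infinity>k. a k * (cmod (d k))\<^sup>2) = t\<^sup>2 * (\<Sum>\<^sub>\<infinity>k. a k * (cmod (c k))\<^sup>2)" for a :: "int \<Rightarrow> real"
    unfolding d2 by (subst infsum_cmult_right'[symmetric]) (simp add: mult_ac)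
  have "(\<lambda>k. t\<^sup>2 * ((1 + (real_of_int k)\<^sup>2) * (cmod (c k))\<^sup>2)) summable_on UNIV"
    using c unfolding H1seq_def by (rule summable_on_cmult_right)
  then have Hd: "H1seq d" unfolding H1seq_def d2 by (simp add: mult_ac)
  have "nsq d = t\<^sup>2 * nsq c" using pull[of "\<lambda>_. 1"] by (simp add: nsq_def)
  then have nd: "nsq d = 1" using t2 n by simp
  have detuning: "kin q d = t\<^sup>2 * kin q c" using pull by (simp add: kin_def)
  have "fsum d x = of_real t * fsum c x" for x
    unfolding fsum_def d_def by (subst infsum_cmult_right'[symmetric]) (simp add: mult_ac)
  then have "energy \<mu> q d = t\<^sup>2 * energy \<mu> q c"
    by (simp add: energy_def detuning norm_mult power_mult_distrib distrib_left)
  then have "ground_energy \<mu> q \<le> energy \<mu> q c / nsq c" using ground_energy_le[OF Hd nd, of \<mu> q] t2 by simp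
  then show ?thesis using n by (simp add: le_divide_eq)
qed

text \<open>
  A fixed ground state of the limit gives the upper bound. For the lower bound, ground states of the
  approximating measures accumulate at a competitor for the limit, by \<open>energy_limit\<close>.
\<close>

lemma ground_energy_weak_limit:
  assumes \<mu>: "\<And>n. finite_borel (\<mu> n)" "finite_borel \<mu>'" and M: "\<And>n. measure (\<mu> n) UNIV \<le> M" and w: "weak_limit \<mu> \<mu>'"
  shows "(\<lambda>n. ground_energy (\<mu> n) q) \<longlonglongrightarrow> ground_energy \<mu>' q"
proof (rule order_tendstoI)
  fix a assume a: "ground_energy \<mu>' q < a"
  obtain c where c: "H1seq c" "nsq c = 1" "energy \<mu>' q c = ground_energy \<mu>' q" by (rule ground_energy_attained[OF \<mu>(2)])
  have "cper (\<lambda>x. (cmod (fsum c x))\<^sup>2)" by (intro cper_intros H1seq_cper c)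
  then have "(\<lambda>n. energy (\<mu> n) q c) \<longlonglongrightarrow> energy \<mu>' q c"
    using w unfolding energy_def weak_limit_def by (intro tendsto_intros) blast
  then have "eventually (\<lambda>n. energy (\<mu> n) q c < a) sequentially" using a c(3) by (intro order_tendstoD(2)) auto
  then show "eventually (\<lambda>n. ground_energy (\<mu> n) q < a) sequentially"
    by eventually_elim (use ground_energy_le[OF c(1,2)] in \<open>meson le_less_trans\<close>)
next
  fix a assume a: "a < ground_energy \<mu>' q"
  show "eventually (\<lambda>n. a < ground_energy (\<mu> n) q) sequentially"
  proof (rule ccontr)
    assume "\<not> ?thesis"
    then have "\<exists>\<^sub>F n in sequentially. ground_energy (\<mu> n) q \<le> a" by (simp add: frequently_def not_le)
    then have "infinite {n. ground_energy (\<mu> n) q \<le> a}"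
      unfolding cofinite_eq_sequentially[symmetric] frequently_cofinite .
    from infinite_enumerate[OF this] obtain r where "strict_mono (r :: nat \<Rightarrow> nat) \<and> (\<forall>n. r n \<in> {n. ground_energy (\<mu> n) q \<le> a})"
      by blast
    then have r: "strict_mono r" "\<And>n. ground_energy (\<mu> (r n)) q \<le> a" by auto
    have "\<exists>c. H1seq c \<and> nsq c = 1 \<and> energy (\<mu> (r n)) q c = ground_energy (\<mu> (r n)) q" for n
      using ground_energy_attained[OF \<mu>(1)] by metis
    then obtain c where c: "\<And>n. H1seq (c n)" "\<And>n. nsq (c n) = 1" "\<And>n. energy (\<mu> (r n)) q (c n) = ground_energy (\<mu> (r n)) q" by metis
    have "\<exists>c'. H1seq c' \<and> nsq c' = 1 \<and> energy \<mu>' q c' \<le> a"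
      by (rule energy_limit[where c = c and M = M and e = "\<lambda>_. a", OF _ \<mu>(2) _ weak_limit_subseq[OF w r(1)] c(1,2)])
         (use \<mu> M c r in auto)
    then show False using ground_energy_le a by (meson not_le order_trans)
  qed
qed

text \<open>
  For a fixed state, \<open>kin q c\<close> is \<open>q\<^sup>2 * nsq c\<close> plus an affine function of \<open>q\<close>. Hence
  \<open>q\<^sup>2 - ground_energy \<mu> q\<close> is a supremum of affine functions, thus convex, thus continuous.
\<close>

lemma ground_energy_continuous:
  assumes "finite_borel \<mu>"
  shows "continuous_on UNIV (ground_energy \<mu>)"
proof -
  have "convex_on UNIV (\<lambda>q. q\<^sup>2 - ground_energy \<mu> q)"
  proof (rule convex_onI)
    fix t x y :: real assume t: "0 < t" "t < 1"
    define z where "z = (1 - t) * x + t * y"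
    obtain c where c: "H1seq c" "nsq c = 1" "energy \<mu> z c = ground_energy \<mu> z" by (rule ground_energy_attained[OF assms])
    define S where "S q = (\<Sum>\<^sub>\<infinity>k. (of_int k + q)\<^sup>2 * (cmod (c k))\<^sup>2)" for q
    define N where "N = (\<Sum>\<^sub>\<infinity>k. (cmod (c k))\<^sup>2)"
    have "((\<lambda>k. (1 - t) * ((of_int k + x)\<^sup>2 * (cmod (c k))\<^sup>2) + t * ((of_int k + y)\<^sup>2 * (cmod (c k))\<^sup>2) + (z\<^sup>2 - (1 - t) * x\<^sup>2 - t * y\<^sup>2) * (cmod (c k))\<^sup>2)
       has_sum ((1 - t) * S x + t * S y + (z\<^sup>2 - (1 - t) * x\<^sup>2 - t * y\<^sup>2) * N)) UNIV"
      unfolding S_def N_def by (intro has_sum_add has_sum_cmult_right has_sum_infsum kin_summable nsq_summable c)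
    moreover have "(1 - t) * ((of_int k + x)\<^sup>2 * (cmod (c k))\<^sup>2) + t * ((of_int k + y)\<^sup>2 * (cmod (c k))\<^sup>2) + (z\<^sup>2 - (1 - t) * x\<^sup>2 - t * y\<^sup>2) * (cmod (c k))\<^sup>2
       = (of_int k + z)\<^sup>2 * (cmod (c k))\<^sup>2" for k
      unfolding z_def by (simp add: power2_eq_square algebra_simps)
    ultimately have "S z = (1 - t) * S x + t * S y + (z\<^sup>2 - (1 - t) * x\<^sup>2 - t * y\<^sup>2) * N"
      unfolding S_def[of z] by (simp add: infsumI)
    then have "2 * pi * S z = 2 * pi * ((1 - t) * S x + t * S y + (z\<^sup>2 - (1 - t) * x\<^sup>2 - t * y\<^sup>2) * N)"
      by (simp only:)
    also have "\<dots> = (1 - t) * (2 * pi * S x) + t * (2 * pi * S y) + (z\<^sup>2 - (1 - t) * x\<^sup>2 - t * y\<^sup>2) * (2 * pi * N)"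
      by (simp add: algebra_simps)
    finally have "kin z c = (1 - t) * kin x c + t * kin y c + (z\<^sup>2 - (1 - t) * x\<^sup>2 - t * y\<^sup>2)"
      using c(2) by (simp add: kin_def nsq_def S_def N_def)
    then have "ground_energy \<mu> z = (1 - t) * energy \<mu> x c + t * energy \<mu> y c + (z\<^sup>2 - (1 - t) * x\<^sup>2 - t * y\<^sup>2)"
      unfolding c(3)[symmetric] energy_def by (simp add: algebra_simps)
    moreover have "(1 - t) * ground_energy \<mu> x \<le> (1 - t) * energy \<mu> x c" "t * ground_energy \<mu> y \<le> t * energy \<mu> y c"
      using t ground_energy_le[OF c(1,2)] by (auto intro!: mult_left_mono)
    ultimately have "z\<^sup>2 - ground_energy \<mu> z \<le> (1 - t) * (x\<^sup>2 - ground_energy \<mu> x) + t * (y\<^sup>2 - ground_energy \<mu> y)"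
      by (simp add: right_diff_distrib)
    then show "((1 - t) *\<^sub>R x + t *\<^sub>R y)\<^sup>2 - ground_energy \<mu> ((1 - t) *\<^sub>R x + t *\<^sub>R y) \<le> (1 - t) * (x\<^sup>2 - ground_energy \<mu> x) + t * (y\<^sup>2 - ground_energy \<mu> y)"
      by (simp add: z_def)
  qed simp
  then have "continuous_on UNIV (\<lambda>q. q\<^sup>2 - ground_energy \<mu> q)" by (intro convex_on_continuous) auto
  from continuous_on_diff[OF continuous_on_power[OF continuous_on_id] this, of 2]
  show ?thesis by simp
qed

section \<open>Weak compactness of bounded measures on the cell\<close>

lemma density_const:
  assumes \<mu>: "finite_borel \<mu>" and a: "a \<ge> 0"
  shows "finite_borel (density \<mu> (\<lambda>_. ennreal a))" "measure (density \<mu> (\<lambda>_. ennreal a)) UNIV = a * measure \<mu> UNIV"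
    "cper \<phi> \<Longrightarrow> (\<integral>x. \<phi> x \<partial>density \<mu> (\<lambda>_. ennreal a)) = a * (\<integral>x. (\<phi> x :: real) \<partial>\<mu>)"
proof -
  interpret finite_measure \<mu> using \<mu> by (simp add: finite_borel_def)
  have s: "sets \<mu> = sets borel" using \<mu> by (simp add: finite_borel_def)
  have [measurable_cong]: "sets \<mu> = sets borel" by fact
  have U: "UNIV \<in> sets \<mu>" using s by simp
  have e: "emeasure (density \<mu> (\<lambda>_. ennreal a)) UNIV = ennreal a * emeasure \<mu> UNIV"
    using U by (subst emeasure_density) (auto simp: finite_borel_space[OF \<mu>])
  then have e': "emeasure (density \<mu> (\<lambda>_. ennreal a)) UNIV = ennreal (a * measure \<mu> UNIV)"
    using a by (simp add: emeasure_eq_measure ennreal_mult'')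
  show "finite_borel (density \<mu> (\<lambda>_. ennreal a))"
    unfolding finite_borel_def using s e' by (auto intro!: finite_measureI simp: finite_borel_space[OF \<mu>])
  show "measure (density \<mu> (\<lambda>_. ennreal a)) UNIV = a * measure \<mu> UNIV"
    using e' a by (simp add: measure_def[of "density \<mu> _"])
  show "(\<integral>x. \<phi> x \<partial>density \<mu> (\<lambda>_. ennreal a)) = a * (\<integral>x. \<phi> x \<partial>\<mu>)" if "cper \<phi>"
    using a cper_measurable[OF that] by (subst integral_density) auto
qed

text \<open>
  Normalise to probability measures, which are tight because they live on the bounded cell; Helly's
  selection theorem gives a weakly convergent subsequence, and the masses converge along a further
  one. The limit is a measure on the closed cell and may charge the endpoint \<open>\<pi>\<close>.
\<close>

lemma weak_compactness:
  assumes \<mu>: "\<And>n. finite_borel (\<mu> n)" and M: "\<And>n. measure (\<mu> n) UNIV \<le> M" and supp: "\<And>n. emeasure (\<mu> n) (- cell) = 0"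
  shows "\<exists>r \<mu>'. strict_mono (r :: nat \<Rightarrow> nat) \<and> finite_borel \<mu>' \<and> weak_limit (\<mu> \<circ> r) \<mu>'"
proof -
  define m where "m n = measure (\<mu> n) UNIV" for n
  have m: "0 \<le> m n" "m n \<le> M" for n using M by (auto simp: m_def)
  have "\<forall>n. m n \<in> {0..M}" using m by simp
  then obtain L r1 where L: "L \<in> {0..M}" "strict_mono (r1 :: nat \<Rightarrow> nat)" "(m \<circ> r1) \<longlonglongrightarrow> L"
    using compact_Icc[of 0 M] unfolding compact_def by blast
  \<comment> \<open>A zero measure cannot be normalised; any probability measure may stand in for it, since it is
    multiplied by the mass \<open>0\<close> afterwards.\<close>
  define N where "N n = (if m n = 0 then return borel 0 else density (\<mu> n) (\<lambda>_. ennreal (1 / m n)))" for n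
  have sN: "sets (N n) = sets borel" for n using \<mu>[of n] by (simp add: N_def finite_borel_def)
  have fN: "finite_borel (N n)" and mN: "measure (N n) UNIV = 1" for n
  proof -
    have "finite_borel (return borel (0::real))" "measure (return borel (0::real)) UNIV = 1"
      using prob_space_return[of 0 "borel :: real measure"] prob_space.prob_space[OF prob_space_return[of 0 "borel :: real measure"]]
      by (auto simp: finite_borel_def prob_space_def)
    then show "finite_borel (N n)" "measure (N n) UNIV = 1"
      using density_const(1,2)[OF \<mu>[of n], of "1 / m n"] m(1)[of n] by (auto simp: N_def m_def)
  qed
  have rd: "real_distribution (N n)" for n
  proof -
    have "emeasure (N n) (space (N n)) = 1"
      using fN[of n] mN[of n] by (simp add: finite_borel_space finite_borel_def finite_measure.emeasure_eq_measure)
    then show ?thesis by (auto simp: real_distribution_def real_distribution_axioms_def sN intro: prob_spaceI)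
  qed
  have "measure (N n) {-4<..4} = 1" for n
  proof -
    have "cell \<subseteq> {-4<..4}" using pi_less_4 by (auto simp: cell_def)
    then have "emeasure (\<mu> n) (- {-4<..4}) = 0"
      using emeasure_mono[of "- {-4<..4}" "- cell" "\<mu> n"] supp[of n] \<mu>[of n] by (auto simp: finite_borel_def)
    then have "AE x in \<mu> n. x \<in> {-4<..4}"
      using \<mu>[of n] by (intro AE_I[where N = "- {-4<..4}"]) (auto simp: finite_borel_def)
    then have "AE x in N n. x \<in> {-4<..4}"
      using \<mu>[of n] unfolding N_def finite_borel_def by (auto simp: AE_density AE_return elim!: eventually_mono)
    then show ?thesis
      using prob_space.prob_eq_1[of "N n" "{-4<..4}"] rd[of n] sN[of n] by (simp add: real_distribution_def)
  qed
  then have "\<exists>a b. a < b \<and> (\<forall>n. 1 - \<epsilon> < measure (N n) {a<..b})" if "\<epsilon> > 0" for \<epsilon> :: real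
    using that by (intro exI[of _ "-4"] exI[of _ 4]) simp
  then have "tight N" unfolding tight_def using rd by blast
  then obtain r2 P where r2: "strict_mono (r2 :: nat \<Rightarrow> nat)" and P: "real_distribution P" and w: "weak_conv_m (N \<circ> r1 \<circ> r2) P"
    using tight_imp_convergent_subsubsequence[OF _ L(2), of N] by blast
  have fP: "finite_borel P" using P by (auto simp: finite_borel_def real_distribution_def prob_space_def real_distribution_axioms_def)
  define r where "r = r1 \<circ> r2"
  have r: "strict_mono r" unfolding r_def by (rule strict_mono_o[OF L(2) r2])
  have mr: "(\<lambda>n. m (r n)) \<longlonglongrightarrow> L" using LIMSEQ_subseq_LIMSEQ[OF L(3) r2] by (simp add: r_def o_def)
  define \<mu>' where "\<mu>' = density P (\<lambda>_. ennreal L)"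
  have L0: "L \<ge> 0" using L(1) by simp
  have "(\<lambda>n. \<integral>x. \<phi> x \<partial>(\<mu> \<circ> r) n) \<longlonglongrightarrow> (\<integral>x. \<phi> x \<partial>\<mu>')" if \<phi>: "cper \<phi>" for \<phi> :: "real \<Rightarrow> real"
  proof -
    obtain B where B: "\<And>x. norm (\<phi> x) \<le> B" using cper_bounded[OF \<phi>] by blast
    have \<phi>c: "isCont \<phi> x" for x using \<phi> by (simp add: cper_def continuous_on_eq_continuous_at)
    have "(\<lambda>n. \<integral>x. \<phi> x \<partial>(N \<circ> r1 \<circ> r2) n) \<longlonglongrightarrow> (\<integral>x. \<phi> x \<partial>P)"
      by (rule weak_conv_imp_integral_bdd_continuous_conv[OF _ P w \<phi>c B]) (simp add: rd)
    then have "(\<lambda>n. m (r n) * (\<integral>x. \<phi> x \<partial>N (r n))) \<longlonglongrightarrow> L * (\<integral>x. \<phi> x \<partial>P)"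
      by (intro tendsto_mult mr) (simp add: r_def o_def)
    moreover have "m n * (\<integral>x. \<phi> x \<partial>N n) = (\<integral>x. \<phi> x \<partial>\<mu> n)" for n
    proof (cases "m n = 0")
      case True
      then have "\<bar>\<integral>x. \<phi> x \<partial>\<mu> n\<bar> \<le> 0"
        using finite_borel_integral_bound[OF \<mu>[of n] \<phi>, of B] B by (simp add: m_def)
      then show ?thesis using True by simp
    next
      case False
      then show ?thesis using density_const(3)[OF \<mu>[of n] _ \<phi>, of "1 / m n"] m(1)[of n] by (simp add: N_def)
    qed
    ultimately show ?thesis using density_const(3)[OF fP L0 \<phi>] by (simp add: \<mu>'_def)
  qed
  then have "weak_limit (\<mu> \<circ> r) \<mu>'" by (simp add: weak_limit_def)
  moreover have "finite_borel \<mu>'" unfolding \<mu>'_def by (rule density_const(1)[OF fP L0])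
  ultimately show ?thesis using r by blast
qed

section \<open>Large mass flattens the band\<close>

text \<open>
  The remainder of \<open>z\<close> after subtracting its nearest point in the disc of radius \<open>s\<close>: it vanishes
  on the disc and lowers the modulus by \<open>s\<close> outside.
\<close>

definition shrink :: "real \<Rightarrow> complex \<Rightarrow> complex"
  where "shrink s z = (if cmod z \<le> s then 0 else of_real (1 - s / cmod z) * z)"

lemma shrink_rotate: "cmod w = 1 \<Longrightarrow> shrink s (w * z) = w * shrink s z"
  by (simp add: shrink_def norm_mult)

lemma norm_shrink:
  assumes "s \<ge> 0"
  shows "cmod (shrink s z) = max 0 (cmod z - s)"
proof (cases "cmod z \<le> s")
  case False
  then have z: "cmod z > 0" using assms by linarith
  then have "s / cmod z \<le> 1" using False by simp
  then have "cmod (shrink s z) = (1 - s / cmod z) * cmod z" using False by (simp add: shrink_def norm_mult del: of_real_diff)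
  also have "\<dots> = cmod z - s" using z by (simp add: left_diff_distrib)
  finally show ?thesis using False by simp
qed (simp add: shrink_def)

text \<open>
  The obtuse-angle characterisation of the projection \<open>z - shrink s z\<close> onto the disc.
\<close>

lemma shrink_projection:
  assumes s: "s \<ge> 0" and y: "cmod y \<le> s"
  shows "inner (shrink s z) (y - (z - shrink s z)) \<le> 0"
proof (cases "cmod z \<le> s")
  case False
  then have z: "cmod z > 0" using s by linarith
  define t where "t = s / cmod z"
  have t: "0 \<le> t" "t \<le> 1" using False s z by (auto simp: t_def)
  have T: "shrink s z = (1 - t) *\<^sub>R z" using False by (simp add: shrink_def t_def scaleR_conv_of_real)
  have "z - shrink s z = t *\<^sub>R z" unfolding T by (simp add: scaleR_left_diff_distrib)
  then have "inner (shrink s z) (y - (z - shrink s z)) = (1 - t) * (inner z y - t * (cmod z)\<^sup>2)"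
    unfolding T by (simp add: inner_diff_right power2_norm_eq_inner algebra_simps)
  moreover have "inner z y \<le> t * (cmod z)\<^sup>2"
  proof -
    have "inner z y \<le> cmod z * cmod y" by (rule norm_cauchy_schwarz)
    also have "\<dots> \<le> cmod z * s" using y by (intro mult_left_mono) auto
    also have "\<dots> = t * (cmod z)\<^sup>2" using z by (simp add: t_def power2_eq_square)
    finally show ?thesis .
  qed
  ultimately show ?thesis using t by (simp add: mult_nonneg_nonpos)
qed (simp add: shrink_def)

text \<open>
  Adding the two obtuse-angle inequalities shows that the increments of \<open>shrink s\<close> and of the projection have
  nonnegative inner product; so the increment of their sum, the identity, is at least as long as
  that of \<open>shrink s\<close>.
\<close>

lemma shrink_nonexpansive:
  assumes s: "s \<ge> 0"
  shows "cmod (shrink s z - shrink s w) \<le> cmod (z - w)"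
proof -
  define P where "P z = z - shrink s z" for z
  have P: "cmod (P z) \<le> s" for z
  proof (cases "cmod z \<le> s")
    case False
    then have z: "cmod z > 0" using s by linarith
    then have "P z = of_real (s / cmod z) * z" using False by (simp add: P_def shrink_def left_diff_distrib)
    then have "cmod (P z) = s" using z s by (simp add: norm_mult norm_divide)
    then show ?thesis by simp
  qed (simp add: P_def shrink_def)
  define a where "a = shrink s z - shrink s w"
  define p where "p = P z - P w"
  have "inner a p \<ge> 0"
    using shrink_projection[OF s P, of z w] shrink_projection[OF s P, of w z]
    unfolding a_def p_def P_def[symmetric] by (simp add: inner_diff_left inner_diff_right)
  moreover have "z - w = a + p" by (simp add: a_def p_def P_def)
  ultimately have "(cmod a)\<^sup>2 \<le> (cmod (z - w))\<^sup>2"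
    by (simp add: power2_norm_eq_inner inner_add_left inner_add_right inner_commute)
  then show ?thesis unfolding a_def by (simp add: power2_le_iff_abs_le)
qed

text \<open>
  The representative of \<open>x - x0\<close> modulo \<open>2 \<pi>\<close> in \<open>[0, 2 \<pi>)\<close>, with its jump at \<open>x0\<close>.
\<close>

definition sawtooth :: "real \<Rightarrow> real \<Rightarrow> real"
  where "sawtooth x0 x = x - x0 - 2 * pi * of_int \<lfloor>(x - x0) / (2 * pi)\<rfloor>"

lemma sawtooth_periodic: "sawtooth x0 (x + 2 * pi) = sawtooth x0 x"
proof -
  have "(x + 2 * pi - x0) / (2 * pi) = (x - x0) / (2 * pi) + 1" by (simp add: field_simps)
  then show ?thesis by (simp add: sawtooth_def algebra_simps)
qed

text \<open>
  The factor \<open>cis (- (q' - q) * sawtooth x0 x)\<close> turns the operator \<open>-i d/dx + q'\<close> into \<open>-i d/dx + q\<close>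
  except at its jump, and shrinking does not increase differences. The jump does no harm,
  because \<open>|v| < s\<close> near \<open>x0\<close> makes the shrunken function vanish there.
\<close>

lemma twist_admissible:
  fixes q q' :: real
  assumes c: "H1seq c" and s: "s > 0" and x0: "cmod (fsum c x0) < s"
  defines "w \<equiv> \<lambda>x. cis (- (q' - q) * sawtooth x0 x) * shrink s (fsum c x)"
  shows "cper w" "H1seq (fc w)" "kin q' (fc w) \<le> kin q c"
proof -
  let ?v = "fsum c"
  have cv: "cper ?v" by (rule H1seq_cper[OF c])
  have s0: "s \<ge> 0" using s by simp
  have iv: "isCont ?v x" for x using cv by (simp add: cper_def continuous_on_eq_continuous_at)
  have pv: "?v (x0 + 2 * pi * of_int m) = ?v x0" for m using periodic_int[of ?v x0 m] cv by (simp add: cper_def)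
  have pv': "?v (x + 2 * pi * of_int m) = ?v x" for m x using periodic_int[of ?v x m] cv by (simp add: cper_def)
  have iT: "isCont (shrink s) z" for z
    using shrink_nonexpansive[OF s0] unfolding continuous_at_eps_delta dist_norm
    by (meson le_less_trans)
  have zero: "w x = 0" if "cmod (?v x) \<le> s" for x using that by (simp add: w_def shrink_def)
  have "isCont w x" for x
  proof (cases "cmod (?v x) < s")
    case True
    have "isCont (\<lambda>x. cmod (?v x)) x" using iv by (intro continuous_intros)
    then have "(\<lambda>x. cmod (?v x)) \<midarrow>x\<rightarrow> cmod (?v x)" by (simp add: isCont_def)
    from tendsto_compose_filtermap order_tendstoD(2)[OF this True]
    have "eventually (\<lambda>y. cmod (?v y) < s) (at x)" by simp
    then have "eventually (\<lambda>y. cmod (?v y) < s) (nhds x)" using True by (simp add: eventually_nhds_conv_at)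
    then have "eventually (\<lambda>y. w y = 0) (nhds x)" by eventually_elim (rule zero, simp)
    from isCont_cong[OF this] show ?thesis by simp
  next
    case False
    define n where "n = \<lfloor>(x - x0) / (2 * pi)\<rfloor>"
    have ne: "x \<noteq> x0 + 2 * pi * of_int n" using False x0 pv[of n] by auto
    have "of_int n \<le> (x - x0) / (2 * pi)" "(x - x0) / (2 * pi) < of_int n + 1" unfolding n_def by linarith+
    then have "of_int n * (2 * pi) \<le> x - x0" "x - x0 < (of_int n + 1) * (2 * pi)"
      by (simp_all only: pos_le_divide_eq pos_divide_less_eq pi_gt_zero mult_pos_pos zero_less_numeral)
    then have x: "x \<in> {x0 + 2 * pi * of_int n<..<x0 + 2 * pi * (of_int n + 1)}" using ne by (auto simp: algebra_simps)
    have "eventually (\<lambda>y. y \<in> {x0 + 2 * pi * of_int n<..<x0 + 2 * pi * (of_int n + 1)}) (nhds x)"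
      using x by (intro eventually_nhds_in_open) auto
    then have ev: "eventually (\<lambda>y. w y = cis (- (q' - q) * (y - x0 - 2 * pi * of_int n)) * shrink s (?v y)) (nhds x)"
    proof eventually_elim
      case (elim y)
      then have "of_int n * (2 * pi) \<le> y - x0" "y - x0 < (of_int n + 1) * (2 * pi)" by (auto simp: algebra_simps)
      then have "of_int n \<le> (y - x0) / (2 * pi)" "(y - x0) / (2 * pi) < of_int n + 1"
        by (simp_all only: pos_le_divide_eq pos_divide_less_eq pi_gt_zero mult_pos_pos zero_less_numeral)
      then have "\<lfloor>(y - x0) / (2 * pi)\<rfloor> = n" by linarith
      then show ?case by (simp add: w_def sawtooth_def)
    qed
    have "isCont (\<lambda>y. cis (- (q' - q) * (y - x0 - 2 * pi * of_int n))) x"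
    proof -
      have "continuous_on UNIV (\<lambda>y. cis (- (q' - q) * (y - x0 - 2 * pi * of_int n)))"
        by (intro continuous_intros)
      then show ?thesis by (simp add: continuous_on_eq_continuous_at)
    qed
    then have "isCont (\<lambda>y. cis (- (q' - q) * (y - x0 - 2 * pi * of_int n)) * shrink s (?v y)) x"
      by (rule continuous_mult[OF _ isCont_o2[OF iv iT]])
    then show ?thesis by (simp only: isCont_cong[OF ev])
  qed
  then have "continuous_on UNIV w" by (simp add: continuous_at_imp_continuous_on)
  moreover have "w (x + 2 * pi) = w x" for x
    using cv by (simp add: w_def sawtooth_periodic cper_def periodic_def)
  ultimately show cw: "cper w" by (simp add: cper_def periodic_def)
  have "(\<lambda>x. cmod (?v x)) \<midarrow>x0\<rightarrow> cmod (?v x0)" using iv[of x0] by (intro tendsto_norm) (simp add: isCont_def)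
  from order_tendstoD(2)[OF this x0] obtain r where r: "r > 0" "\<And>y. y \<noteq> x0 \<Longrightarrow> \<bar>y - x0\<bar> < r \<Longrightarrow> cmod (?v y) < s"
    by (auto simp: eventually_at dist_real_def)
  have near: "cmod (?v (y + 2 * pi * of_int m)) < s" if "\<bar>y - x0\<bar> < r" for y m
    using r(2)[of y] that x0 pv' by (cases "y = x0") auto
  \<comment> \<open>If no jump lies between \<open>x\<close> and \<open>x + h\<close>, the phases combine exactly and \<open>shrink\<close> commutes with them;
    otherwise both points are within \<open>r\<close> of a translate of \<open>x0\<close>, where \<open>w\<close> vanishes.\<close>
  have le: "cmod (cis (q' * h) * w (x + h) - w x) \<le> 1 * cmod (cis (q * h) * ?v (x + h) - ?v x)" if h: "0 < h" "h < r" for h x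
  proof (cases "\<lfloor>(x + h - x0) / (2 * pi)\<rfloor> = \<lfloor>(x - x0) / (2 * pi)\<rfloor>")
    case True
    define y where "y = sawtooth x0 x"
    have "sawtooth x0 (x + h) = y + h" using True by (simp add: sawtooth_def y_def)
    then have wh: "w (x + h) = cis (- (q' - q) * (y + h)) * shrink s (?v (x + h))" by (simp add: w_def)
    have wx: "w x = cis (- (q' - q) * y) * shrink s (?v x)" by (simp add: w_def y_def)
    have "cis (q' * h) * cis (- (q' - q) * (y + h)) = cis (- (q' - q) * y) * cis (q * h)"
      by (simp add: cis_mult algebra_simps)
    then have "cis (q' * h) * w (x + h) - w x = cis (- (q' - q) * y) * (cis (q * h) * shrink s (?v (x + h)) - shrink s (?v x))"
      unfolding wh wx by (simp add: right_diff_distrib mult.assoc[symmetric])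
    also have "\<dots> = cis (- (q' - q) * y) * (shrink s (cis (q * h) * ?v (x + h)) - shrink s (?v x))"
      by (simp add: shrink_rotate)
    finally show ?thesis using shrink_nonexpansive[OF s0] by (simp add: norm_mult)
  next
    case False
    define m where "m = \<lfloor>(x + h - x0) / (2 * pi)\<rfloor>"
    have "(x - x0) / (2 * pi) \<le> (x + h - x0) / (2 * pi)" using h by (simp add: divide_right_mono)
    then have "\<lfloor>(x - x0) / (2 * pi)\<rfloor> < m" using False floor_mono[of "(x - x0) / (2 * pi)" "(x + h - x0) / (2 * pi)"] by (simp add: m_def)
    then have "(x - x0) / (2 * pi) < of_int m" "of_int m \<le> (x + h - x0) / (2 * pi)" by (simp add: floor_less_iff, simp add: m_def)
    then have "x - x0 < of_int m * (2 * pi)" "of_int m * (2 * pi) \<le> x + h - x0"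
      by (simp_all only: pos_le_divide_eq pos_divide_less_eq pi_gt_zero mult_pos_pos zero_less_numeral)
    then have "\<bar>(x - 2 * pi * of_int m) - x0\<bar> < r" "\<bar>(x + h - 2 * pi * of_int m) - x0\<bar> < r"
      using h by (auto simp: abs_less_iff algebra_simps)
    from near[OF this(1), of m] near[OF this(2), of m] have "w x = 0" "w (x + h) = 0" by (auto intro!: zero)
    then show ?thesis by simp
  qed
  show "H1seq (fc w)" "kin q' (fc w) \<le> kin q c"
    using kin_comparison[OF c cw r(1) le] by simp_all
qed

text \<open>
  If the ground state \<open>v\<close> at \<open>q\<close> satisfied \<open>s \<le> |v|\<close> everywhere, its potential energy would be at least
  \<open>s\<^sup>2\<close> times the mass; so it is smaller than \<open>s\<close> at some point, and \<open>twist_admissible\<close> applies. The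
  competitor at \<open>q'\<close> has no more energy, and its squared norm is at least
  \<open>\<integral> ((1 - s) |v|\<^sup>2 - s) = 1 - s (2 \<pi> + 1)\<close>.
\<close>

lemma ground_energy_flat:
  assumes \<mu>: "finite_borel \<mu>" and s: "s > 0" and M: "ground_energy \<mu> q < s\<^sup>2 * measure \<mu> UNIV"
  shows "ground_energy \<mu> q' * (1 - s * (2 * pi + 1)) \<le> ground_energy \<mu> q"
proof -
  interpret finite_measure \<mu> using \<mu> by (simp add: finite_borel_def)
  obtain c where c: "H1seq c" "nsq c = 1" "energy \<mu> q c = ground_energy \<mu> q" by (rule ground_energy_attained[OF \<mu>])
  let ?v = "fsum c"
  have cv: "cper ?v" by (rule H1seq_cper[OF c(1)])
  have cv2: "cper (\<lambda>x. (cmod (?v x))\<^sup>2)" by (intro cper_intros cv)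
  have s0: "s \<ge> 0" using s by simp
  have "\<exists>x0. cmod (?v x0) < s"
  proof (rule ccontr)
    assume "\<not> ?thesis"
    then have "s \<le> cmod (?v x)" for x by (simp add: not_less)
    then have "s\<^sup>2 \<le> (cmod (?v x))\<^sup>2" for x using s0 by (intro power_mono)
    then have "(\<integral>x. s\<^sup>2 \<partial>\<mu>) \<le> (\<integral>x. (cmod (?v x))\<^sup>2 \<partial>\<mu>)"
      by (intro integral_mono finite_borel_integrable[OF \<mu> cv2]) auto
    moreover have "(\<integral>x. s\<^sup>2 \<partial>\<mu>) = s\<^sup>2 * measure \<mu> UNIV" by (simp add: finite_borel_space[OF \<mu>] mult.commute)
    moreover have "(\<integral>x. (cmod (?v x))\<^sup>2 \<partial>\<mu>) \<le> ground_energy \<mu> q"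
      unfolding c(3)[symmetric] energy_def using kin_nonneg[of q c] by simp
    ultimately show False using M by linarith
  qed
  then obtain x0 where x0: "cmod (?v x0) < s" by blast
  define w where "w = (\<lambda>x. cis (- (q' - q) * sawtooth x0 x) * shrink s (?v x))"
  have w: "cper w" "H1seq (fc w)" "kin q' (fc w) \<le> kin q c"
    unfolding w_def by (rule twist_admissible[OF c(1) s x0])+
  have we: "fsum (fc w) = w" by (rule H1seq_expansion[OF w(1,2), symmetric])
  have wn: "cmod (w x) = max 0 (cmod (?v x) - s)" for x
    by (simp add: w_def norm_mult norm_shrink[OF s0])
  have w2: "cper (\<lambda>x. (cmod (w x))\<^sup>2)" by (intro cper_intros w)
  have up: "(cmod (w x))\<^sup>2 \<le> (cmod (?v x))\<^sup>2" for x
    unfolding wn using s0 by (intro power_mono) auto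
  have lo: "(1 - s) * (cmod (?v x))\<^sup>2 - s \<le> (cmod (w x))\<^sup>2" for x
  proof -
    define t where "t = cmod (?v x)"
    have t: "2 * t \<le> t\<^sup>2 + 1" using sum_squares_bound[of t 1] by simp
    then have t': "s * (2 * t) \<le> s * (t\<^sup>2 + 1)" using s0 by (rule mult_left_mono)
    have "t\<^sup>2 - 2 * s * t \<le> (max 0 (t - s))\<^sup>2"
    proof (cases "t \<le> s")
      case True
      have "t\<^sup>2 \<le> s * t" using True by (simp add: power2_eq_square t_def mult_right_mono)
      moreover have "0 \<le> s * t" using s0 by (simp add: t_def)
      ultimately show ?thesis using True by simp
    qed (simp add: power2_diff max_def mult.commute mult.left_commute)
    then show ?thesis using t' unfolding wn t_def[symmetric] by (simp add: algebra_simps)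
  qed
  have "energy \<mu> q' (fc w) \<le> ground_energy \<mu> q"
  proof -
    have "(\<integral>x. (cmod (w x))\<^sup>2 \<partial>\<mu>) \<le> (\<integral>x. (cmod (?v x))\<^sup>2 \<partial>\<mu>)"
      by (intro integral_mono finite_borel_integrable[OF \<mu>] w2 cv2 up)
    then show ?thesis unfolding c(3)[symmetric] energy_def we using w(3) by linarith
  qed
  moreover have "1 - s * (2 * pi + 1) \<le> nsq (fc w)"
  proof -
    have "(\<integral>x. (1 - s) * (cmod (?v x))\<^sup>2 - s \<partial>lam) \<le> (\<integral>x. (cmod (w x))\<^sup>2 \<partial>lam)"
      by (intro integral_mono finite_borel_integrable[OF finite_borel_lam] w2 cper_intros cv lo)
    moreover have "(\<integral>x. (1 - s) * (cmod (?v x))\<^sup>2 - s \<partial>lam) = (1 - s) * (\<integral>x. (cmod (?v x))\<^sup>2 \<partial>lam) - (\<integral>x. s \<partial>lam)"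
      by (subst Bochner_Integration.integral_diff) (auto intro!: finite_borel_integrable[OF finite_borel_lam] cv2)
    ultimately show ?thesis
      using c(2) unfolding nsq_integral[OF w(2)] nsq_integral[OF c(1)] we by (simp add: measure_lam algebra_simps)
  qed
  ultimately have "ground_energy \<mu> q' * (1 - s * (2 * pi + 1)) \<le> ground_energy \<mu> q' * nsq (fc w)"
    by (intro mult_left_mono ground_energy_nonneg)
  also have "\<dots> \<le> energy \<mu> q' (fc w)" by (rule ground_energy_scaled[OF w(2)])
  also have "\<dots> \<le> ground_energy \<mu> q" by fact
  finally show ?thesis .
qed

section \<open>A diagonal form with one negative entry and a rank-one perturbation\<close>

text \<open>
  The secular condition for the diagonal form with entries \<open>E i\<close> plus \<open>m\<close> times the squared modulus
  of the sum of all components, when exactly one entry \<open>E i0\<close> is negative. Write \<open>T\<close> for the sum of the positive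
  reciprocals and \<open>y\<close> for the sum of the other components. Cauchy-Schwarz gives \<open>|y|\<^sup>2 \<le> T * Y\<close> with \<open>Y\<close> the
  form on the other components, hence \<open>|a i0|\<^sup>2 \<le> (|A| + |y|)\<^sup>2 \<le> (1/m + T) (m |A|\<^sup>2 + Y)\<close>, and the hypothesis
  says that \<open>1/m + T \<le> -1 / E i0\<close>.
\<close>

lemma rank_one_form_nonneg:
  fixes E :: "'i \<Rightarrow> real" and a :: "'i \<Rightarrow> complex"
  assumes E0: "E i0 < 0" and E: "\<And>i. i \<noteq> i0 \<Longrightarrow> E i > 0"
    and hs: "((\<lambda>i. 1 / E i) has_sum \<sigma>) UNIV" and hX: "((\<lambda>i. E i * (cmod (a i))\<^sup>2) has_sum X) UNIV"
    and hA: "(a has_sum A) UNIV" and m: "m > 0" and \<sigma>: "\<sigma> \<le> - 1 / m"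
  shows "0 \<le> X + m * (cmod A)\<^sup>2"
proof -
  define T where "T = \<sigma> - 1 / E i0"
  define Y where "Y = X - E i0 * (cmod (a i0))\<^sup>2"
  define y where "y = A - a i0"
  have hT: "((\<lambda>i. 1 / E i) has_sum T) (UNIV - {i0})"
    using has_sum_Diff[OF hs has_sum_finite[of "{i0}"]] by (simp add: T_def)
  have hY: "((\<lambda>i. E i * (cmod (a i))\<^sup>2) has_sum Y) (UNIV - {i0})"
    using has_sum_Diff[OF hX has_sum_finite[of "{i0}"]] by (simp add: Y_def)
  have hy: "(a has_sum y) (UNIV - {i0})"
    using has_sum_Diff[OF hA has_sum_finite[of "{i0}"]] by (simp add: y_def)
  have T0: "T \<ge> 0" by (rule has_sum_nonneg[OF hT]) (use E in \<open>auto intro: less_imp_le\<close>)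
  have En: "0 \<le> E i * (cmod (a i))\<^sup>2" if "i \<noteq> i0" for i
    using E[OF that] by (intro mult_nonneg_nonneg) auto
  have Y0: "Y \<ge> 0" by (rule has_sum_nonneg[OF hY]) (use En in auto)
  have fin: "(cmod (sum a F))\<^sup>2 \<le> T * Y" if F: "finite F" "F \<subseteq> UNIV - {i0}" for F
  proof -
    have "(cmod (sum a F))\<^sup>2 \<le> (\<Sum>i\<in>F. cmod (a i))\<^sup>2" by (intro power_mono norm_sum) simp
    also have "\<dots> = (\<Sum>i\<in>F. (1 / sqrt (E i)) * (sqrt (E i) * cmod (a i)))\<^sup>2"
      using E F(2) by (intro arg_cong[where f = "\<lambda>t. t\<^sup>2"] sum.cong) force+
    also have "\<dots> \<le> (\<Sum>i\<in>F. (1 / sqrt (E i))\<^sup>2) * (\<Sum>i\<in>F. (sqrt (E i) * cmod (a i))\<^sup>2)"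
      by (rule Cauchy_Schwarz_ineq_sum)
    also have "\<dots> = (\<Sum>i\<in>F. 1 / E i) * (\<Sum>i\<in>F. E i * (cmod (a i))\<^sup>2)"
    proof -
      have "i \<in> F \<Longrightarrow> E i \<ge> 0" for i using E F(2) by (force intro: less_imp_le)
      then show ?thesis by (simp add: power_divide power_mult_distrib)
    qed
    also have "\<dots> \<le> T * Y"
    proof (intro mult_mono T0)
      show "(\<Sum>i\<in>F. 1 / E i) \<le> T"
        by (rule finite_sum_le_has_sum[OF hT F(1,2)]) (use E in \<open>auto intro: less_imp_le\<close>)
      show "(\<Sum>i\<in>F. E i * (cmod (a i))\<^sup>2) \<le> Y"
        by (rule finite_sum_le_has_sum[OF hY F(1,2)]) (use En in auto)
      show "0 \<le> (\<Sum>i\<in>F. E i * (cmod (a i))\<^sup>2)"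
        using En F(2) by (intro sum_nonneg) auto
    qed
    finally show ?thesis .
  qed
  have yTY: "(cmod y)\<^sup>2 \<le> T * Y"
  proof (rule tendsto_upperbound)
    show "((\<lambda>F. (cmod (sum a F))\<^sup>2) \<longlongrightarrow> (cmod y)\<^sup>2) (finite_subsets_at_top (UNIV - {i0}))"
      using hy unfolding has_sum_def by (intro tendsto_intros)
    show "eventually (\<lambda>F. (cmod (sum a F))\<^sup>2 \<le> T * Y) (finite_subsets_at_top (UNIV - {i0}))"
      by (rule eventually_finite_subsets_at_top_weakI) (rule fin)
  qed simp
  define p where "p = cmod A"
  have "cmod (a i0) \<le> p + cmod y"
    using norm_triangle_ineq4[of A y] by (simp add: y_def p_def)
  then have "(cmod (a i0))\<^sup>2 \<le> (p + cmod y)\<^sup>2" by (intro power_mono) auto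
  also have "\<dots> \<le> (1 / m + T) * (m * p\<^sup>2 + Y)"
  proof -
    have "cmod y \<le> sqrt (T * Y)" using yTY by (rule real_le_rsqrt)
    then have "2 * p * cmod y \<le> 2 * p * sqrt (T * Y)" by (intro mult_left_mono) (auto simp: p_def)
    also have "\<dots> = 2 * (sqrt (m * T) * p) * sqrt (Y / m)"
    proof -
      have "sqrt (m * T) * sqrt (Y / m) = sqrt (T * Y)" using m by (simp add: real_sqrt_mult[symmetric])
      then show ?thesis by (simp add: algebra_simps)
    qed
    also have "\<dots> \<le> (sqrt (m * T) * p)\<^sup>2 + (sqrt (Y / m))\<^sup>2" by (rule sum_squares_bound)
    also have "\<dots> = m * T * p\<^sup>2 + Y / m" using m T0 Y0 by (simp add: power_mult_distrib)
    finally have "(p + cmod y)\<^sup>2 \<le> p\<^sup>2 + T * Y + (m * T * p\<^sup>2 + Y / m)"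
      using yTY by (simp add: power2_sum)
    also have "\<dots> = (1 / m + T) * (m * p\<^sup>2 + Y)" using m by (simp add: field_simps)
    finally show ?thesis .
  qed
  finally have 1: "(cmod (a i0))\<^sup>2 \<le> (1 / m + T) * (m * p\<^sup>2 + Y)" .
  have "1 / m + T \<le> - 1 / E i0" using \<sigma> by (simp add: T_def)
  moreover have "0 \<le> m * p\<^sup>2 + Y" using m Y0 by simp
  ultimately have "(cmod (a i0))\<^sup>2 \<le> (- 1 / E i0) * (m * p\<^sup>2 + Y)"
    using 1 by (meson mult_right_mono order_trans)
  then have "(- E i0) * (cmod (a i0))\<^sup>2 \<le> (- E i0) * ((- 1 / E i0) * (m * p\<^sup>2 + Y))"
    using E0 by (intro mult_left_mono) auto
  also have "\<dots> = m * p\<^sup>2 + Y" using E0 by simp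
  finally show ?thesis by (simp add: Y_def p_def)
qed

text \<open>
  The kinetic energy of the mode \<open>n\<close>, relative to \<open>1/4\<close>, the Dirichlet ground energy on an interval of
  length \<open>2 \<pi>\<close>.
\<close>

definition detuning :: "real \<Rightarrow> int \<Rightarrow> real"
  where "detuning q n = (of_int n + q)\<^sup>2 - 1 / 4"

text \<open>
  Equal to \<open>- d/d\<lambda>\<close> of the sum of \<open>1 / ((n + q)\<^sup>2 - 1/4 + \<lambda>)\<close> at \<open>\<lambda> = 0\<close>; the first-order shift of the
  ground energy of a strong point interaction is inversely proportional to it.
\<close>

definition tau :: "real \<Rightarrow> real"
  where "tau q = (\<Sum>\<^sub>\<infinity>n. 1 / (detuning q n)\<^sup>2)"

lemma detuning_factor: "detuning q n = (of_int n + q - 1 / 2) * (of_int n + q + 1 / 2)"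
  by (simp add: detuning_def power2_eq_square algebra_simps)

lemma detuning_zero: "0 \<le> q \<Longrightarrow> q < 1 / 2 \<Longrightarrow> detuning q 0 < 0"
  by (simp add: detuning_factor mult_neg_pos)

lemma detuning_pos:
  assumes "0 \<le> q" "q < 1 / 2" "n \<noteq> 0"
  shows "detuning q n > 0"
proof (cases "n > 0")
  case True
  then have "1 \<le> real_of_int n" by linarith
  then show ?thesis unfolding detuning_factor using assms by (intro mult_pos_pos) auto
next
  case False
  then have "real_of_int n \<le> -1" using assms(3) by linarith
  then show ?thesis unfolding detuning_factor using assms by (intro mult_neg_neg) auto
qed

lemma detuning_nonzero: "0 \<le> q \<Longrightarrow> q < 1 / 2 \<Longrightarrow> detuning q n \<noteq> 0"
  using detuning_zero[of q] detuning_pos[of q n] by (cases "n = 0") auto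

lemma detuning_large:
  assumes "0 \<le> q" "q < 1 / 2" "n \<noteq> 0" "n \<noteq> -1"
  shows "detuning q n \<ge> 3 / 4"
proof (cases "n > 0")
  case True
  then have n: "1 \<le> real_of_int n" by linarith
  have "1 * 1 \<le> (of_int n + q) * (of_int n + q)" using n assms by (intro mult_mono) auto
  then show ?thesis unfolding detuning_def power2_eq_square by simp
next
  case False
  then have "real_of_int n \<le> -2" using assms(3,4) by linarith
  then have "1 * 1 \<le> (- of_int n - q) * (- of_int n - q)" using assms by (intro mult_mono) auto
  then have "1 \<le> (of_int n + q)\<^sup>2" by (simp add: power2_eq_square algebra_simps)
  then show ?thesis unfolding detuning_def by simp
qed

text \<open>
  Outside \<open>{-1, 0, 1}\<close> the constant \<open>5/2\<close> works, because \<open>n\<^sup>2 - |n| \<le> detuning q n\<close> and \<open>|n| \<ge> 2\<close>; the three remaining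
  indices are paid for by their own quotients, so \<open>K\<close> depends on \<open>q\<close>.
\<close>

lemma detuning_weight:
  assumes q: "0 \<le> q" "q < 1 / 2"
  obtains K where "K > 0" "\<And>n. 1 + (real_of_int n)\<^sup>2 \<le> K * \<bar>detuning q n\<bar>"
proof -
  define K where "K = 5 / 2 + (\<Sum>n\<in>{-1, 0, 1 :: int}. (1 + (real_of_int n)\<^sup>2) / \<bar>detuning q n\<bar>)"
  have K0: "K \<ge> 5 / 2" unfolding K_def by (simp add: sum_nonneg)
  have "1 + (real_of_int n)\<^sup>2 \<le> K * \<bar>detuning q n\<bar>" for n
  proof (cases "n \<in> {-1, 0, 1}")
    case True
    have "(1 + (real_of_int n)\<^sup>2) / \<bar>detuning q n\<bar> \<le> (\<Sum>n\<in>{-1, 0, 1 :: int}. (1 + (real_of_int n)\<^sup>2) / \<bar>detuning q n\<bar>)"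
      by (rule member_le_sum[OF True]) auto
    also have "\<dots> \<le> K" by (simp add: K_def)
    finally show ?thesis using detuning_nonzero[OF q, of n] by (simp add: divide_le_eq)
  next
    case False
    have n2: "2 \<le> \<bar>real_of_int n\<bar>" using False by auto
    have "\<bar>real_of_int n\<bar> - 1 / 2 \<le> \<bar>of_int n + q\<bar>" using q by linarith
    then have "(\<bar>real_of_int n\<bar> - 1 / 2)\<^sup>2 \<le> \<bar>of_int n + q\<bar>\<^sup>2" using n2 by (intro power_mono) auto
    then have "(real_of_int n)\<^sup>2 - \<bar>real_of_int n\<bar> \<le> detuning q n" by (simp add: detuning_def power2_diff power_one_over)
    moreover have "2 * \<bar>real_of_int n\<bar> \<le> \<bar>real_of_int n\<bar> * \<bar>real_of_int n\<bar>" using n2 by (intro mult_right_mono) auto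
    then have "2 * \<bar>real_of_int n\<bar> \<le> (real_of_int n)\<^sup>2" by (simp add: power2_eq_square)
    ultimately have "1 + (real_of_int n)\<^sup>2 \<le> 5 / 2 * detuning q n" using n2 by linarith
    also have "\<dots> \<le> K * \<bar>detuning q n\<bar>"
    proof -
      have "0 \<le> detuning q n" using \<open>1 + (real_of_int n)\<^sup>2 \<le> 5 / 2 * detuning q n\<close> zero_le_power2[of "real_of_int n"] by linarith
      then show ?thesis using K0 by (intro mult_mono) auto
    qed
    finally show ?thesis .
  qed
  then show ?thesis using that[of K] K0 by simp
qed

lemma inverse_detuning_le:
  assumes "K > 0" "1 + (real_of_int n)\<^sup>2 \<le> K * \<bar>detuning q n\<bar>"
  shows "\<bar>1 / detuning q n\<bar> \<le> K * (1 / (1 + (real_of_int n)\<^sup>2))"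
proof -
  have w: "1 + (real_of_int n)\<^sup>2 > 0" by (simp add: add_pos_nonneg)
  have "detuning q n \<noteq> 0" using assms w by auto
  then show ?thesis using assms w by (simp add: field_simps)
qed

lemma inverse_detuning_summable:
  assumes q: "0 \<le> q" "q < 1 / 2"
  shows "(\<lambda>n. \<bar>1 / detuning q n\<bar>) summable_on UNIV"
proof -
  obtain K where K: "K > 0" "\<And>n. 1 + (real_of_int n)\<^sup>2 \<le> K * \<bar>detuning q n\<bar>" using detuning_weight[OF q] by blast
  show ?thesis
    by (rule summable_on_comparison_test[OF summable_on_cmult_right[OF inverse_weight_summable, of K]])
       (use inverse_detuning_le[OF K] in auto)
qed

text \<open>
  Partial fractions: \<open>1 / detuning q n\<close> is \<open>1 / (n + q - 1/2) - 1 / (n + q + 1/2)\<close>, so the symmetric partial sums telescope. The value \<open>0\<close> expresses that \<open>1/4\<close> is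
  the energy of a function vanishing at \<open>0\<close>.
\<close>

lemma sum_inverse_detuning:
  assumes q: "0 \<le> q" "q < 1 / 2"
  shows "((\<lambda>n. 1 / detuning q n) has_sum 0) UNIV"
proof -
  have s: "(\<lambda>n. 1 / detuning q n) summable_on UNIV"
    by (rule abs_summable_summable) (use inverse_detuning_summable[OF q] in simp)
  define S where "S = (\<Sum>\<^sub>\<infinity>n. 1 / detuning q n)"
  have hs: "((\<lambda>n. 1 / detuning q n) has_sum S) UNIV" unfolding S_def using s by (rule has_sum_infsum)
  define t where "t n = 1 / (real_of_int n + q - 1 / 2)" for n
  have tt: "1 / detuning q n = t n - t (n + 1)" for n
  proof -
    have "real_of_int n + q - 1 / 2 \<noteq> 0" "real_of_int n + q + 1 / 2 \<noteq> 0"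
      using detuning_nonzero[OF q, of n] by (auto simp: detuning_factor)
    then show ?thesis unfolding t_def detuning_factor by (simp add: field_simps)
  qed
  have tel: "(\<Sum>n\<in>{- int N..int N}. 1 / detuning q n) = t (- int N) - t (int N + 1)" for N
  proof (induction N)
    case 0
    then show ?case by (simp add: tt)
  next
    case (Suc N)
    have "{- int (Suc N)..int (Suc N)} = insert (- int N - 1) (insert (int N + 1) {- int N..int N})" by auto
    then have "(\<Sum>n\<in>{- int (Suc N)..int (Suc N)}. 1 / detuning q n) = 1 / detuning q (- int N - 1) + (1 / detuning q (int N + 1) + (\<Sum>n\<in>{- int N..int N}. 1 / detuning q n))"
      by simp
    also have "\<dots> = t (- int N - 1) - t (int N + 1 + 1)"
      unfolding Suc.IH unfolding tt by simp
    also have "\<dots> = t (- int (Suc N)) - t (int (Suc N) + 1)"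
      by (intro arg_cong2[where f = "(-)"] arg_cong[where f = t]) auto
    finally show ?case .
  qed
  have "(\<lambda>N. t (- int N)) \<longlonglongrightarrow> 0"
  proof (rule Lim_null_comparison[OF _ lim_inverse_n])
    have "norm (t (- int N)) \<le> inverse (real N)" if "N \<ge> 1" for N
    proof -
      have "real N \<le> \<bar>real_of_int (- int N) + q - 1 / 2\<bar>" using q by simp
      then have "inverse \<bar>real_of_int (- int N) + q - 1 / 2\<bar> \<le> inverse (real N)" using that by (intro le_imp_inverse_le) auto
      then show ?thesis by (simp only: t_def divide_inverse mult_1_left real_norm_def abs_inverse)
    qed
    then show "eventually (\<lambda>N. norm (t (- int N)) \<le> inverse (real N)) sequentially"
      by (auto simp: eventually_sequentially)
  qed
  moreover have "(\<lambda>N. t (int N + 1)) \<longlonglongrightarrow> 0"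
  proof (rule Lim_null_comparison[OF _ lim_inverse_n])
    have "norm (t (int N + 1)) \<le> inverse (real N)" if "N \<ge> 1" for N
    proof -
      have "real N \<le> \<bar>real_of_int (int N + 1) + q - 1 / 2\<bar>" using q by simp
      then have "inverse \<bar>real_of_int (int N + 1) + q - 1 / 2\<bar> \<le> inverse (real N)" using that by (intro le_imp_inverse_le) auto
      then show ?thesis by (simp only: t_def divide_inverse mult_1_left real_norm_def abs_inverse)
    qed
    then show "eventually (\<lambda>N. norm (t (int N + 1)) \<le> inverse (real N)) sequentially"
      by (auto simp: eventually_sequentially)
  qed
  ultimately have "(\<lambda>N. t (- int N) - t (int N + 1)) \<longlonglongrightarrow> 0 - 0" by (rule tendsto_diff)
  moreover have "(\<lambda>N. t (- int N) - t (int N + 1)) \<longlonglongrightarrow> S"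
    using has_sum_symmetric_limit[OF hs filterlim_ident] unfolding tel .
  ultimately have "S = 0" using LIMSEQ_unique by fastforce
  then show ?thesis using hs by simp
qed

lemma tau_has_sum:
  assumes q: "0 \<le> q" "q < 1 / 2"
  shows "((\<lambda>n. 1 / (detuning q n)\<^sup>2) has_sum tau q) UNIV"
  unfolding tau_def
proof (rule has_sum_infsum, rule summable_on_comparison_test)
  define C where "C = \<bar>1 / detuning q 0\<bar> + 4 / 3 + \<bar>1 / detuning q (-1)\<bar>"
  show "(\<lambda>n. C * \<bar>1 / detuning q n\<bar>) summable_on UNIV"
    by (rule summable_on_cmult_right[OF inverse_detuning_summable[OF q]])
  fix n
  have "\<bar>1 / detuning q n\<bar> \<le> C"
  proof (cases "n = 0 \<or> n = -1")
    case False
    then have "detuning q n \<ge> 3 / 4" using detuning_large[OF q] by simp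
    then have "\<bar>1 / detuning q n\<bar> \<le> 4 / 3" by (simp add: field_simps)
    then show ?thesis by (simp add: C_def add_increasing add_increasing2)
  qed (auto simp: C_def)
  then have "\<bar>1 / detuning q n\<bar> * \<bar>1 / detuning q n\<bar> \<le> C * \<bar>1 / detuning q n\<bar>" by (rule mult_right_mono) simp
  then show "1 / (detuning q n)\<^sup>2 \<le> C * \<bar>1 / detuning q n\<bar>" by (simp add: power2_eq_square)
qed simp

lemma tau_ge:
  assumes q: "0 \<le> q" "q < 1 / 2"
  shows "tau q \<ge> 1 / (detuning q 0)\<^sup>2" "tau q \<ge> 16"
proof -
  show 1: "tau q \<ge> 1 / (detuning q 0)\<^sup>2"
    using finite_sum_le_has_sum[OF tau_has_sum[OF q], of "{0}"] by simp
  have "\<bar>detuning q 0\<bar> \<le> 1 / 4"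
    using detuning_zero[OF q] by (simp add: detuning_def)
  then have "\<bar>detuning q 0\<bar>\<^sup>2 \<le> (1 / 4)\<^sup>2" by (intro power_mono) auto
  then have "(detuning q 0)\<^sup>2 \<le> 1 / 16" by (simp add: power2_eq_square)
  then have "16 \<le> 1 / (detuning q 0)\<^sup>2" using detuning_nonzero[OF q, of 0] by (simp add: field_simps)
  then show "tau q \<ge> 16" using 1 by linarith
qed

text \<open>
  Pairing \<open>n\<close> with \<open>-n\<close> makes the summand depend on \<open>q\<^sup>2\<close> only and monotonically so. With
  \<open>P = detuning q n * detuning q (- n)\<close> the pair contributes \<open>(difference)\<^sup>2 / P\<^sup>2 + 2 / P\<close>; here the difference
  is \<open>4 n q\<close>, and the positive product \<open>P\<close> decreases as \<open>q\<^sup>2\<close> increases.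
\<close>

lemma tau_strict_mono:
  assumes p: "0 \<le> p" and pq: "p < q" and q: "q < 1 / 2"
  shows "tau p < tau q"
proof -
  define P where "P s n = ((real_of_int n)\<^sup>2 - s)\<^sup>2 - ((real_of_int n)\<^sup>2 + s) / 2 + 1 / 16" for s n
  define \<phi> where "\<phi> r n = 16 * (real_of_int n)\<^sup>2 * r\<^sup>2 / (P (r\<^sup>2) n)\<^sup>2 + 2 / P (r\<^sup>2) n" for r n
  have kk: "detuning r n * detuning r (- n) = P (r\<^sup>2) n" for r n
    by (simp add: detuning_def P_def power2_eq_square algebra_simps)
  have kp: "0 < P (r\<^sup>2) n" if r: "0 \<le> r" "r < 1 / 2" for r n
  proof (cases "n = 0")
    case True
    then show ?thesis using kk[of r n] detuning_zero[OF r] mult_neg_neg[of "detuning r 0" "detuning r 0"] by simp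
  next
    case False
    then show ?thesis unfolding kk[symmetric] using detuning_pos[OF r] by (intro mult_pos_pos) auto
  qed
  have id: "1 / (detuning r n)\<^sup>2 + 1 / (detuning r (- n))\<^sup>2 = \<phi> r n" if r: "0 \<le> r" "r < 1 / 2" for r n
  proof -
    let ?A = "detuning r n" let ?B = "detuning r (- n)"
    have nz: "?A \<noteq> 0" "?B \<noteq> 0" using detuning_nonzero[OF r] by auto
    have AB: "?A - ?B = 4 * of_int n * r" by (simp add: detuning_def power2_eq_square algebra_simps)
    have "1 / ?A\<^sup>2 + 1 / ?B\<^sup>2 = (?A - ?B)\<^sup>2 / (?A * ?B)\<^sup>2 + 2 / (?A * ?B)"
      using nz by (simp add: field_simps power2_eq_square)
    then show ?thesis unfolding kk AB by (simp add: \<phi>_def power_mult_distrib)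
  qed
  have hs: "(\<phi> r has_sum (tau r + tau r)) UNIV" if r: "0 \<le> r" "r < 1 / 2" for r
  proof -
    have "((\<lambda>n. 1 / (detuning r (- n))\<^sup>2) has_sum tau r) UNIV"
      by (subst has_sum_reindex_bij_witness[where i = uminus and j = uminus and T = UNIV and h = "\<lambda>n. 1 / (detuning r n)\<^sup>2"])
         (use tau_has_sum[OF r] in auto)
    from has_sum_add[OF tau_has_sum[OF r] this] show ?thesis using id[OF r] by simp
  qed
  have r: "0 \<le> q" "p < 1 / 2" using assms by auto
  have lt: "\<phi> p n < \<phi> q n" for n
  proof -
    have s: "p\<^sup>2 < q\<^sup>2" using p pq by (intro power_strict_mono) auto
    have q2: "q\<^sup>2 < (1 / 2)\<^sup>2" using q r by (intro power_strict_mono) auto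
    then have q2: "q\<^sup>2 < 1 / 4" by (simp add: power2_eq_square)
    have "P (p\<^sup>2) n - P (q\<^sup>2) n = (q\<^sup>2 - p\<^sup>2) * (2 * (real_of_int n)\<^sup>2 + 1 / 2 - p\<^sup>2 - q\<^sup>2)"
      by (simp add: P_def power2_eq_square field_simps)
    moreover have "0 < (q\<^sup>2 - p\<^sup>2) * (2 * (real_of_int n)\<^sup>2 + 1 / 2 - p\<^sup>2 - q\<^sup>2)"
    proof (rule mult_pos_pos)
      show "0 < 2 * (real_of_int n)\<^sup>2 + 1 / 2 - p\<^sup>2 - q\<^sup>2"
        using s q2 zero_le_power2[of "real_of_int n"] by linarith
    qed (use s in simp)
    ultimately have Plt: "P (q\<^sup>2) n < P (p\<^sup>2) n" by linarith
    have Pq: "0 < P (q\<^sup>2) n" by (rule kp[OF r(1) q])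
    have "2 / P (p\<^sup>2) n < 2 / P (q\<^sup>2) n" using Plt Pq by (intro divide_strict_left_mono) auto
    moreover have "16 * (real_of_int n)\<^sup>2 * p\<^sup>2 / (P (p\<^sup>2) n)\<^sup>2 \<le> 16 * (real_of_int n)\<^sup>2 * q\<^sup>2 / (P (q\<^sup>2) n)\<^sup>2"
      using Plt Pq s by (intro frac_le mult_left_mono power_mono) (use p pq in auto)
    ultimately show ?thesis by (simp add: \<phi>_def)
  qed
  have "tau p + tau p < tau q + tau q"
    by (rule has_sum_strict_mono[OF hs[OF p r(2)] hs[OF r(1) q], of 0]) (use lt in \<open>auto intro: less_imp_le\<close>)
  then show ?thesis by simp
qed

section \<open>A strong point interaction\<close>

lemma detuning_sum_kin:
  assumes "H1seq a"
  shows "((\<lambda>n. detuning q n * (cmod (a n))\<^sup>2) has_sum ((kin q a - 1 / 4 * nsq a) / (2 * pi))) UNIV"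
proof -
  have "((\<lambda>n. (of_int n + q)\<^sup>2 * (cmod (a n))\<^sup>2 - 1 / 4 * (cmod (a n))\<^sup>2) has_sum (kin q a / (2 * pi) - 1 / 4 * (nsq a / (2 * pi)))) UNIV"
    unfolding kin_def nsq_def
    by (intro has_sum_minus has_sum_cmult_right) (use kin_summable[OF assms, of q] nsq_summable[OF assms] in auto)
  then show ?thesis by (simp add: detuning_def left_diff_distrib diff_divide_distrib)
qed

lemma nonneg_of_div_2pi: "0 \<le> x / (2 * pi) \<Longrightarrow> 0 \<le> x"
  using mult_nonneg_nonneg[of "x / (2 * pi)" "2 * pi"] by simp

lemma fsum_zero_has_sum: "H1seq a \<Longrightarrow> (a has_sum fsum a 0) UNIV"
  using fsum_has_sum[OF H1seq_summable, of a 0] by simp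

text \<open>
  With \<open>\<delta>\<close> the claimed depression of the energy below \<open>1/4\<close>, the claim is the nonnegativity of a diagonal
  form with entries \<open>detuning q n + \<delta>\<close> plus a rank-one term. If the entry at \<open>n = 0\<close> is not
  negative, every summand is nonnegative. Otherwise \<open>rank_one_form_nonneg\<close> reduces the claim to the sum of reciprocals being at most
  \<open>- 2 \<pi> / L\<close>; expanding the reciprocals in \<open>\<delta>\<close>, the zeroth order vanishes by \<open>sum_inverse_detuning\<close> and
  the first order is \<open>- \<delta> \<tau>\<close>.
\<close>

lemma delta_comb_lower:
  assumes q: "0 \<le> q" "q < 1 / 2" and L: "L \<ge> 4" and a: "H1seq a"
  shows "(1 / 4 - 2 * pi / tau q * (1 + 2 / L) / L) * nsq a \<le> kin q a + L * (cmod (fsum a 0))\<^sup>2"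
proof -
  define g where "g = 2 * pi / tau q"
  define \<delta> where "\<delta> = g * (1 + 2 / L) / L"
  have t16: "tau q \<ge> 16" by (rule tau_ge(2)[OF q])
  have g0: "g > 0" using t16 by (simp add: g_def)
  have g1: "g \<le> 1 / 2" using t16 pi_less_4 by (simp add: g_def divide_le_eq)
  have gt: "g * tau q = 2 * pi" using t16 by (simp add: g_def)
  have \<delta>0: "\<delta> > 0" unfolding \<delta>_def using g0 L by (intro divide_pos_pos mult_pos_pos add_pos_pos) auto
  have L2: "1 + 2 / L \<le> 2" using L by simp
  have "g * (1 + 2 / L) \<le> (1 / 2) * 2" using g0 g1 L2 L by (intro mult_mono) auto
  then have \<delta>1: "\<delta> \<le> 1 / L" using L by (simp add: \<delta>_def divide_right_mono)
  have "(1 / 4 - \<delta>) * nsq a \<le> kin q a + L * (cmod (fsum a 0))\<^sup>2"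
  proof (cases "\<delta> < - detuning q 0")
    case False
    have "0 \<le> (kin q a - 1 / 4 * nsq a) / (2 * pi) + \<delta> * (nsq a / (2 * pi))"
    proof (rule has_sum_nonneg[OF has_sum_add[OF detuning_sum_kin[OF a] has_sum_cmult_right]])
      show "((\<lambda>n. (cmod (a n))\<^sup>2) has_sum (nsq a / (2 * pi))) UNIV"
        unfolding nsq_def using nsq_summable[OF a] by simp
      show "0 \<le> detuning q n * (cmod (a n))\<^sup>2 + \<delta> * (cmod (a n))\<^sup>2" for n
      proof -
        have "0 \<le> detuning q n + \<delta>" using False detuning_pos[OF q, of n] \<delta>0 by (cases "n = 0") auto
        then show ?thesis by (simp add: distrib_right[symmetric])
      qed
    qed
    then have "0 \<le> (kin q a - 1 / 4 * nsq a + \<delta> * nsq a) / (2 * pi)" by (simp add: add_divide_distrib)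
    then have "0 \<le> kin q a - 1 / 4 * nsq a + \<delta> * nsq a" by (rule nonneg_of_div_2pi)
    moreover have "0 \<le> L * (cmod (fsum a 0))\<^sup>2" using L by simp
    ultimately show ?thesis by (simp add: left_diff_distrib)
  next
    case True
    define E where "E n = detuning q n + \<delta>" for n
    have E0: "E 0 < 0" using True by (simp add: E_def)
    have Ep: "E n > 0" if "n \<noteq> 0" for n using detuning_pos[OF q that] \<delta>0 by (simp add: E_def)
    have nz: "detuning q n \<noteq> 0" "E n \<noteq> 0" for n using detuning_nonzero[OF q] E0 Ep[of n] by (auto, cases "n = 0", auto)
    \<comment> \<open>The second-order Taylor remainder of the reciprocal at \<open>detuning q n\<close>.\<close>
    define r where "r n = \<delta>\<^sup>2 / ((detuning q n)\<^sup>2 * E n)" for n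
    have taylor: "1 / E n = 1 / detuning q n - \<delta> * (1 / (detuning q n)\<^sup>2) + r n" for n
    proof -
      have "1 / (D + d) = 1 / D - d * (1 / D\<^sup>2) + d\<^sup>2 / (D\<^sup>2 * (D + d))" if "D \<noteq> 0" "D + d \<noteq> 0" for D d :: real
        using that by (simp add: divide_simps) (simp add: algebra_simps power2_eq_square power3_eq_cube)
      then show ?thesis using nz[of n] by (simp add: E_def r_def)
    qed
    have summable: "(\<lambda>n. 1 / E n) summable_on UNIV"
    proof (rule abs_summable_summable, rule summable_on_comparison_test)
      show "(\<lambda>n. \<bar>1 / detuning q n\<bar> + (if n = 0 then \<bar>1 / E 0\<bar> else 0)) summable_on UNIV"
        by (intro summable_on_add inverse_detuning_summable[OF q] has_sum_imp_summable[OF has_sum_finite_neutralI[where B = "{0}"]]) auto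
      fix n show "norm (1 / E n) \<le> \<bar>1 / detuning q n\<bar> + (if n = 0 then \<bar>1 / E 0\<bar> else 0)"
      proof (cases "n = 0")
        case False
        then have k: "detuning q n > 0" by (rule detuning_pos[OF q])
        then have "1 / E n \<le> 1 / detuning q n" "0 \<le> 1 / E n" using \<delta>0 by (auto simp: E_def intro!: divide_left_mono)
        then show ?thesis using False k by simp
      qed simp
    qed auto
    define \<sigma> where "\<sigma> = (\<Sum>\<^sub>\<infinity>n. 1 / E n)"
    have h\<sigma>: "((\<lambda>n. 1 / E n) has_sum \<sigma>) UNIV" unfolding \<sigma>_def using summable by (rule has_sum_infsum)
    \<comment> \<open>As \<open>q\<close> tends to \<open>1/2\<close>, the entries at \<open>0\<close> and \<open>-1\<close> both tend to \<open>0\<close> and their remainders blow up. They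
      have opposite signs, and the negative one dominates, since \<open>|detuning q 0| \<le> detuning q (-1)\<close>.\<close>
    have pair: "r 0 + r (-1) \<le> 0"
    proof -
      have A: "- detuning q 0 > 0" "- E 0 > 0" using detuning_zero[OF q] E0 by auto
      have B: "detuning q (-1) > 0" using detuning_pos[OF q, of "-1"] by simp
      have AB: "- detuning q 0 \<le> detuning q (-1)" using zero_le_power2[of "q - 1 / 2"] by (simp add: detuning_def power2_eq_square algebra_simps)
      have "(- detuning q 0)\<^sup>2 * (- E 0) \<le> (detuning q (-1))\<^sup>2 * E (-1)"
        using A B AB \<delta>0 by (intro mult_mono power_mono) (auto simp: E_def)
      then have "\<delta>\<^sup>2 / ((detuning q (-1))\<^sup>2 * E (-1)) \<le> \<delta>\<^sup>2 / ((- detuning q 0)\<^sup>2 * (- E 0))"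
      proof (rule divide_left_mono[OF _ _ mult_pos_pos])
        show "0 < (detuning q (-1))\<^sup>2 * E (-1)" using B \<delta>0 by (intro mult_pos_pos) (auto simp: E_def)
        show "0 < (- detuning q 0)\<^sup>2 * (- E 0)" using A by (intro mult_pos_pos) auto
      qed auto
      then show ?thesis by (simp add: r_def)
    qed
    have "\<sigma> \<le> 0 - \<delta> * tau q + (4 / 3 * \<delta>\<^sup>2 * tau q + (r 0 + r (-1)))"
    proof (rule has_sum_mono[OF h\<sigma>])
      have fin: "((\<lambda>n::int. if n = 0 then r 0 else if n = -1 then r (-1) else 0) has_sum (r 0 + r (-1))) UNIV"
      proof -
        have single: "((\<lambda>n. if n = m then z else 0) has_sum z) UNIV" for m :: int and z :: real
          by (rule has_sum_finite_neutralI[where B = "{m}"]) auto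
        have eq: "(if n = 0 then r 0 else if n = -1 then r (-1) else 0) = (if n = 0 then r 0 else 0) + (if n = -1 then r (-1) else 0)" for n :: int
          by simp
        show ?thesis unfolding eq by (intro has_sum_add single)
      qed
      show "((\<lambda>n. 1 / detuning q n - \<delta> * (1 / (detuning q n)\<^sup>2) + (4 / 3 * \<delta>\<^sup>2 * (1 / (detuning q n)\<^sup>2) + (if n = 0 then r 0 else if n = -1 then r (-1) else 0)))
         has_sum (0 - \<delta> * tau q + (4 / 3 * \<delta>\<^sup>2 * tau q + (r 0 + r (-1))))) UNIV"
        by (intro has_sum_add has_sum_minus has_sum_cmult_right sum_inverse_detuning tau_has_sum fin q)
      fix n :: int
      have "r n \<le> 4 / 3 * \<delta>\<^sup>2 * (1 / (detuning q n)\<^sup>2) + (if n = 0 then r 0 else if n = -1 then r (-1) else 0)"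
      proof (cases "n = 0 \<or> n = -1")
        case False
        then have "E n \<ge> 3 / 4" using detuning_large[OF q, of n] \<delta>0 by (simp add: E_def)
        then have "1 / E n \<le> 4 / 3" by (simp add: field_simps)
        then have "\<delta>\<^sup>2 * (1 / (detuning q n)\<^sup>2) * (1 / E n) \<le> \<delta>\<^sup>2 * (1 / (detuning q n)\<^sup>2) * (4 / 3)"
          by (intro mult_left_mono) auto
        then show ?thesis using False by (simp add: r_def mult_ac)
      qed auto
      then show "1 / E n \<le> 1 / detuning q n - \<delta> * (1 / (detuning q n)\<^sup>2) + (4 / 3 * \<delta>\<^sup>2 * (1 / (detuning q n)\<^sup>2) + (if n = 0 then r 0 else if n = -1 then r (-1) else 0))"
        unfolding taylor by linarith
    qed
    then have "\<sigma> \<le> - (\<delta> * tau q * (1 - 4 / 3 * \<delta>))"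
      using pair by (simp add: algebra_simps power2_eq_square)
    moreover have "2 * pi / L \<le> \<delta> * tau q * (1 - 4 / 3 * \<delta>)"
    proof -
      have dt: "\<delta> * tau q = (2 * pi / L) * (1 + 2 / L)"
        using gt L by (simp add: \<delta>_def field_simps)
      \<comment> \<open>The factor \<open>1 + 2/L\<close> in \<open>\<delta>\<close> was chosen to absorb the remainders, which are at most \<open>4/3\<close> times
        \<open>\<delta>\<^sup>2 \<tau>\<close> because all entries but those at \<open>0\<close> and \<open>-1\<close> are at least \<open>3/4\<close>.\<close>
      have "1 \<le> (1 + 2 / L) * (1 - 4 / 3 * (1 / L))"
      proof -
        define k where "k = 1 / L"
        have k: "0 < k" "k \<le> 1 / 4" using L by (auto simp: k_def field_simps)
        have "0 \<le> k * (2 / 3 - 8 / 3 * k)" using k by (intro mult_nonneg_nonneg) auto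
        then have "1 \<le> (1 + 2 * k) * (1 - 4 / 3 * k)" by (simp add: algebra_simps)
        then show ?thesis by (simp add: k_def)
      qed
      also have "\<dots> \<le> (1 + 2 / L) * (1 - 4 / 3 * \<delta>)"
        using \<delta>1 L by (intro mult_left_mono) auto
      finally have "(2 * pi / L) * 1 \<le> (2 * pi / L) * ((1 + 2 / L) * (1 - 4 / 3 * \<delta>))"
        using L by (intro mult_left_mono) auto
      then show ?thesis unfolding dt by (simp add: mult.assoc)
    qed
    ultimately have \<sigma>: "\<sigma> \<le> - 1 / (L / (2 * pi))" by simp
    have hX: "((\<lambda>n. E n * (cmod (a n))\<^sup>2) has_sum ((kin q a - 1 / 4 * nsq a) / (2 * pi) + \<delta> * (nsq a / (2 * pi)))) UNIV"
    proof -
      have "((\<lambda>n. (cmod (a n))\<^sup>2) has_sum (nsq a / (2 * pi))) UNIV"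
        unfolding nsq_def using nsq_summable[OF a] by simp
      from has_sum_add[OF detuning_sum_kin[OF a] has_sum_cmult_right[OF this]]
      show ?thesis by (simp add: E_def distrib_right)
    qed
    have "0 \<le> ((kin q a - 1 / 4 * nsq a) / (2 * pi) + \<delta> * (nsq a / (2 * pi))) + L / (2 * pi) * (cmod (fsum a 0))\<^sup>2"
      by (rule rank_one_form_nonneg[of E 0, OF E0 Ep h\<sigma> hX fsum_zero_has_sum[OF a] _ \<sigma>]) (use L in auto)
    then have "0 \<le> (kin q a - 1 / 4 * nsq a + \<delta> * nsq a + L * (cmod (fsum a 0))\<^sup>2) / (2 * pi)"
      by (simp add: add_divide_distrib)
    then have "0 \<le> kin q a - 1 / 4 * nsq a + \<delta> * nsq a + L * (cmod (fsum a 0))\<^sup>2" by (rule nonneg_of_div_2pi)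
    then show ?thesis by (simp add: left_diff_distrib)
  qed
  then show ?thesis by (simp only: \<delta>_def g_def)
qed

text \<open>
  The function with coefficients \<open>1 / detuning q n\<close> is the Dirichlet ground state: its value at \<open>0\<close>
  vanishes by \<open>sum_inverse_detuning\<close>, and its energy is \<open>1/4\<close>. Lowering the coefficient at \<open>n = 0\<close> by \<open>\<eta>\<close> changes the
  form, relative to \<open>1/4\<close>, by at most \<open>- 4 \<pi> \<eta> + L \<eta>\<^sup>2\<close>, which is minimal at \<open>\<eta> = 2 \<pi> / L\<close>. The squared norm
  changes from \<open>2 \<pi> \<tau>\<close> by a factor at most \<open>1 + 3 \<eta>\<close>.
\<close>

lemma delta_comb_upper:
  assumes q: "0 \<le> q" "q < 1 / 2" and L: "L \<ge> 8"
  shows "\<exists>a. H1seq a \<and> nsq a > 0 \<and> kin q a + L * (cmod (fsum a 0))\<^sup>2 \<le> (1 / 4 - (2 * pi / tau q - 20 / L) / L) * nsq a"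
proof -
  define \<eta> where "\<eta> = 2 * pi / L"
  have \<eta>: "\<eta> > 0" "\<eta> \<le> 1" using L pi_less_4 by (auto simp: \<eta>_def divide_le_eq)
  define u where "u n = 1 / detuning q n - (if n = 0 then \<eta> else 0)" for n
  define a where "a n = complex_of_real (u n)" for n
  have ca: "(cmod (a n))\<^sup>2 = (u n)\<^sup>2" for n by (simp add: a_def)
  have u2: "(u n)\<^sup>2 = 1 / (detuning q n)\<^sup>2 + (if n = 0 then - 2 * \<eta> / detuning q 0 + \<eta>\<^sup>2 else 0)" for n
    by (simp add: u_def power2_diff power_divide)
  have single: "((\<lambda>n. if n = 0 then z else 0) has_sum z) (UNIV :: int set)" for z :: real
    by (rule has_sum_finite_neutralI[where B = "{0}"]) auto
  obtain K where K: "K > 0" "\<And>n. 1 + (real_of_int n)\<^sup>2 \<le> K * \<bar>detuning q n\<bar>" using detuning_weight[OF q] by blast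
  have H: "H1seq a"
    unfolding H1seq_def
  proof (rule summable_on_comparison_test)
    show "(\<lambda>n. K * \<bar>1 / detuning q n\<bar> + (if n = 0 then (u 0)\<^sup>2 else 0)) summable_on UNIV"
      by (intro summable_on_add summable_on_cmult_right inverse_detuning_summable[OF q] has_sum_imp_summable[OF single])
    fix n
    show "(1 + (real_of_int n)\<^sup>2) * (cmod (a n))\<^sup>2 \<le> K * \<bar>1 / detuning q n\<bar> + (if n = 0 then (u 0)\<^sup>2 else 0)"
    proof (cases "n = 0")
      case False
      have "(1 + (real_of_int n)\<^sup>2) * (1 / (detuning q n)\<^sup>2) \<le> (K * \<bar>detuning q n\<bar>) * (1 / (detuning q n)\<^sup>2)"
        by (intro mult_right_mono K(2)) simp
      also have "\<dots> = K * \<bar>1 / detuning q n\<bar>"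
      proof -
        have "\<bar>D\<bar> * (1 / D\<^sup>2) = \<bar>1 / D\<bar>" for D :: real by (cases "D > 0") (auto simp: power2_eq_square)
        then show ?thesis by (simp only: mult.assoc)
      qed
      finally show ?thesis using False by (simp add: ca u2)
    qed (use K(1) in \<open>simp add: ca\<close>)
  qed auto
  define N where "N = tau q + (- 2 * \<eta> / detuning q 0 + \<eta>\<^sup>2)"
  have hN: "((\<lambda>n. (cmod (a n))\<^sup>2) has_sum N) UNIV"
    unfolding ca u2 N_def by (intro has_sum_add tau_has_sum[OF q] single)
  have nsqN: "nsq a = 2 * pi * N" using infsumI[OF hN] by (simp add: nsq_def)
  have t16: "tau q \<ge> 16" by (rule tau_ge(2)[OF q])
  have k0: "detuning q 0 < 0" by (rule detuning_zero[OF q])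
  have "- 2 * \<eta> / detuning q 0 = 2 * \<eta> * (1 / \<bar>detuning q 0\<bar>)" using k0 by simp
  moreover have "1 / \<bar>detuning q 0\<bar> \<le> tau q"
  proof -
    have "tau q * 1 \<le> tau q * tau q" using t16 by (intro mult_left_mono) auto
    then have "tau q \<le> (tau q)\<^sup>2" by (simp add: power2_eq_square)
    moreover have "(1 / \<bar>detuning q 0\<bar>)\<^sup>2 \<le> tau q" using tau_ge(1)[OF q] by (simp add: power_divide)
    ultimately have "(1 / \<bar>detuning q 0\<bar>)\<^sup>2 \<le> (tau q)\<^sup>2" by linarith
    then show ?thesis by (rule power2_le_imp_le) (use t16 in auto)
  qed
  then have "2 * \<eta> * (1 / \<bar>detuning q 0\<bar>) \<le> 2 * \<eta> * tau q" using \<eta> by (intro mult_left_mono) auto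
  ultimately have cross: "0 \<le> - 2 * \<eta> / detuning q 0" "- 2 * \<eta> / detuning q 0 \<le> 2 * \<eta> * tau q"
    using \<eta> by auto
  have "\<eta>\<^sup>2 \<le> \<eta> * 1" unfolding power2_eq_square using \<eta> by (intro mult_left_mono) auto
  also have "\<dots> \<le> \<eta> * tau q" using \<eta> t16 by (intro mult_left_mono) auto
  finally have e2: "\<eta>\<^sup>2 \<le> \<eta> * tau q" .
  have dist: "tau q * (1 + 3 * \<eta>) = tau q + 2 * \<eta> * tau q + \<eta> * tau q" by (simp add: algebra_simps)
  have N: "N > 0" "N \<le> tau q * (1 + 3 * \<eta>)"
    unfolding N_def dist using cross t16 e2 zero_le_power2[of \<eta>] by linarith+
  have f0: "fsum a 0 = of_real (- \<eta>)"
  proof -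
    have "((\<lambda>n. 1 / detuning q n + (if n = 0 then - \<eta> else 0)) has_sum (0 + - \<eta>)) UNIV"
      by (intro has_sum_add sum_inverse_detuning[OF q] single)
    moreover have "1 / detuning q n + (if n = 0 then - \<eta> else 0) = u n" for n by (simp add: u_def)
    ultimately have "(u has_sum - \<eta>) UNIV" by simp
    then have "(a has_sum of_real (- \<eta>)) UNIV" unfolding a_def by (rule has_sum_of_real)
    then show ?thesis using fsum_zero_has_sum[OF H] has_sum_unique by blast
  qed
  have hK: "((\<lambda>n. detuning q n * (cmod (a n))\<^sup>2) has_sum (0 + (- 2 * \<eta> + \<eta>\<^sup>2 * detuning q 0))) UNIV"
  proof -
    have "((\<lambda>n. 1 / detuning q n + (if n = 0 then - 2 * \<eta> + \<eta>\<^sup>2 * detuning q 0 else 0)) has_sum (0 + (- 2 * \<eta> + \<eta>\<^sup>2 * detuning q 0))) UNIV"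
      by (intro has_sum_add sum_inverse_detuning[OF q] single)
    moreover have "1 / detuning q n + (if n = 0 then - 2 * \<eta> + \<eta>\<^sup>2 * detuning q 0 else 0) = detuning q n * (cmod (a n))\<^sup>2" for n
      unfolding ca u2 using detuning_nonzero[OF q, of n] by (auto simp: field_simps power2_eq_square)
    ultimately show ?thesis by simp
  qed
  have "(kin q a - 1 / 4 * nsq a) / (2 * pi) = 0 + (- 2 * \<eta> + \<eta>\<^sup>2 * detuning q 0)"
    by (rule has_sum_unique[OF detuning_sum_kin[OF H] hK])
  then have kinq: "kin q a - 1 / 4 * nsq a = 2 * pi * (- 2 * \<eta> + \<eta>\<^sup>2 * detuning q 0)" by (simp add: field_simps)
  have "L * (cmod (fsum a 0))\<^sup>2 = 2 * pi * \<eta>"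
  proof -
    have "cmod (complex_of_real (- \<eta>)) = \<eta>" unfolding norm_of_real using \<eta> by simp
    then show ?thesis unfolding f0 using L by (simp add: \<eta>_def power2_eq_square)
  qed
  moreover have "2 * pi * (\<eta>\<^sup>2 * detuning q 0) \<le> 0" using k0 by (simp add: mult_nonneg_nonpos)
  ultimately have up: "kin q a + L * (cmod (fsum a 0))\<^sup>2 \<le> 1 / 4 * nsq a - 2 * pi * \<eta>"
    using kinq by (simp add: algebra_simps)
  have "(2 * pi / tau q - 20 / L) * N \<le> 2 * pi"
  proof (cases "2 * pi / tau q - 20 / L \<le> 0")
    case True
    then have "(2 * pi / tau q - 20 / L) * N \<le> 0" using N(1) by (intro mult_nonpos_nonneg) auto
    then show ?thesis using pi_gt_zero by linarith
  next
    case False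
    then have "(2 * pi / tau q - 20 / L) * N \<le> (2 * pi / tau q - 20 / L) * (tau q * (1 + 3 * \<eta>))"
      using N(2) by (intro mult_left_mono) auto
    also have "\<dots> = (2 * pi - 20 * tau q / L) * (1 + 3 * \<eta>)"
      using t16 by (simp add: field_simps)
    also have "\<dots> \<le> 2 * pi"
    proof -
      have key: "x \<le> p" if "x = p + u - v - w" "u \<le> c" "c \<le> d" "d \<le> v" "0 \<le> w" for x p u v w c d :: real
        using that by linarith
      show ?thesis
      proof (rule key)
        show "(2 * pi - 20 * tau q / L) * (1 + 3 * \<eta>) = 2 * pi + 2 * pi * (3 * \<eta>) - 20 * tau q / L - 20 * tau q / L * (3 * \<eta>)"
          by (simp add: algebra_simps add_divide_distrib)
        \<comment> \<open>The constant \<open>20\<close> works because \<open>12 \<pi>\<^sup>2 \<le> 192 \<le> 320 = 20 * 16\<close> and \<open>\<tau> \<ge> 16\<close>.\<close>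
        have "pi * pi \<le> 4 * 4" using pi_less_4 by (intro mult_mono) auto
        then have "12 * (pi * pi) / L \<le> 192 / L" using L by (intro divide_right_mono) auto
        then show "2 * pi * (3 * \<eta>) \<le> 192 / L" by (simp add: \<eta>_def)
        show "192 / L \<le> 320 / L" using L by (intro divide_right_mono) auto
        show "320 / L \<le> 20 * tau q / L" using t16 L by (intro divide_right_mono) auto
        show "0 \<le> 20 * tau q / L * (3 * \<eta>)" using t16 L \<eta> by simp
      qed
    qed
    finally show ?thesis .
  qed
  then have "(2 * pi / tau q - 20 / L) * N * (2 * pi / L) \<le> 2 * pi * (2 * pi / L)"
    using L by (intro mult_right_mono) auto
  then have "(2 * pi / tau q - 20 / L) / L * nsq a \<le> 2 * pi * \<eta>"
    unfolding nsqN \<eta>_def by (simp add: mult_ac)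
  then have "kin q a + L * (cmod (fsum a 0))\<^sup>2 \<le> (1 / 4 - (2 * pi / tau q - 20 / L) / L) * nsq a"
    unfolding left_diff_distrib using up by linarith
  moreover have "nsq a > 0" using N(1) by (simp add: nsqN)
  ultimately show ?thesis using H by blast
qed

section \<open>Point mass plus constant density\<close>

text \<open>
  The sum of \<open>L\<close> times the point mass at \<open>0\<close> and \<open>c\<close> times Lebesgue measure on the cell, as
  an image of a measure on two copies of the cell: the copy with index \<open>True\<close>, of total mass \<open>L\<close>, is collapsed
  to \<open>0\<close>.
\<close>

definition delta_mix :: "real \<Rightarrow> real \<Rightarrow> real measure"
  where "delta_mix L c = distr (density (count_space (UNIV :: bool set) \<Otimes>\<^sub>M lam) (\<lambda>(b, x). ennreal (if b then L / (2 * pi) else c)))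
     borel (\<lambda>(b, x). if b then 0 else x)"

lemma nn_integral_delta_mix:
  assumes L: "L \<ge> 0" and f: "f \<in> borel_measurable borel"
  shows "(\<integral>\<^sup>+x. f x \<partial>delta_mix L c) = ennreal L * f 0 + ennreal c * (\<integral>\<^sup>+x. f x \<partial>lam)"
proof -
  interpret finite_measure lam by (rule finite_measure_lam)
  have [measurable]: "f \<in> borel_measurable borel" by fact
  let ?P = "count_space (UNIV :: bool set) \<Otimes>\<^sub>M lam"
  have m1 [measurable]: "(\<lambda>(b, x). if b then 0 else x) \<in> ?P \<rightarrow>\<^sub>M (borel :: real measure)"
    by (rule measurable_pair_measure_countable1) auto
  have m2 [measurable]: "(\<lambda>(b, x). ennreal (if b then L / (2 * pi) else c)) \<in> borel_measurable ?P"
    by (rule measurable_pair_measure_countable1) auto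
  have "(\<integral>\<^sup>+x. f x \<partial>delta_mix L c) = (\<integral>\<^sup>+p. (case p of (b, x) \<Rightarrow> ennreal (if b then L / (2 * pi) else c)) * f (case p of (b, x) \<Rightarrow> if b then 0 else x) \<partial>?P)"
    unfolding delta_mix_def by (subst nn_integral_distr) (auto simp: nn_integral_density)
  also have "\<dots> = (\<integral>\<^sup>+b. \<integral>\<^sup>+x. ennreal (if b then L / (2 * pi) else c) * f (if b then 0 else x) \<partial>lam \<partial>count_space UNIV)"
    by (subst nn_integral_fst[symmetric]) auto
  also have "\<dots> = (\<integral>\<^sup>+x. ennreal (L / (2 * pi)) * f 0 \<partial>lam) + (\<integral>\<^sup>+x. ennreal c * f x \<partial>lam)"
    by (subst nn_integral_count_space_finite) (auto simp: UNIV_bool add.commute)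
  also have "(\<integral>\<^sup>+x. ennreal (L / (2 * pi)) * f 0 \<partial>lam) = ennreal (L / (2 * pi)) * f 0 * ennreal (2 * pi)"
    by (simp add: emeasure_lam)
  also have "\<dots> = ennreal (L / (2 * pi) * (2 * pi)) * f 0"
    using L by (subst ennreal_mult) (auto simp: mult_ac)
  also have "(\<integral>\<^sup>+x. ennreal c * f x \<partial>lam) = ennreal c * (\<integral>\<^sup>+x. f x \<partial>lam)"
    by (rule nn_integral_cmult) simp
  finally show ?thesis by simp
qed

lemma finite_borel_delta_mix:
  assumes "L \<ge> 0"
  shows "finite_borel (delta_mix L c)"
proof -
  have s: "sets (delta_mix L c) = sets borel" by (simp add: delta_mix_def)
  have "emeasure (delta_mix L c) UNIV = (\<integral>\<^sup>+x. 1 \<partial>delta_mix L c)"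
    by (simp add: delta_mix_def)
  also have "\<dots> \<noteq> \<infinity>"
    by (subst nn_integral_delta_mix[OF assms]) (auto simp: emeasure_lam ennreal_mult_eq_top_iff)
  finally show ?thesis unfolding finite_borel_def using s by (auto intro!: finite_measureI simp: delta_mix_def)
qed

lemma integral_delta_mix:
  assumes L: "L \<ge> 0" and c: "c \<ge> 0" and f: "cper f" and f0: "\<And>x. f x \<ge> (0::real)"
  shows "(\<integral>x. f x \<partial>delta_mix L c) = L * f 0 + c * (\<integral>x. f x \<partial>lam)"
proof -
  have m: "(\<lambda>x. ennreal (f x)) \<in> borel_measurable borel" using cper_measurable[OF f] by simp
  have nn: "0 \<le> (\<integral>x. f x \<partial>lam)" "0 \<le> (\<integral>x. f x \<partial>delta_mix L c)"
    using f0 by (auto intro: Bochner_Integration.integral_nonneg)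
  have "ennreal (\<integral>x. f x \<partial>delta_mix L c) = (\<integral>\<^sup>+x. f x \<partial>delta_mix L c)"
    by (rule nn_integral_eq_integral[symmetric, OF finite_borel_integrable[OF finite_borel_delta_mix[OF L] f]]) (simp add: f0)
  also have "\<dots> = ennreal L * f 0 + ennreal c * (\<integral>\<^sup>+x. f x \<partial>lam)" by (rule nn_integral_delta_mix[OF L m])
  also have "(\<integral>\<^sup>+x. f x \<partial>lam) = ennreal (\<integral>x. f x \<partial>lam)"
    by (rule nn_integral_eq_integral[OF finite_borel_integrable[OF finite_borel_lam f]]) (simp add: f0)
  also have "ennreal L * ennreal (f 0) + ennreal c * ennreal (\<integral>x. f x \<partial>lam) = ennreal (L * f 0 + c * (\<integral>x. f x \<partial>lam))"
    using L c f0[of 0] nn by (simp add: ennreal_mult)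
  finally have "ennreal (\<integral>x. f x \<partial>delta_mix L c) = ennreal (L * f 0 + c * (\<integral>x. f x \<partial>lam))" .
  moreover have "0 \<le> L * f 0 + c * (\<integral>x. f x \<partial>lam)" using L c f0[of 0] nn by simp
  ultimately show ?thesis using nn by (simp only: ennreal_inj)
qed

lemma energy_delta_mix:
  assumes L: "L \<ge> 0" and c: "c \<ge> 0" and a: "H1seq a"
  shows "energy (delta_mix L c) q a = kin q a + L * (cmod (fsum a 0))\<^sup>2 + c * nsq a"
proof -
  have "cper (\<lambda>x. (cmod (fsum a x))\<^sup>2)" by (intro cper_intros H1seq_cper a)
  from integral_delta_mix[OF L c this] show ?thesis
    by (simp add: energy_def nsq_integral[OF a])
qed

text \<open>
  Reflecting the coefficients exchanges \<open>q\<close> and \<open>- q\<close> and preserves the value at \<open>0\<close>.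
\<close>

lemma ground_energy_delta_mix_even:
  assumes L: "L \<ge> 0" and c: "c \<ge> 0"
  shows "ground_energy (delta_mix L c) (- q) = ground_energy (delta_mix L c) q"
proof -
  have "ground_energy (delta_mix L c) (- q) \<le> ground_energy (delta_mix L c) q" for q
  proof (rule ground_energy_greatest)
    fix a assume a: "H1seq a" "nsq a = 1"
    define d where "d k = a (- k)" for k
    have d: "H1seq d" unfolding d_def by (rule H1seq_reflect[OF a(1)])
    have refl: "(\<Sum>\<^sub>\<infinity>k::int. h (- k)) = (\<Sum>\<^sub>\<infinity>k. h k)" for h :: "int \<Rightarrow> 'z::{comm_monoid_add, t2_space}"
      by (rule infsum_reindex_bij_witness[where i = uminus and j = uminus]) auto
    have nd: "nsq d = 1" using a(2) refl[of "\<lambda>k. (cmod (a k))\<^sup>2"] by (simp add: nsq_def d_def)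
    have "(of_int k + - q)\<^sup>2 = (of_int (- k) + q)\<^sup>2" for k by (simp add: power2_eq_square algebra_simps)
    then have detuning: "kin (- q) d = kin q a"
      using refl[of "\<lambda>k. (of_int k + q)\<^sup>2 * (cmod (a k))\<^sup>2"] by (simp only: kin_def d_def)
    have "fsum d 0 = fsum a 0" using refl[of a] by (simp add: fsum_def d_def)
    then have "energy (delta_mix L c) (- q) d = energy (delta_mix L c) q a"
      by (simp add: energy_delta_mix[OF L c] a d detuning nd)
    then show "ground_energy (delta_mix L c) (- q) \<le> energy (delta_mix L c) q a" using ground_energy_le[OF d nd, of "delta_mix L c" "- q"] by simp
  qed
  from this[of q] this[of "- q"] show ?thesis by simp
qed

lemma ground_energy_delta_mix_bounds:
  assumes L: "L \<ge> 8" and c: "c \<ge> 0" and q: "\<bar>q\<bar> < 1 / 2"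
  defines "G \<equiv> L * (1 / 4 + c - ground_energy (delta_mix L c) q)"
  shows "G \<le> 2 * pi / tau \<bar>q\<bar> + 1 / L" "2 * pi / tau \<bar>q\<bar> - 20 / L \<le> G"
proof -
  define p where "p = \<bar>q\<bar>"
  have p: "0 \<le> p" "p < 1 / 2" using q by (auto simp: p_def)
  have L0: "L \<ge> 0" using L by simp
  have gp: "ground_energy (delta_mix L c) q = ground_energy (delta_mix L c) p"
    using ground_energy_delta_mix_even[OF L0 c, of q] by (auto simp: p_def abs_if)
  define g where "g = 2 * pi / tau p"
  have t16: "tau p \<ge> 16" by (rule tau_ge(2)[OF p])
  have g: "0 \<le> g" "g \<le> 1 / 2" using t16 pi_less_4 by (auto simp: g_def divide_le_eq)
  have "1 / 4 - g * (1 + 2 / L) / L + c \<le> ground_energy (delta_mix L c) p"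
  proof (rule ground_energy_greatest)
    fix a assume "H1seq a" "nsq a = 1"
    then show "1 / 4 - g * (1 + 2 / L) / L + c \<le> energy (delta_mix L c) p a"
      using delta_comb_lower[OF p, of L a] L energy_delta_mix[OF L0 c, of a p] by (simp add: g_def)
  qed
  then have "1 / 4 + c - ground_energy (delta_mix L c) p \<le> g * (1 + 2 / L) / L" by linarith
  then have "L * (1 / 4 + c - ground_energy (delta_mix L c) p) \<le> L * (g * (1 + 2 / L) / L)" using L0 by (rule mult_left_mono)
  also have "\<dots> = g + 2 * g / L" using L by (simp add: field_simps)
  also have "2 * g / L \<le> 1 / L" using g L by (intro divide_right_mono) auto
  finally show "G \<le> 2 * pi / tau \<bar>q\<bar> + 1 / L" by (simp add: G_def gp g_def p_def)
  obtain a where a: "H1seq a" "nsq a > 0" "kin p a + L * (cmod (fsum a 0))\<^sup>2 \<le> (1 / 4 - (g - 20 / L) / L) * nsq a"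
    using delta_comb_upper[OF p L] unfolding g_def by blast
  have "ground_energy (delta_mix L c) p * nsq a \<le> energy (delta_mix L c) p a" by (rule ground_energy_scaled[OF a(1)])
  also have "\<dots> \<le> (1 / 4 - (g - 20 / L) / L + c) * nsq a"
    using a(3) by (simp add: energy_delta_mix[OF L0 c a(1)] distrib_right)
  finally have "ground_energy (delta_mix L c) p \<le> 1 / 4 - (g - 20 / L) / L + c"
    using a(2) by (simp add: mult_le_cancel_right)
  then have "(g - 20 / L) / L \<le> 1 / 4 + c - ground_energy (delta_mix L c) p" by linarith
  then have "L * ((g - 20 / L) / L) \<le> L * (1 / 4 + c - ground_energy (delta_mix L c) p)" using L0 by (rule mult_left_mono)
  moreover have "L * ((g - 20 / L) / L) = g - 20 / L" using L by simp
  ultimately show "2 * pi / tau \<bar>q\<bar> - 20 / L \<le> G" by (simp add: G_def gp g_def p_def)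
qed

section \<open>The misfit and its value for a flat band\<close>

text \<open>
  A probability measure, because the zone has length one.
\<close>

definition zone :: "real measure" where "zone = density lborel (indicator bzone)"

lemma bzone_borel [measurable]: "bzone \<in> sets borel" by (simp add: bzone_def)

lemma sets_zone [simp, measurable_cong]: "sets zone = sets borel" by (simp add: zone_def)

lemma space_zone [simp]: "space zone = UNIV" by (simp add: zone_def)

lemma emeasure_zone: "S \<in> sets borel \<Longrightarrow> emeasure zone S = emeasure lborel (bzone \<inter> S)"
  unfolding zone_def by (subst emeasure_density) (auto simp: indicator_inter_arith[symmetric])

lemma prob_zone: "prob_space zone"
  by (rule prob_spaceI) (simp add: emeasure_zone bzone_def)

lemma measure_zone: "measure zone UNIV = 1"
  using prob_space.prob_space[OF prob_zone] by simp

lemma measure_zone_interval: "0 \<le> a \<Longrightarrow> a \<le> 1 / 2 \<Longrightarrow> measure zone {a..1 / 2} = 1 / 2 - a"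
proof -
  assume a: "0 \<le> a" "a \<le> 1 / 2"
  have "bzone \<inter> {a..1 / 2} = {a..1 / 2}" using a by (auto simp: bzone_def)
  then show ?thesis using a by (simp add: measure_def emeasure_zone)
qed

lemma set_integral_zone:
  fixes f :: "real \<Rightarrow> real"
  assumes [measurable]: "f \<in> borel_measurable borel"
  shows "(LINT q:bzone|lborel. f q) = (\<integral>q. f q \<partial>zone)"
proof -
  have "(\<integral>q. f q \<partial>density lborel (\<lambda>q. ennreal (indicator bzone q))) = (\<integral>q. indicator bzone q *\<^sub>R f q \<partial>lborel)"
    by (rule integral_density) auto
  moreover have "(\<lambda>q. ennreal (indicator bzone q)) = (indicator bzone :: real \<Rightarrow> ennreal)"
    by (auto simp: fun_eq_iff indicator_def)
  ultimately show ?thesis by (simp add: zone_def set_lebesgue_integral_def)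
qed

lemma AE_zone: "AE q in zone. \<bar>q\<bar> < 1 / 2"
proof -
  have "AE q in lborel. 0 < (indicator bzone q :: ennreal) \<longrightarrow> \<bar>q\<bar> < 1 / 2"
    using AE_lborel_singleton[of "1 / 2"] AE_lborel_singleton[of "- (1 / 2)"]
    by eventually_elim (auto simp: indicator_def bzone_def)
  then show ?thesis unfolding zone_def by (subst AE_density) auto
qed

lemma zone_integrable_AE_bounded:
  fixes f :: "real \<Rightarrow> real"
  assumes "f \<in> borel_measurable borel" "\<And>q. \<bar>q\<bar> < 1 / 2 \<Longrightarrow> \<bar>f q\<bar> \<le> C"
  shows "integrable zone f"
proof -
  interpret prob_space zone by (rule prob_zone)
  have m: "f \<in> borel_measurable zone" using assms(1) by simp
  show ?thesis
    by (rule integrable_const_bound[of f C, OF _ m]) (use AE_zone in eventually_elim, use assms(2) in auto)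
qed

lemma continuous_zone_bounded:
  fixes f :: "real \<Rightarrow> real"
  assumes "continuous_on UNIV f"
  shows "\<exists>C>0. \<forall>q. \<bar>q\<bar> \<le> 1 / 2 \<longrightarrow> \<bar>f q\<bar> \<le> C"
proof -
  have "compact (f ` {-1/2..1/2})"
    using assms by (intro compact_continuous_image) (auto intro: continuous_on_subset)
  then obtain C where C: "C > 0" "\<forall>y\<in>f ` {-1/2..1/2}. norm y \<le> C"
    using compact_imp_bounded bounded_pos by blast
  have "\<bar>f q\<bar> \<le> C" if q: "\<bar>q\<bar> \<le> 1 / 2" for q
  proof -
    have "q \<in> {-1/2..1/2}" unfolding atLeastAtMost_iff using q by linarith
    then show ?thesis using C(2) by simp
  qed
  then show ?thesis using C(1) by blast
qed

lemma zone_integrable_continuous: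
  fixes f :: "real \<Rightarrow> real"
  assumes "continuous_on UNIV f"
  shows "integrable zone f"
proof -
  obtain C where "\<And>q. \<bar>q\<bar> \<le> 1 / 2 \<Longrightarrow> \<bar>f q\<bar> \<le> C" using continuous_zone_bounded[OF assms] by blast
  then show ?thesis using assms
    by (intro zone_integrable_AE_bounded[of f C] borel_measurable_continuous_onI) auto
qed

definition misfit :: "(real \<Rightarrow> real) \<Rightarrow> real measure \<Rightarrow> real"
  where "misfit \<beta> \<mu> = (\<integral>q. (\<beta> q - ground_energy \<mu> q)\<^sup>2 \<partial>zone)"

text \<open>
  The least mean square distance from \<open>\<beta>\<close> to a constant.
\<close>

definition spread :: "(real \<Rightarrow> real) \<Rightarrow> real"
  where "spread \<beta> = (\<integral>q. (\<beta> q - (\<integral>p. \<beta> p \<partial>zone))\<^sup>2 \<partial>zone)"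

text \<open>
  Chebyshev's inequality with a quantitative gain. Let \<open>q0\<close> be a point where \<open>\<beta>\<close> takes its mean \<open>m\<close>. Since \<open>\<beta>\<close> is
  increasing and \<open>g\<close> decreasing in \<open>|q|\<close>, the product \<open>(\<beta> - m) (g - g q0)\<close> is nowhere positive, and it is at most
  \<open>- \<kappa>\<close> on \<open>[q1, 1/2)\<close>, where \<open>q1\<close> is half-way between \<open>q0\<close> and \<open>1/2\<close>. So the first-order term in \<open>1/L\<close> of
  the misfit is negative and dominates the errors when \<open>L\<close> is large.
\<close>

lemma delta_mix_beats_constant:
  assumes cont: "continuous_on UNIV \<beta>" and even: "\<And>q. \<beta> (- q) = \<beta> q" and inc: "strict_mono_on {0..1/2} \<beta>"
    and mean: "(\<integral>q. \<beta> q \<partial>zone) > 1 / 4"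
  shows "\<exists>\<mu>. finite_borel \<mu> \<and> misfit \<beta> \<mu> < spread \<beta>"
proof -
  interpret prob_space zone by (rule prob_zone)
  define m where "m = (\<integral>q. \<beta> q \<partial>zone)"
  \<comment> \<open>The density that makes the limiting band equal to the mean of \<open>\<beta>\<close>.\<close>
  define c where "c = m - 1 / 4"
  have c: "c \<ge> 0" using mean by (simp add: c_def m_def)
  have io: "integrable zone \<beta>" by (rule zone_integrable_continuous[OF cont])
  have abs: "\<beta> \<bar>q\<bar> = \<beta> q" for q using even[of q] by (cases "q \<ge> 0") auto
  have mono: "\<beta> p \<le> \<beta> q" if "0 \<le> p" "p \<le> q" "q \<le> 1 / 2" for p q
    using strict_mono_onD[OF inc, of p q] that by (cases "p = q") auto
  have lo: "\<beta> 0 \<le> m"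
  proof -
    have "(\<integral>q. \<beta> 0 \<partial>zone) \<le> (\<integral>q. \<beta> q \<partial>zone)"
    proof (rule integral_mono_AE[OF _ io])
      show "AE q in zone. \<beta> 0 \<le> \<beta> q"
        using AE_zone
      proof eventually_elim
        case (elim q)
        then show ?case using mono[of 0 "\<bar>q\<bar>"] abs[of q] by simp
      qed
    qed simp
    then show ?thesis by (simp add: m_def measure_zone)
  qed
  have hi: "m < \<beta> (1 / 2)"
  proof -
    define e where "e = \<beta> (1 / 2) - \<beta> (1 / 4)"
    have e: "e > 0" using strict_mono_onD[OF inc, of "1 / 4" "1 / 2"] by (simp add: e_def)
    have ii: "integrable zone (indicator {0..1/4} :: real \<Rightarrow> real)"
      by (rule zone_integrable_AE_bounded[of _ 1]) (auto simp: indicator_def)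
    have meas: "measure zone {0..1/4} = 1 / 4"
    proof -
      have "bzone \<inter> {0..1/4} = {0..1/4::real}" by (auto simp: bzone_def)
      then show ?thesis by (simp add: measure_def emeasure_zone)
    qed
    have "m \<le> (\<integral>q. \<beta> (1 / 2) - e * indicator {0..1/4} q \<partial>zone)"
      unfolding m_def
    proof (rule integral_mono_AE[OF io])
      show "integrable zone (\<lambda>q. \<beta> (1 / 2) - e * indicator {0..1/4} q)" using ii by simp
      show "AE q in zone. \<beta> q \<le> \<beta> (1 / 2) - e * indicator {0..1/4} q"
        using AE_zone
      proof eventually_elim
        case (elim q)
        show ?case
        proof (cases "q \<in> {0..1/4}")
          case True
          then show ?thesis using mono[of q "1 / 4"] by (simp add: e_def)
        next
          case False
          then show ?thesis using mono[of "\<bar>q\<bar>" "1 / 2"] abs[of q] elim by simp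
        qed
      qed
    qed
    also have "\<dots> = \<beta> (1 / 2) - e * (1 / 4)" using ii meas by (simp add: measure_zone)
    finally show ?thesis using e by simp
  qed
  \<comment> \<open>The mean is below the maximum, so the intermediate value is attained away from \<open>1/2\<close>.\<close>
  obtain q0 where q0: "0 \<le> q0" "q0 \<le> 1 / 2" "\<beta> q0 = m"
    using IVT'[of \<beta> 0 m "1 / 2"] lo hi continuous_on_subset[OF cont] by auto
  then have q0h: "q0 < 1 / 2" using hi by (cases "q0 = 1 / 2") auto
  define q1 where "q1 = (q0 + 1 / 2) / 2"
  have q1: "q0 < q1" "q1 < 1 / 2" "0 \<le> q1" using q0 q0h by (auto simp: q1_def)
  define g where "g q = 2 * pi / tau q" for q
  have tpos: "tau q > 0" if "0 \<le> q" "q < 1 / 2" for q using tau_ge(2)[OF that] by linarith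
  have g_anti: "g q \<le> g p" if "0 \<le> p" "p \<le> q" "q < 1 / 2" for p q
    using tau_strict_mono[of p q] that tpos[of p] by (cases "p = q") (auto simp: g_def intro!: divide_left_mono mult_pos_pos)
  have g_strict: "g q1 < g q0"
    unfolding g_def using tau_strict_mono[OF q0(1) q1(1,2)] tpos[OF q0(1) q0h] 
    by (intro divide_strict_left_mono mult_pos_pos) auto
  define \<kappa> where "\<kappa> = (g q0 - g q1) * (\<beta> q1 - m)"
  have b1: "m < \<beta> q1" using strict_mono_onD[OF inc, of q0 q1] q0 q1 by simp
  have \<kappa>: "\<kappa> > 0" using g_strict b1 by (simp add: \<kappa>_def)
  have cm: "continuous_on UNIV (\<lambda>q. \<beta> q - m)" using cont by (intro continuous_intros)
  obtain C where C: "C > 0" "\<And>q. \<bar>q\<bar> \<le> 1 / 2 \<Longrightarrow> \<bar>\<beta> q - m\<bar> \<le> C"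
    using continuous_zone_bounded[OF cm] by blast
  define I where "I = \<kappa> * (1 / 2 - q1)"
  have I: "I > 0" using \<kappa> q1 by (simp add: I_def)
  \<comment> \<open>Chosen so that the gain \<open>2 I / L\<close> exceeds the total error \<open>(40 C + 9) / L\<^sup>2\<close> of the pointwise
    bound \<open>?R\<close> below.\<close>
  define L where "L = 8 + (40 * C + 9) / (2 * I)"
  have L8: "L \<ge> 8" using C(1) I by (simp add: L_def)
  have LI: "40 * C + 9 < 2 * I * L"
  proof -
    have "2 * I * L = 16 * I + (40 * C + 9)" using I by (simp add: L_def field_simps)
    then show ?thesis using I by simp
  qed
  define \<mu> where "\<mu> = delta_mix L c"
  have f\<mu>: "finite_borel \<mu>" unfolding \<mu>_def using L8 by (intro finite_borel_delta_mix) simp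
  define G where "G q = L * (1 / 4 + c - ground_energy \<mu> q)" for q
  have eq: "\<beta> q - ground_energy \<mu> q = (\<beta> q - m) + G q / L" for q
    using L8 by (simp add: G_def c_def)
  define h where "h q = (\<beta> q - m) * g q0 - \<kappa> * indicator {q1..1/2} q + 20 * C / L" for q
  let ?R = "\<lambda>q. (\<beta> q - m)\<^sup>2 + 2 / L * h q + 9 / L\<^sup>2"
  have pw: "(\<beta> q - ground_energy \<mu> q)\<^sup>2 \<le> ?R q" if q: "\<bar>q\<bar> < 1 / 2" for q
  proof -
    have G: "G q \<le> g \<bar>q\<bar> + 1 / L" "g \<bar>q\<bar> - 20 / L \<le> G q"
      using ground_energy_delta_mix_bounds[OF L8 c q] by (auto simp: G_def \<mu>_def g_def)
    have "g \<bar>q\<bar> \<le> 1 / 2" "0 \<le> g \<bar>q\<bar>"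
      using tau_ge(2)[of "\<bar>q\<bar>"] q pi_less_4 by (auto simp: g_def divide_le_eq)
    moreover have "1 / L \<le> 1 / 8" "20 / L \<le> 20 / 8" using L8 by (auto simp: divide_le_eq)
    ultimately have "\<bar>G q\<bar> \<le> 3" using G by linarith
    then have "\<bar>G q\<bar>\<^sup>2 \<le> 3\<^sup>2" by (intro power_mono) auto
    then have G2: "(G q)\<^sup>2 \<le> 9" by simp
    have Cq: "\<bar>\<beta> q - m\<bar> \<le> C" using C(2) q by simp
    have L0: "0 < 1 / L" using L8 by simp
    \<comment> \<open>The error term has a different size on the two sides of \<open>q0\<close>: the lower bound for \<open>G\<close>, with its \<open>20 / L\<close>, is used where
      \<open>\<beta> \<le> m\<close> and the upper bound, with \<open>1 / L\<close>, where \<open>\<beta> \<ge> m\<close>.\<close>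
    have cross: "(\<beta> q - m) * G q \<le> (\<beta> q - m) * g q0 - \<kappa> * indicator {q1..1/2} q + 20 * C / L"
    proof (cases "\<bar>q\<bar> < q0")
      case True
      have "\<beta> q \<le> m" using mono[of "\<bar>q\<bar>" q0] True q0 abs[of q] by simp
      moreover have "g q0 - 20 / L \<le> G q" using g_anti[of "\<bar>q\<bar>" q0] True q0h G(2) by simp
      ultimately have "(\<beta> q - m) * G q \<le> (\<beta> q - m) * (g q0 - 20 / L)" by (intro mult_left_mono_neg) auto
      also have "\<dots> = (\<beta> q - m) * g q0 + (m - \<beta> q) * (20 / L)"
        by (simp only: right_diff_distrib left_diff_distrib)
      also have "(m - \<beta> q) * (20 / L) \<le> C * (20 / L)" using Cq L8 by (intro mult_right_mono) auto
      finally show ?thesis using True q1 by (simp add: mult.commute indicator_def abs_less_iff)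
    next
      case False
      have bm: "m \<le> \<beta> q" using mono[of q0 "\<bar>q\<bar>"] False q0 q abs[of q] by simp
      have err: "(\<beta> q - m) * (1 / L) \<le> 20 * C / L"
      proof -
        have "(\<beta> q - m) * (1 / L) \<le> (20 * C) * (1 / L)" using Cq C(1) L0 by (intro mult_right_mono) auto
        then show ?thesis by simp
      qed
      show ?thesis
      proof (cases "q \<in> {q1..1/2}")
        case False
        have "g \<bar>q\<bar> \<le> g q0" using g_anti[of q0 "\<bar>q\<bar>"] \<open>\<not> \<bar>q\<bar> < q0\<close> q0 q by simp
        then have "(\<beta> q - m) * G q \<le> (\<beta> q - m) * (g q0 + 1 / L)" using G(1) bm by (intro mult_left_mono) auto
        then show ?thesis using err False by (simp add: distrib_left)
      next
        case True
        then have aq: "\<bar>q\<bar> = q" "q1 \<le> q" using q1 by auto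
        have "g \<bar>q\<bar> \<le> g q1" using g_anti[of q1 "\<bar>q\<bar>"] aq q1 q by simp
        then have "(\<beta> q - m) * G q \<le> (\<beta> q - m) * (g q1 + 1 / L)" using G(1) bm by (intro mult_left_mono) auto
        also have "\<dots> = (\<beta> q - m) * g q0 - (\<beta> q - m) * (g q0 - g q1) + (\<beta> q - m) * (1 / L)" by (simp add: algebra_simps)
        finally have 1: "(\<beta> q - m) * G q \<le> (\<beta> q - m) * g q0 - (\<beta> q - m) * (g q0 - g q1) + (\<beta> q - m) * (1 / L)" .
        have "\<beta> q1 \<le> \<beta> q" using mono[of q1 q] aq q1 q by simp
        then have "\<kappa> \<le> (\<beta> q - m) * (g q0 - g q1)"
          unfolding \<kappa>_def using g_strict by (subst mult.commute) (intro mult_right_mono, auto)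
        then show ?thesis using 1 err True by simp
      qed
    qed
    have "(\<beta> q - ground_energy \<mu> q)\<^sup>2 = (\<beta> q - m)\<^sup>2 + 2 / L * ((\<beta> q - m) * G q) + (G q)\<^sup>2 / L\<^sup>2"
      unfolding eq by (simp add: power2_sum power_divide)
    also have "\<dots> \<le> ?R q"
      using cross G2 L8 unfolding h_def by (intro add_mono mult_left_mono divide_right_mono) auto
    finally show ?thesis .
  qed
  have ii: "integrable zone (indicator {q1..1/2} :: real \<Rightarrow> real)"
    by (rule zone_integrable_AE_bounded[of _ 1]) (auto simp: indicator_def)
  have i1: "integrable zone (\<lambda>q. (\<beta> q - m)\<^sup>2)" "integrable zone (\<lambda>q. (\<beta> q - m) * g q0)" "integrable zone (\<lambda>q. (\<beta> q - ground_energy \<mu> q)\<^sup>2)"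
    using cont ground_energy_continuous[OF f\<mu>] by (auto intro!: zone_integrable_continuous continuous_intros)
  have i2: "integrable zone (\<lambda>q. \<kappa> * indicator {q1..1/2} q)" using ii by simp
  have i3: "integrable zone (\<lambda>q. (\<beta> q - m) * g q0 - \<kappa> * indicator {q1..1/2} q)" by (rule Bochner_Integration.integrable_diff[OF i1(2) i2])
  have i4: "integrable zone h" using i3 by (simp add: h_def[abs_def])
  have "misfit \<beta> \<mu> \<le> (\<integral>q. ?R q \<partial>zone)"
    unfolding misfit_def
  proof (rule integral_mono_AE[OF i1(3)])
    show "integrable zone ?R" using i1(1) i4 by (intro Bochner_Integration.integrable_add integrable_mult_right) auto
    show "AE q in zone. (\<beta> q - ground_energy \<mu> q)\<^sup>2 \<le> ?R q" using AE_zone by eventually_elim (rule pw)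
  qed
  also have "(\<integral>q. ?R q \<partial>zone) = (\<integral>q. (\<beta> q - m)\<^sup>2 \<partial>zone) + 2 / L * (\<integral>q. h q \<partial>zone) + 9 / L\<^sup>2"
    using i1(1) i4 by (simp add: measure_zone)
  also have "(\<integral>q. h q \<partial>zone) = (\<integral>q. (\<beta> q - m) * g q0 \<partial>zone) - (\<integral>q. \<kappa> * indicator {q1..1/2} q \<partial>zone) + 20 * C / L"
    unfolding h_def using i1(2) i2 i3 by (simp add: measure_zone)
  also have "(\<integral>q. (\<beta> q - m) * g q0 \<partial>zone) = 0"
    using io by (simp add: measure_zone m_def)
  also have "(\<integral>q. \<kappa> * indicator {q1..1/2} q \<partial>zone) = I"
    using measure_zone_interval[of q1] q1 by (simp add: I_def)
  finally have "misfit \<beta> \<mu> \<le> spread \<beta> + (2 / L * (0 - I + 20 * C / L) + 9 / L\<^sup>2)"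
    by (simp add: spread_def m_def)
  also have "2 / L * (0 - I + 20 * C / L) + 9 / L\<^sup>2 = (40 * C + 9 - 2 * I * L) / L\<^sup>2"
    using L8 by (simp add: field_simps power2_eq_square)
  also have "(40 * C + 9 - 2 * I * L) / L\<^sup>2 < 0" using LI L8 by (intro divide_neg_pos) auto
  finally show ?thesis using f\<mu> by auto
qed

section \<open>Existence of a minimiser\<close>

text \<open>
  A misfit at most \<open>K\<close> forces the ground energy to be at most \<open>R\<close> somewhere. If the mass were huge,
  \<open>ground_energy_flat\<close> with a small \<open>\<theta>\<close> would make the whole band constant up to \<open>18 R \<theta>\<close>, and the misfit would
  be at least \<open>spread \<beta> - D \<theta>\<close>, which exceeds \<open>K\<close>.
\<close>

lemma misfit_bounds_mass:
  assumes cont: "continuous_on UNIV \<beta>" and K: "K < spread \<beta>"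
  shows "\<exists>M. \<forall>\<mu>. finite_borel \<mu> \<longrightarrow> misfit \<beta> \<mu> \<le> K \<longrightarrow> measure \<mu> UNIV \<le> M"
proof -
  interpret prob_space zone by (rule prob_zone)
  define m where "m = (\<integral>q. \<beta> q \<partial>zone)"
  obtain C where C: "C > 0" "\<And>q. \<bar>q\<bar> \<le> 1 / 2 \<Longrightarrow> \<bar>\<beta> q\<bar> \<le> C" using continuous_zone_bounded[OF cont] by blast
  \<comment> \<open>If the ground energy exceeded \<open>R\<close> everywhere, the misfit would be at least \<open>|K| + 1 > K\<close>.\<close>
  define R where "R = C + \<bar>K\<bar> + 1"
  have R: "R > 0" using C(1) by (simp add: R_def)
  define D where "D = 2 * (C + 2 * R) * (36 * R)"
  have D: "D > 0" using C(1) R by (simp add: D_def)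
  \<comment> \<open>As \<open>2 \<pi> + 1 \<le> 9\<close>, the bound \<open>1/18\<close> makes the flatness factor \<open>1 - \<theta> (2 \<pi> + 1)\<close> at least \<open>1/2\<close>; the other
    bound gives \<open>\<theta> D < spread \<beta> - K\<close>.\<close>
  define \<theta> where "\<theta> = min (1 / 18) ((spread \<beta> - K) / (2 * D))"
  have \<theta>: "\<theta> > 0" "\<theta> \<le> 1 / 18" using K D by (auto simp: \<theta>_def)
  have \<theta>D: "\<theta> * D < spread \<beta> - K"
  proof -
    have "\<theta> * D \<le> (spread \<beta> - K) / (2 * D) * D" using D by (intro mult_right_mono) (auto simp: \<theta>_def)
    also have "\<dots> = (spread \<beta> - K) / 2" using D by simp
    also have "\<dots> < spread \<beta> - K" using K by simp
    finally show ?thesis .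
  qed
  have "measure \<mu> UNIV \<le> (2 * R + 1) / \<theta>\<^sup>2" if \<mu>: "finite_borel \<mu>" and J: "misfit \<beta> \<mu> \<le> K" for \<mu>
  proof (rule ccontr)
    assume "\<not> ?thesis"
    then have big: "2 * R + 1 < \<theta>\<^sup>2 * measure \<mu> UNIV" using \<theta> by (simp add: not_le divide_less_eq mult.commute)
    have gc: "continuous_on UNIV (ground_energy \<mu>)" by (rule ground_energy_continuous[OF \<mu>])
    have iJ: "integrable zone (\<lambda>q. (\<beta> q - ground_energy \<mu> q)\<^sup>2)"
      using cont gc by (auto intro!: zone_integrable_continuous continuous_intros)
    have "\<exists>q. \<bar>q\<bar> \<le> 1 / 2 \<and> ground_energy \<mu> q \<le> R"
    proof (rule ccontr)
      assume no: "\<not> ?thesis"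
      have "(\<integral>q. \<bar>K\<bar> + 1 \<partial>zone) \<le> (\<integral>q. (\<beta> q - ground_energy \<mu> q)\<^sup>2 \<partial>zone)"
      proof (rule integral_mono_AE[OF _ iJ])
        show "AE q in zone. \<bar>K\<bar> + 1 \<le> (\<beta> q - ground_energy \<mu> q)\<^sup>2"
          using AE_zone
        proof eventually_elim
          case (elim q)
          then have "\<bar>q\<bar> \<le> 1 / 2" by simp
          then have "ground_energy \<mu> q > R" using no not_le by blast
          moreover have "\<beta> q \<le> C" using C(2)[of q] elim by auto
          ultimately have "\<bar>K\<bar> + 1 \<le> ground_energy \<mu> q - \<beta> q" by (simp add: R_def)
          then have sq: "(\<bar>K\<bar> + 1) * (\<bar>K\<bar> + 1) \<le> (ground_energy \<mu> q - \<beta> q) * (ground_energy \<mu> q - \<beta> q)" by (intro mult_mono) auto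
          have "\<bar>K\<bar> + 1 = (\<bar>K\<bar> + 1) * 1" by simp
          also have "\<dots> \<le> (\<bar>K\<bar> + 1) * (\<bar>K\<bar> + 1)" by (intro mult_left_mono) auto
          also have "\<dots> \<le> (ground_energy \<mu> q - \<beta> q) * (ground_energy \<mu> q - \<beta> q)" by (rule sq)
          also have "\<dots> = (\<beta> q - ground_energy \<mu> q)\<^sup>2" by (simp add: power2_eq_square algebra_simps)
          finally show ?case .
        qed
      qed simp
      then show False using J by (simp add: misfit_def measure_zone)
    qed
    then obtain q0 where q0: "ground_energy \<mu> q0 \<le> R" by blast
    have pi9: "2 * pi + 1 \<le> 9" using pi_less_4 by simp
    have half: "\<theta> * (2 * pi + 1) \<le> \<theta> * 9" using \<theta> pi9 by (intro mult_left_mono) auto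
    have step: "ground_energy \<mu> q' * (1 - \<theta> * 9) \<le> ground_energy \<mu> q" if "ground_energy \<mu> q \<le> 2 * R" for q q'
    proof -
      have "ground_energy \<mu> q' * (1 - \<theta> * (2 * pi + 1)) \<le> ground_energy \<mu> q"
        by (rule ground_energy_flat[OF \<mu> \<theta>(1)]) (use that big in linarith)
      moreover have "ground_energy \<mu> q' * (1 - \<theta> * 9) \<le> ground_energy \<mu> q' * (1 - \<theta> * (2 * pi + 1))"
        using half by (intro mult_left_mono ground_energy_nonneg) auto
      ultimately show ?thesis by linarith
    qed
    have all: "ground_energy \<mu> q \<le> 2 * R" for q
    proof -
      have "ground_energy \<mu> q * (1 / 2) \<le> ground_energy \<mu> q * (1 - \<theta> * 9)" using \<theta> by (intro mult_left_mono ground_energy_nonneg) auto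
      then show ?thesis using step[of q0 q] q0 R by linarith
    qed
    have osc: "ground_energy \<mu> p \<le> ground_energy \<mu> q + 18 * R * \<theta>" for p q
    proof -
      have "ground_energy \<mu> p * (\<theta> * 9) \<le> 2 * R * (\<theta> * 9)" using all \<theta> by (intro mult_right_mono) auto
      then show ?thesis using step[OF all[of q], of p] by (simp add: algebra_simps)
    qed
    define X where "X q = \<beta> q - ground_energy \<mu> 0" for q
    have Xc: "continuous_on UNIV X" unfolding X_def using cont by (intro continuous_intros)
    have "(X q)\<^sup>2 - \<theta> * D \<le> (\<beta> q - ground_energy \<mu> q)\<^sup>2" if q: "\<bar>q\<bar> < 1 / 2" for q
    proof -
      define y where "y = ground_energy \<mu> 0 - ground_energy \<mu> q"
      have y: "\<bar>y\<bar> \<le> 18 * R * \<theta>" using osc[of 0 q] osc[of q 0] by (auto simp: y_def)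
      have "\<bar>X q\<bar> \<le> C + 2 * R" using C(2)[of q] q all[of 0] ground_energy_nonneg[of \<mu> 0] by (auto simp: X_def)
      then have "\<bar>X q\<bar> * \<bar>y\<bar> \<le> (C + 2 * R) * (18 * R * \<theta>)" using y by (intro mult_mono) auto
      then have xy: "\<bar>X q * y\<bar> \<le> (C + 2 * R) * (18 * R * \<theta>)" by (simp only: abs_mult)
      have "\<theta> * D = 2 * (2 * ((C + 2 * R) * (18 * R * \<theta>)))" by (simp add: D_def)
      moreover have "0 \<le> (C + 2 * R) * (18 * R * \<theta>)" using xy by linarith
      ultimately have "2 * \<bar>X q * y\<bar> \<le> \<theta> * D" using xy by linarith
      then have "- (2 * (X q * y)) \<le> \<theta> * D" by linarith
      moreover have "(\<beta> q - ground_energy \<mu> q)\<^sup>2 = (X q + y)\<^sup>2" by (simp add: X_def y_def)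
      moreover have "(X q + y)\<^sup>2 = (X q)\<^sup>2 + 2 * (X q * y) + y\<^sup>2" by (simp add: power2_sum)
      moreover have "0 \<le> y\<^sup>2" by simp
      ultimately show ?thesis by linarith
    qed
    then have "(\<integral>q. (X q)\<^sup>2 - \<theta> * D \<partial>zone) \<le> (\<integral>q. (\<beta> q - ground_energy \<mu> q)\<^sup>2 \<partial>zone)"
      using Xc by (intro integral_mono_AE iJ eventually_mono[OF AE_zone] zone_integrable_continuous continuous_intros) auto
    moreover have "(\<integral>q. (X q)\<^sup>2 - \<theta> * D \<partial>zone) = (\<integral>q. (X q)\<^sup>2 \<partial>zone) - \<theta> * D"
      using Xc by (subst Bochner_Integration.integral_diff) (auto intro!: zone_integrable_continuous continuous_intros simp: measure_zone)
    moreover have "spread \<beta> \<le> (\<integral>q. (X q)\<^sup>2 \<partial>zone)"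
    proof -
      define t where "t = m - ground_energy \<mu> 0"
      have i: "integrable zone (\<lambda>q. (\<beta> q - m)\<^sup>2)" "integrable zone (\<lambda>q. \<beta> q - m)"
        using cont by (auto intro!: zone_integrable_continuous continuous_intros)
      have "(X q)\<^sup>2 = (\<beta> q - m)\<^sup>2 + (2 * t) * (\<beta> q - m) + t\<^sup>2" for q
        by (simp add: X_def t_def power2_eq_square algebra_simps)
      then have "(\<integral>q. (X q)\<^sup>2 \<partial>zone) = (\<integral>q. (\<beta> q - m)\<^sup>2 \<partial>zone) + (2 * t) * (\<integral>q. \<beta> q - m \<partial>zone) + t\<^sup>2"
        using i by (simp add: measure_zone)
      moreover have "(\<integral>q. \<beta> q - m \<partial>zone) = 0"
        using zone_integrable_continuous[OF cont] by (simp add: m_def measure_zone)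
      ultimately show ?thesis by (simp add: spread_def m_def)
    qed
    ultimately show False using J \<theta>D by (simp add: misfit_def)
  qed
  then show ?thesis by blast
qed

text \<open>
  The direct method, started below \<open>spread \<beta>\<close> so that \<open>misfit_bounds_mass\<close> keeps the masses bounded. The limit
  measure need not vanish outside the half-open cell, as it may charge \<open>\<pi>\<close>; it is folded
  back when it is turned into a potential, in \<open>ground_energy_periodize\<close>.
\<close>

lemma misfit_minimiser:
  assumes cont: "continuous_on UNIV \<beta>" and \<mu>0: "finite_borel \<mu>0" "emeasure \<mu>0 (- cell) = 0" "misfit \<beta> \<mu>0 < spread \<beta>"
  shows "\<exists>\<mu>'. finite_borel \<mu>' \<and> (\<forall>\<mu>. finite_borel \<mu> \<longrightarrow> emeasure \<mu> (- cell) = 0 \<longrightarrow> misfit \<beta> \<mu>' \<le> misfit \<beta> \<mu>)"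
proof -
  interpret prob_space zone by (rule prob_zone)
  define A where "A = {\<mu>. finite_borel \<mu> \<and> emeasure \<mu> (- cell) = 0}"
  define I where "I = Inf (misfit \<beta> ` A)"
  have bdd: "bdd_below (misfit \<beta> ` A)" by (rule bdd_belowI2[of _ 0]) (simp add: misfit_def)
  have IA: "I \<le> misfit \<beta> \<mu>" if "\<mu> \<in> A" for \<mu> unfolding I_def using that bdd by (intro cInf_lower) auto
  have \<mu>0A: "\<mu>0 \<in> A" using \<mu>0 by (simp add: A_def)
  define K where "K = (I + spread \<beta>) / 2"
  have Is: "I < spread \<beta>" using IA[OF \<mu>0A] \<mu>0(3) by linarith
  then have K: "I < K" "K < spread \<beta>" by (auto simp: K_def)
  obtain M where M: "\<And>\<mu>. finite_borel \<mu> \<Longrightarrow> misfit \<beta> \<mu> \<le> K \<Longrightarrow> measure \<mu> UNIV \<le> M"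
    using misfit_bounds_mass[OF cont K(2)] by blast
  have "\<exists>\<mu>\<in>A. misfit \<beta> \<mu> < min K (I + 1 / real (Suc n))" for n
  proof -
    have "Inf (misfit \<beta> ` A) < min K (I + 1 / real (Suc n))" using K(1) by (simp add: I_def)
    then obtain y where "y \<in> misfit \<beta> ` A" "y < min K (I + 1 / real (Suc n))"
      using cInf_lessD[of "misfit \<beta> ` A"] \<mu>0A by blast
    then show ?thesis by blast
  qed
  then obtain \<mu> where \<mu>: "\<And>n. \<mu> n \<in> A" "\<And>n. misfit \<beta> (\<mu> n) < min K (I + 1 / real (Suc n))" by metis
  have f: "finite_borel (\<mu> n)" and supp: "emeasure (\<mu> n) (- cell) = 0" for n using \<mu>(1)[of n] by (auto simp: A_def)
  have mass: "measure (\<mu> n) UNIV \<le> M" for n using \<mu>(2)[of n] by (intro M f) simp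
  obtain r \<mu>' where r: "strict_mono (r :: nat \<Rightarrow> nat)" and \<mu>': "finite_borel \<mu>'" and w: "weak_limit (\<mu> \<circ> r) \<mu>'"
    using weak_compactness[of \<mu> M, OF f mass supp] by blast
  have lim: "(\<lambda>n. ground_energy (\<mu> (r n)) q) \<longlonglongrightarrow> ground_energy \<mu>' q" for q
    using ground_energy_weak_limit[of "\<mu> \<circ> r" \<mu>' M q, OF _ \<mu>' _ w] f mass by simp
  obtain C where C: "C > 0" "\<And>q. \<bar>q\<bar> \<le> 1 / 2 \<Longrightarrow> \<bar>\<beta> q\<bar> \<le> C" using continuous_zone_bounded[OF cont] by blast
  have gb: "ground_energy (\<mu> n) q \<le> 1 + M" if q: "\<bar>q\<bar> < 1 / 2" for n q
  proof -
    have "q\<^sup>2 \<le> 1" using q by (simp add: abs_square_le_1)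
    moreover have "measure (\<mu> n) UNIV / (2 * pi) \<le> M"
    proof -
      have "measure (\<mu> n) UNIV / (2 * pi) \<le> measure (\<mu> n) UNIV / 1"
        using pi_ge_two by (intro divide_left_mono) auto
      then show ?thesis using mass[of n] by simp
    qed
    ultimately show ?thesis using ground_energy_upper[OF f[of n], of q] by linarith
  qed
  have "(\<lambda>n. misfit \<beta> (\<mu> (r n))) \<longlonglongrightarrow> misfit \<beta> \<mu>'"
    unfolding misfit_def
  proof (rule integral_dominated_convergence[where w = "\<lambda>_. (C + (1 + M))\<^sup>2"])
    show "(\<lambda>q. (\<beta> q - ground_energy \<mu>' q)\<^sup>2) \<in> borel_measurable zone"
      by (intro borel_measurable_integrable zone_integrable_continuous continuous_intros cont ground_energy_continuous[OF \<mu>'])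
    show "(\<lambda>q. (\<beta> q - ground_energy (\<mu> (r n)) q)\<^sup>2) \<in> borel_measurable zone" for n
      by (intro borel_measurable_integrable zone_integrable_continuous continuous_intros cont ground_energy_continuous[OF f])
    show "AE q in zone. (\<lambda>n. (\<beta> q - ground_energy (\<mu> (r n)) q)\<^sup>2) \<longlonglongrightarrow> (\<beta> q - ground_energy \<mu>' q)\<^sup>2"
      by (intro AE_I2 tendsto_intros lim)
    show "AE q in zone. norm ((\<beta> q - ground_energy (\<mu> (r n)) q)\<^sup>2) \<le> (C + (1 + M))\<^sup>2" for n
      using AE_zone
    proof eventually_elim
      case (elim q)
      have "\<bar>\<beta> q - ground_energy (\<mu> (r n)) q\<bar> \<le> C + (1 + M)"
        using C(2)[of q] elim gb[OF elim, of "r n"] ground_energy_nonneg[of "\<mu> (r n)" q] by auto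
      then have "\<bar>\<beta> q - ground_energy (\<mu> (r n)) q\<bar>\<^sup>2 \<le> (C + (1 + M))\<^sup>2" by (intro power_mono) auto
      then show ?case by simp
    qed
  qed simp
  moreover have "(\<lambda>n. I + 1 / real (Suc (r n))) \<longlonglongrightarrow> I + 0"
    using LIMSEQ_subseq_LIMSEQ[OF LIMSEQ_Suc[OF lim_1_over_n] r] by (intro tendsto_add tendsto_const) (simp add: o_def)
  moreover have "misfit \<beta> (\<mu> (r n)) \<le> I + 1 / real (Suc (r n))" for n using \<mu>(2)[of "r n"] by simp
  ultimately have "misfit \<beta> \<mu>' \<le> I + 0" by (intro LIMSEQ_le) auto
  then have "misfit \<beta> \<mu>' \<le> misfit \<beta> \<mu>" if "finite_borel \<mu>" "emeasure \<mu> (- cell) = 0" for \<mu>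
    using IA[of \<mu>] that by (simp add: A_def)
  then show ?thesis using \<mu>' by blast
qed

lemma finite_borel_cell_measure:
  assumes "\<nu> \<in> periodic_measures"
  shows "finite_borel (cell_measure \<nu>)" "emeasure (cell_measure \<nu>) (- cell) = 0"
proof -
  have s: "sets \<nu> = sets borel" and fin: "emeasure \<nu> cell < \<infinity>" using assms by (auto simp: periodic_measures_def)
  have sp: "space \<nu> = UNIV" using s by (metis sets_eq_imp_space_eq space_borel)
  show "finite_borel (cell_measure \<nu>)"
    unfolding finite_borel_def using fin emeasure_cell_measure[OF s, of UNIV] s sp by (auto intro!: finite_measureI)
  show "emeasure (cell_measure \<nu>) (- cell) = 0"
    by (subst emeasure_cell_measure[OF s]) auto
qed

text \<open>
  The minimiser required by \<open>first_band_eq_ground_energy\<close> exists by \<open>ground_energy_attained\<close>.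
\<close>

lemma first_band_potential:
  assumes \<nu>: "\<nu> \<in> periodic_measures" and W: "is_potential_of \<nu> W"
  shows "first_band (distr_diff W (distr_of_fun (\<lambda>x. of_real B))) q = ground_energy (cell_measure \<nu>) q - B"
proof -
  have s: "sets \<nu> = sets borel" using \<nu> by (simp add: periodic_measures_def)
  obtain c where c: "H1seq c" "nsq c = 1" "energy (cell_measure \<nu>) q c = ground_energy (cell_measure \<nu>) q"
    by (rule ground_energy_attained[OF finite_borel_cell_measure(1)[OF \<nu>]])
  show ?thesis by (rule first_band_eq_ground_energy[OF s W c(1,2)]) (use c ground_energy_le in auto)
qed

lemma potentials_first_band:
  assumes "V \<in> potentials B"
  obtains \<mu> where "finite_borel \<mu>" "emeasure \<mu> (- cell) = 0" "\<And>q. first_band V q = ground_energy \<mu> q - B"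
proof -
  obtain \<nu> W where \<nu>: "\<nu> \<in> periodic_measures" and W: "is_potential_of \<nu> W" and V: "V = distr_diff W (distr_of_fun (\<lambda>x. of_real B))"
    using assms unfolding potentials_def by blast
  show ?thesis
    by (rule that[OF finite_borel_cell_measure[OF \<nu>]]) (simp only: V first_band_potential[OF \<nu> W])
qed

lemma ground_energy_periodize:
  assumes "finite_borel \<mu>"
  shows "ground_energy (cell_measure (periodize \<mu>)) q = ground_energy \<mu> q"
proof -
  have "energy (cell_measure (periodize \<mu>)) q c = energy \<mu> q c" if c: "H1seq c" for c
  proof -
    have "cper (\<lambda>x. (cmod (fsum c x))\<^sup>2)" by (intro cper_intros H1seq_cper c)
    then show ?thesis using assms unfolding energy_def finite_borel_def by (simp add: integral_periodize)
  qed
  then have "{energy (cell_measure (periodize \<mu>)) q c | c. H1seq c \<and> nsq c = 1} = {energy \<mu> q c | c. H1seq c \<and> nsq c = 1}"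
    by (intro Collect_cong ex_cong1) auto
  then show ?thesis by (simp add: ground_energy_def)
qed

lemma potential_with_band:
  assumes "finite_borel \<mu>"
  obtains V where "V \<in> potentials B" "\<And>q. first_band V q = ground_energy \<mu> q - B"
proof -
  have \<nu>: "periodize \<mu> \<in> periodic_measures" using assms by (intro periodize_periodic_measure) (auto simp: finite_borel_def)
  obtain W where W: "is_potential_of (periodize \<mu>) W" "\<And>B. distr_diff W (distr_of_fun (\<lambda>x. of_real B)) \<in> potentials B"
    using potential_of_measure[OF \<nu>] by blast
  show ?thesis
    by (rule that[OF W(2)]) (simp add: first_band_potential[OF \<nu> W(1)] ground_energy_periodize[OF assms])
qed

theorem theorem2p3:
  fixes b :: "real \<Rightarrow> real" and B :: real
  assumes "b \<in> target_bands"
    and "B > 1/4 - band_mean b"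
  shows "\<exists>V\<in>potentials B. \<forall>W\<in>potentials B. error_functional b V \<le> error_functional b W"
proof -
  interpret prob_space zone by (rule prob_zone)
  have bc: "continuous_on bzone b" and be: "\<And>q. q \<in> bzone \<Longrightarrow> b (- q) = b q" and bs: "strict_mono_on {0..1/2} b"
    using assms(1) by (auto simp: target_bands_def)
  \<comment> \<open>The retraction of the line onto the zone; \<open>\<beta>\<close> extends the shifted target band continuously to
    the whole line.\<close>
  define \<gamma> where "\<gamma> q = max (-1/2) (min (1/2) q)" for q :: real
  define \<beta> where "\<beta> q = b (\<gamma> q) + B" for q
  have \<gamma>: "\<gamma> q \<in> bzone" for q by (auto simp: \<gamma>_def bzone_def)
  have \<gamma>id: "\<gamma> q = q" if "q \<in> bzone" for q using that by (auto simp: \<gamma>_def bzone_def)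
  have cont: "continuous_on UNIV \<beta>"
    unfolding \<beta>_def
    by (intro continuous_on_add continuous_on_const continuous_on_compose2[OF bc])
       (auto simp: \<gamma>_def[abs_def] bzone_def intro!: continuous_intros)
  have even: "\<beta> (- q) = \<beta> q" for q
  proof -
    have "\<gamma> (- q) = - \<gamma> q" by (auto simp: \<gamma>_def max_def min_def)
    then show ?thesis using be[OF \<gamma>[of q]] by (simp add: \<beta>_def)
  qed
  have inc: "strict_mono_on {0..1/2} \<beta>"
    using bs \<gamma>id by (auto simp: strict_mono_on_def \<beta>_def bzone_def)
  have bm: "(\<lambda>q. \<beta> q - B) \<in> borel_measurable borel"
    using cont by (intro borel_measurable_continuous_onI continuous_intros)
  have "band_mean b = (LINT q:bzone|lborel. \<beta> q - B)"
    unfolding band_mean_def by (rule set_lebesgue_integral_cong) (auto simp: \<beta>_def \<gamma>id)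
  also have "\<dots> = (\<integral>q. \<beta> q - B \<partial>zone)" by (rule set_integral_zone[OF bm])
  also have "\<dots> = (\<integral>q. \<beta> q \<partial>zone) - B"
    using zone_integrable_continuous[OF cont] by (simp add: measure_zone)
  finally have mean: "(\<integral>q. \<beta> q \<partial>zone) > 1 / 4" using assms(2) by simp
  have err: "error_functional b V = 1 / 2 * misfit \<beta> \<mu>" if \<mu>: "finite_borel \<mu>" and fb: "\<And>q. first_band V q = ground_energy \<mu> q - B" for V \<mu>
  proof -
    have m: "(\<lambda>q. (\<beta> q - ground_energy \<mu> q)\<^sup>2) \<in> borel_measurable borel"
      using cont ground_energy_continuous[OF \<mu>] by (intro borel_measurable_continuous_onI continuous_intros)
    have "(LINT q:bzone|lborel. \<bar>b q - first_band V q\<bar>\<^sup>2) = (LINT q:bzone|lborel. (\<beta> q - ground_energy \<mu> q)\<^sup>2)"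
      by (rule set_lebesgue_integral_cong) (auto simp: \<beta>_def \<gamma>id fb algebra_simps)
    also have "\<dots> = misfit \<beta> \<mu>" unfolding misfit_def by (rule set_integral_zone[OF m])
    finally show ?thesis by (simp add: error_functional_def)
  qed
  obtain \<mu>1 where \<mu>1: "finite_borel \<mu>1" "misfit \<beta> \<mu>1 < spread \<beta>"
    using delta_mix_beats_constant[OF cont even inc mean] by blast
  have \<nu>: "periodize \<mu>1 \<in> periodic_measures" using \<mu>1 by (intro periodize_periodic_measure) (auto simp: finite_borel_def)
  have "misfit \<beta> (cell_measure (periodize \<mu>1)) < spread \<beta>"
    using \<mu>1 by (simp add: misfit_def ground_energy_periodize)
  then obtain \<mu> where \<mu>: "finite_borel \<mu>" "\<And>\<mu>'. finite_borel \<mu>' \<Longrightarrow> emeasure \<mu>' (- cell) = 0 \<Longrightarrow> misfit \<beta> \<mu> \<le> misfit \<beta> \<mu>'"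
    using misfit_minimiser[OF cont finite_borel_cell_measure[OF \<nu>]] by blast
  obtain V where V: "V \<in> potentials B" "\<And>q. first_band V q = ground_energy \<mu> q - B" using potential_with_band[OF \<mu>(1)] by blast
  have "error_functional b V \<le> error_functional b W" if W: "W \<in> potentials B" for W
  proof -
    obtain \<mu>' where \<mu>': "finite_borel \<mu>'" "emeasure \<mu>' (- cell) = 0" "\<And>q. first_band W q = ground_energy \<mu>' q - B"
      using potentials_first_band[OF W] by blast
    show ?thesis using \<mu>(2)[OF \<mu>'(1,2)] err[OF \<mu>(1) V(2)] err[OF \<mu>'(1,3)] by simp
  qed
  then show ?thesis using V(1) by blast
qed

end
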